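(* Let $n,d\in\mathbb{N}$, let $U\subseteq F^d$ be open, and let $\mathbf{f}=(f_1,\dots,f_n): U\to F^n$ be a map which is $(C,\alpha_0)$-good on $U$ with respect to $\lambda$ for some $C,\alpha_0>0$. Assume that $(\mathbf{f},\lambda)$ is nonplanar. Then, for every $\theta\in F$, for $\lambda$-almost every $\mathbf{x}\in U$, $$\omega(\mathbf{f}(\mathbf{x}),\theta)\le 1.$$ (The exceptional null set may depend on $\theta$.)
   Context: Let $p$ be a prime, $q=p^r$ with $r\in\mathbb{N}$, $\Lambda=\mathbb{F}_q[T]$ and $F=\mathbb{F}_q((T^{-1}))$, the field of Laurent series in $T^{-1}$ over $\mathbb{F}_q$. For nonzero $a=\sum_{k\le k_0}a_kT^k\in F$ with $a_k\in\mathbb{F}_q$ and $a_{k_0}\ne 0$, put $|a|=e^{k_0}$, and $|0|=0$. This is a non-archimedean absolute value on $F$. The space $F^d$ carries the supremum norm $\|\mathbf{x}\|=\max_{1\le i\le d}|x_i|$ and the induced metric and topology. $\lambda$ denotes the Haar measure on $F^d$ giving measure $1$ to the closed unit ball $\{\|\mathbf{x}\|\le 1\}$. Exponent. For $\mathbf{y}\in F^n$ (viewed as a single linear form, i.e. a $1\times n$ matrix) and $\theta\in F$, the inhomogeneous exponent $\omega(\mathbf{y},\theta)$ is the supremum (possibly $+\infty$) of the real numbers $\omega$ for which, for arbitrarily large $t\in\mathbb{N}$, the inequalities $$|\mathbf{y}\cdot\mathbf{q}-p_0-\theta|<e^{-n\omega t},\qquad \|\mathbf{q}\|<e^{t}$$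 have a solution $(p_0,\mathbf{q})\in\Lambda\times(\Lambda^n\setminus\{\mathbf{0}\})$, where $\mathbf{y}\cdot\mathbf{q}=\sum_{i=1}^n y_iq_i$. Good maps. A function $g:U\to F$ with $|g|$ measurable is $(C,\alpha)$-good on $U$ with respect to $\lambda$ if for every ball $B\subseteq U$ and every $\varepsilon>0$, $$\lambda(\{\mathbf{x}\in B:|g(\mathbf{x})|<\varepsilon\})\le C\left(\frac{\varepsilon}{\sup_{\mathbf{x}\in B}|g(\mathbf{x})|}\right)^{\alpha}\lambda(B)$$ (the condition being vacuous when the supremum is $0$). The map $\mathbf{f}=(f_1,\dots,f_n)$ is $(C,\alpha)$-good on $U$ with respect to $\lambda$ if every $F$-linear combination of $1,f_1,\dots,f_n$ is $(C,\alpha)$-good on $U$ with respect to $\lambda$. Nonplanarity. $(\mathbf{f},\lambda)$ is nonplanar at $\mathbf{x}_0\in U$ if for every ball $B\subseteq U$ centered at $\mathbf{x}_0$ the restrictions of $1,f_1,\dots,f_n$ to $B$ are linearly independent over $F$. $(\mathbf{f},\lambda)$ is nonplanar if it is nonplanar at $\lambda$-almost every point of $U$. *)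

theory Defs
  imports
    "HOL-Analysis.Analysis"
    "HOL-Computational_Algebra.Formal_Laurent_Series"
begin

unbundle no fps_syntax

text \<open>
  For a finite field \<open>'k\<close>, the field of Laurent series in \<open>1/T\<close> over \<open>'k\<close> is represented by
  \<open>'k fls\<close>, where the variable \<open>fls_X\<close> stands for \<open>1/T\<close>.  Hence the coefficient of \<open>T ^ k\<close> in
  \<open>a\<close> is \<open>fls_nth a (- k)\<close>, and the leading exponent of a nonzero \<open>a\<close> in \<open>T\<close> is
  \<open>- fls_subdegree a\<close>.
\<close>

definition fls_abs :: "'k::field fls \<Rightarrow> real" where
  "fls_abs a = (if a = 0 then 0 else exp (- real_of_int (fls_subdegree a)))"

definition sup_norm :: "'k::field fls ^ 'd \<Rightarrow> real" where
  "sup_norm x = Max (range (\<lambda>i. fls_abs (x $ i)))"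

definition sup_ball :: "'k::field fls ^ 'd \<Rightarrow> real \<Rightarrow> ('k fls ^ 'd) set" where
  "sup_ball c r = {x. sup_norm (x - c) < r}"

text \<open>The inclusion of the polynomial ring in \<open>T\<close> over \<open>'k\<close>: evaluation at \<open>T = inverse fls_X\<close>.\<close>

definition poly_in_T :: "'k::field poly \<Rightarrow> 'k fls" where
  "poly_in_T p = poly (map_poly fls_const p) fls_X_inv"

lemma fls_nth_poly_in_T:
  "fls_nth (poly_in_T p) k = (if k \<le> 0 then coeff p (nat (- k)) else 0)"
proof (induction p arbitrary: k)
  case 0
  then show ?case by (simp add: poly_in_T_def)
next
  case (pCons a p)
  have "poly_in_T (pCons a p) = fls_const a + fls_X_inv * poly_in_T p"
    using pCons.hyps by (simp add: poly_in_T_def map_poly_pCons)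
  then show ?case
    by (cases "k = 0"; cases "k < 0")
       (simp_all add: fls_X_inv_times_conv_shift pCons.IH coeff_pCons' nat_diff_distrib)
qed

text \<open>
  The library metric on \<open>'k fls\<close> uses base 2 instead of base \<open>exp 1\<close>; the lemma below shows that
  the library topology on the product space is nevertheless the one induced by \<open>sup_norm\<close>.
\<close>

lemma sup_norm_less_iff: "sup_norm (x :: 'k::field fls ^ 'd) < r \<longleftrightarrow> (\<forall>i. fls_abs (x $ i) < r)"
  unfolding sup_norm_def by (subst Max_less_iff) auto

lemma fls_abs_eq_dist_powr: "fls_abs (a - b) = dist a b powr (1 / ln 2)"
  for a b :: "'k::field fls"
proof (cases "a = b")
  case False
  have "dist a b = 2 powr (- real_of_int (fls_subdegree (a - b)))"
  proof (cases "fls_subdegree (a - b) \<ge> 0")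
    case True
    then show ?thesis
      using False by (simp add: dist_fls_def powr_minus flip: powr_realpow)
  next
    case nonpos: False
    then show ?thesis
      using False by (simp add: dist_fls_def flip: powr_realpow)
  qed
  then show ?thesis
    using False by (simp add: fls_abs_def powr_powr powr_def)
qed (simp add: fls_abs_def)

lemma fls_abs_less_iff_dist:
  assumes "r > 0"
  shows "fls_abs (a - b) < r \<longleftrightarrow> dist a b < r powr ln 2"
proof -
  have eq: "fls_abs (a - b) powr ln 2 = dist a b"
    by (simp add: fls_abs_eq_dist_powr powr_powr)
  have nonneg: "fls_abs (a - b) \<ge> 0" by (simp add: fls_abs_def)
  have "fls_abs (a - b) < r \<longleftrightarrow> fls_abs (a - b) powr ln 2 < r powr ln 2"
  proof
    assume "fls_abs (a - b) < r"
    then show "fls_abs (a - b) powr ln 2 < r powr ln 2"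
      using nonneg by (intro powr_less_mono2) auto
  next
    assume *: "fls_abs (a - b) powr ln 2 < r powr ln 2"
    show "fls_abs (a - b) < r"
    proof (rule ccontr)
      assume "\<not> fls_abs (a - b) < r"
      then have "r powr ln 2 \<le> fls_abs (a - b) powr ln 2"
        using assms by (intro powr_mono2) auto
      with * show False by simp
    qed
  qed
  then show ?thesis by (simp add: eq)
qed

lemma open_iff_sup_ball:
  fixes U :: "('k::field fls ^ 'd) set"
  shows "open U \<longleftrightarrow> (\<forall>x\<in>U. \<exists>r>0. sup_ball x r \<subseteq> U)"
proof
  assume U: "open U"
  show "\<forall>x\<in>U. \<exists>r>0. sup_ball x r \<subseteq> U"
  proof
    fix x assume "x \<in> U"
    then obtain e where e: "e > 0" "\<And>y. dist y x < e \<Longrightarrow> y \<in> U"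
      using U by (auto simp: open_dist)
    define s where "s = e / (2 * real CARD('d))"
    have s: "s > 0" using e(1) by (simp add: s_def)
    have "sup_ball x (s powr (1 / ln 2)) \<subseteq> U"
    proof
      fix y assume y: "y \<in> sup_ball x (s powr (1 / ln 2))"
      have "dist (y $ i) (x $ i) < s" for i
        using y s by (simp add: sup_ball_def sup_norm_less_iff fls_abs_less_iff_dist powr_powr)
      then have "(\<Sum>i\<in>UNIV. dist (y $ i) (x $ i)) \<le> (\<Sum>i\<in>(UNIV::'d set). s)"
        by (intro sum_mono less_imp_le)
      also have "\<dots> < e" using e(1) by (simp add: s_def)
      finally have "dist y x < e"
        unfolding dist_vec_def by (intro le_less_trans[OF L2_set_le_sum]) auto
      then show "y \<in> U" by (rule e(2))
    qed
    then show "\<exists>r>0. sup_ball x r \<subseteq> U" using s by (intro exI[of _ "s powr (1 / ln 2)"]) auto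
  qed
next
  assume *: "\<forall>x\<in>U. \<exists>r>0. sup_ball x r \<subseteq> U"
  show "open U"
    unfolding open_dist
  proof
    fix x assume "x \<in> U"
    then obtain r where r: "r > 0" "sup_ball x r \<subseteq> U" using * by auto
    have "y \<in> sup_ball x r" if "dist y x < r powr ln 2" for y
      using that r(1) dist_vec_nth_le[of y _ x]
      by (auto simp: sup_ball_def sup_norm_less_iff fls_abs_less_iff_dist intro: le_less_trans)
    then show "\<exists>e>0. \<forall>y. dist y x < e \<longrightarrow> y \<in> U"
      using r by (intro exI[of _ "r powr ln 2"]) auto
  qed
qed

text \<open>
  The Haar measure on the Borel sets, characterised by translation invariance and its
  normalisation.  Since every compact set is covered by finitely many translates of the closed unit
  ball, local finiteness is automatic.
\<close>

definition is_haar_measure :: "('k::field fls ^ 'd) measure \<Rightarrow> bool" where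
  "is_haar_measure \<mu> \<longleftrightarrow>
     sets \<mu> = sets borel \<and>
     (\<forall>v. \<forall>A\<in>sets \<mu>. emeasure \<mu> ((\<lambda>x. v + x) ` A) = emeasure \<mu> A) \<and>
     emeasure \<mu> {x. sup_norm x \<le> 1} = 1"

definition inhom_exponent :: "'k::field fls ^ 'n \<Rightarrow> 'k fls \<Rightarrow> ereal" where
  "inhom_exponent y \<theta> =
     (SUP \<omega> \<in> {\<omega> :: real.
        \<forall>N::nat. \<exists>t\<ge>N. \<exists>(p0 :: 'k poly) (q :: 'k poly ^ 'n). q \<noteq> 0 \<and>
          fls_abs ((\<Sum>i\<in>UNIV. y $ i * poly_in_T (q $ i)) - poly_in_T p0 - \<theta>)
            < exp (- (real CARD('n) * \<omega> * real t)) \<and>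
          sup_norm (\<chi> i. poly_in_T (q $ i)) < exp (real t)}. ereal \<omega>)"

text \<open>
  Measurability is understood with respect to the completion of \<open>\<mu>\<close>, which includes the Borel
  measurable case.  The supremum is taken in the extended nonnegative reals; where it is infinite,
  the quotient \<open>\<epsilon> / sup\<close> is \<open>0\<close>.
\<close>

definition good_fun ::
    "('k::field fls ^ 'd) measure \<Rightarrow> real \<Rightarrow> real \<Rightarrow> ('k fls ^ 'd) set \<Rightarrow>
     ('k fls ^ 'd \<Rightarrow> 'k fls) \<Rightarrow> bool" where
  "good_fun \<mu> C \<alpha> U g \<longleftrightarrow>
     (\<lambda>x. fls_abs (g x)) \<in> borel_measurable (restrict_space (completion \<mu>) U) \<and>
     (\<forall>c r \<epsilon>. r > 0 \<longrightarrow> sup_ball c r \<subseteq> U \<longrightarrow> \<epsilon> > 0 \<longrightarrow>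
        (let S = (SUP x \<in> sup_ball c r. ennreal (fls_abs (g x))) in
         S \<noteq> 0 \<longrightarrow>
         emeasure (completion \<mu>) {x \<in> sup_ball c r. fls_abs (g x) < \<epsilon>}
           \<le> ennreal (C * enn2real (ennreal \<epsilon> / S) powr \<alpha>) *
              emeasure (completion \<mu>) (sup_ball c r)))"

definition good_map ::
    "('k::field fls ^ 'd) measure \<Rightarrow> real \<Rightarrow> real \<Rightarrow> ('k fls ^ 'd) set \<Rightarrow>
     ('k fls ^ 'd \<Rightarrow> 'k fls ^ 'n) \<Rightarrow> bool" where
  "good_map \<mu> C \<alpha> U f \<longleftrightarrow>
     (\<forall>(a0 :: 'k fls) (a :: 'k fls ^ 'n).
        good_fun \<mu> C \<alpha> U (\<lambda>x. a0 + (\<Sum>i\<in>UNIV. a $ i * f x $ i)))"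

definition nonplanar_at ::
    "('k::field fls ^ 'd) set \<Rightarrow> ('k fls ^ 'd \<Rightarrow> 'k fls ^ 'n) \<Rightarrow> 'k fls ^ 'd \<Rightarrow> bool" where
  "nonplanar_at U f x0 \<longleftrightarrow>
     (\<forall>r>0. sup_ball x0 r \<subseteq> U \<longrightarrow>
        (\<forall>(a0 :: 'k fls) (a :: 'k fls ^ 'n).
           (\<forall>x\<in>sup_ball x0 r. a0 + (\<Sum>i\<in>UNIV. a $ i * f x $ i) = 0) \<longrightarrow>
           a0 = 0 \<and> (\<forall>i. a $ i = 0)))"

definition nonplanar ::
    "('k::field fls ^ 'd) measure \<Rightarrow> ('k fls ^ 'd) set \<Rightarrow>
     ('k fls ^ 'd \<Rightarrow> 'k fls ^ 'n) \<Rightarrow> bool" where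
  "nonplanar \<mu> U f \<longleftrightarrow> (AE x in \<mu>. x \<in> U \<longrightarrow> nonplanar_at U f x)"

end

(*
  Homogeneous part, after Kleinbock and Margulis.  Solutions (p, q) of |f(x).q + p| < e^(-n(1+d/2)t),
  |q| < e^t are vectors of norm less than e^(-dt/4) in the image of the lattice of polynomial vectors
  under a shear given by f(x) followed by a diagonal weight of determinant 1.  The covolume of each
  sublattice is, as a function of x, a maximum of good functions, and by nonplanarity it is bounded
  below somewhere on every small ball around almost every point.  Choosing repeatedly the largest ball
  on which some sublattice has small covolume, one finds, outside a set of measure O(e^(-ct)), a flag
  of sublattices which excludes short vectors.

  Inhomogeneous part, after Beresnevich and Velani.  Two different solutions of
  |f(x).q - p - theta| < e^(-n(1+d/2)t) differ by a homogeneous one, so outside the exceptional set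
  above the balls on which such inequalities hold are disjoint for different (p, q).  On each of them
  goodness bounds the proportion of points with the stronger inequality, exponent 1+d, by
  O(e^(-ct)).  The Borel-Cantelli lemma concludes.

  The coordinates of f need not be continuous.  A density argument shows that the points at which a
  good function is small but not small on any ball around them form a null set.
*)
theory Submission
  imports Defs
begin

unbundle no fps_syntax

subsection \<open>Absolute value and polynomials\<close>

text \<open>Goodness gives measurability only in the completion, so the estimates are made for the
  outer measure of \<open>lam\<close>, and no exceptional set has to be shown measurable. Balls are
  nested or disjoint, so the maximal balls with a given property partition their union. Such a ball
  is compared with the next larger one, on which the property fails and goodness applies; this costs
  the factor \<open>cell_index\<close>, the number |k|^d of subballs. The lower bounds must hold for
  all sublattices at once. They come from discreteness: coordinates of covolumes are affine in f(x)
  with polynomial coefficients, and a nonzero polynomial has absolute value at least 1, so one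
  constant per ball suffices. Adding a vector to a basis of a primitive lattice need not give a
  basis of a primitive lattice. Subspaces are therefore represented by bases with least
  determinants. The exponent 1+d/2 separates two gains: its excess over 1 makes homogeneous
  solutions rare, and its distance from 1+d gives goodness the ratio e^(-ndt/2).\<close>

lemma fls_abs_nonneg [simp]: "fls_abs a \<ge> 0"
  by (simp add: fls_abs_def)

lemma fls_abs_0 [simp]: "fls_abs 0 = 0"
  by (simp add: fls_abs_def)

lemma fls_abs_1 [simp]: "fls_abs 1 = 1"
  by (simp add: fls_abs_def)

lemma fls_abs_eq_0_iff [simp]: "fls_abs a = 0 \<longleftrightarrow> a = 0"
  by (simp add: fls_abs_def)

lemma fls_abs_minus [simp]: "fls_abs (- a) = fls_abs a"
  by (simp add: fls_abs_def)

lemma fls_abs_mult: "fls_abs (a * b) = fls_abs a * fls_abs b"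
  by (simp add: fls_abs_def mult_exp_exp)

lemma fls_abs_add: "fls_abs (a + b) \<le> max (fls_abs a) (fls_abs b)"
proof (cases "a = 0 \<or> b = 0 \<or> a + b = 0")
  case True
  then show ?thesis
    by (auto simp: le_max_iff_disj)
next
  case False
  then have "fls_subdegree (a + b) \<ge> min (fls_subdegree a) (fls_subdegree b)"
    by (intro fls_plus_subdegree) auto
  with False show ?thesis
    by (auto simp: fls_abs_def le_max_iff_disj min_le_iff_disj)
qed

lemma fls_abs_diff: "fls_abs (a - b) \<le> max (fls_abs a) (fls_abs b)"
  using fls_abs_add[of a "- b"] by simp

lemma fls_abs_sum_le:
  assumes "\<And>i. i \<in> I \<Longrightarrow> fls_abs (g i) \<le> B" and "B \<ge> 0"
  shows "fls_abs (sum g I) \<le> B"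
  using assms
proof (induction I rule: infinite_finite_induct)
  case (insert i I)
  then have "max (fls_abs (g i)) (fls_abs (sum g I)) \<le> B"
    by auto
  with fls_abs_add[of "g i" "sum g I"] show ?case
    using insert.hyps by (auto intro: order_trans)
qed auto

text \<open>The nonzero values of \<open>fls_abs\<close> are the integral powers of e, so the strict
  bound forces the subdegree to be at least \<open>m + 1\<close>: the coefficient at
  \<open>int m\<close> vanishes as well.\<close>

lemma fls_abs_less_exp_iff:
  "fls_abs a < exp (- real m) \<longleftrightarrow> (\<forall>k\<le>int m. fls_nth a k = 0)"
proof (cases "a = 0")
  case False
  have "fls_abs a < exp (- real m) \<longleftrightarrow> int m < fls_subdegree a"
    using False of_int_less_iff[of "int m" "fls_subdegree a", where 'a = real]
    by (simp add: fls_abs_def del: of_int_less_iff)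
  also have "\<dots> \<longleftrightarrow> (\<forall>k\<le>int m. fls_nth a k = 0)"
  proof
    assume *: "\<forall>k\<le>int m. fls_nth a k = 0"
    show "int m < fls_subdegree a"
    proof (rule ccontr)
      assume "\<not> int m < fls_subdegree a"
      then have "fls_nth a (fls_subdegree a) = 0"
        using * by (meson not_less)
      with False show False
        by (simp add: nth_fls_subdegree_zero_iff)
    qed
  qed auto
  finally show ?thesis .
qed auto

lemma poly_in_T_eqI: "(\<And>k. coeff p k = fls_nth a (- int k)) \<Longrightarrow> (\<And>k. k > 0 \<Longrightarrow> fls_nth a k = 0) \<Longrightarrow> poly_in_T p = a"
  by (intro fls_eqI) (auto simp: fls_nth_poly_in_T)

lemma poly_in_T_0 [simp]: "poly_in_T 0 = 0"
  by (intro poly_in_T_eqI) auto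

lemma poly_in_T_eq_0_iff [simp]: "poly_in_T p = 0 \<longleftrightarrow> p = 0"
proof
  assume "poly_in_T p = 0"
  then have "coeff p k = 0" for k
    using fls_nth_poly_in_T[of p "- int k"] by simp
  then show "p = 0"
    by (intro poly_eqI) auto
qed auto

lemma poly_in_T_add: "poly_in_T (p + q) = poly_in_T p + poly_in_T q"
  by (intro fls_eqI) (auto simp: fls_nth_poly_in_T)

lemma poly_in_T_uminus: "poly_in_T (- p) = - poly_in_T p"
  by (intro fls_eqI) (auto simp: fls_nth_poly_in_T)

lemma poly_in_T_diff: "poly_in_T (p - q) = poly_in_T p - poly_in_T q"
  by (intro fls_eqI) (auto simp: fls_nth_poly_in_T)

lemma poly_in_T_pCons: "poly_in_T (pCons a p) = fls_const a + fls_X_inv * poly_in_T p"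
  by (cases "pCons a p = 0") (auto simp: poly_in_T_def map_poly_pCons)

lemma poly_in_T_smult: "poly_in_T (smult a p) = fls_const a * poly_in_T p"
  by (intro fls_eqI) (auto simp: fls_nth_poly_in_T)

lemma poly_in_T_mult: "poly_in_T (p * q) = poly_in_T p * poly_in_T q"
  by (induction p) (simp_all add: poly_in_T_pCons poly_in_T_add poly_in_T_smult algebra_simps)

lemma poly_in_T_1 [simp]: "poly_in_T 1 = 1"
  by (simp add: one_pCons poly_in_T_pCons)

lemma fls_abs_poly_in_T: "p \<noteq> 0 \<Longrightarrow> fls_abs (poly_in_T p) = exp (real (degree p))"
proof -
  assume p: "p \<noteq> 0"
  have "fls_subdegree (poly_in_T p) = - int (degree p)"
    using p by (intro fls_subdegree_eqI) (auto simp: fls_nth_poly_in_T coeff_eq_0)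
  with p show ?thesis
    by (simp add: fls_abs_def)
qed

section \<open>The polynomial ring as a discrete, countable subset of the field\<close>

definition fls_polys :: "'k::field fls set" where
  "fls_polys = range poly_in_T"

lemma fls_polys_0 [simp]: "0 \<in> fls_polys" and fls_polys_1 [simp]: "1 \<in> fls_polys"
  and fls_polys_poly_in_T [simp]: "poly_in_T p \<in> fls_polys"
  unfolding fls_polys_def by (metis poly_in_T_0 rangeI, metis poly_in_T_1 rangeI, simp)

lemma fls_polys_add: "a \<in> fls_polys \<Longrightarrow> b \<in> fls_polys \<Longrightarrow> a + b \<in> fls_polys"
  unfolding fls_polys_def by (auto simp flip: poly_in_T_add)

lemma fls_polys_uminus: "a \<in> fls_polys \<Longrightarrow> - a \<in> fls_polys"
  unfolding fls_polys_def by (auto simp flip: poly_in_T_uminus)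

lemma fls_polys_mult: "a \<in> fls_polys \<Longrightarrow> b \<in> fls_polys \<Longrightarrow> a * b \<in> fls_polys"
  unfolding fls_polys_def by (auto simp flip: poly_in_T_mult)

lemma fls_polys_sum: "(\<And>i. i \<in> I \<Longrightarrow> g i \<in> fls_polys) \<Longrightarrow> sum g I \<in> fls_polys"
  by (induction I rule: infinite_finite_induct) (auto intro: fls_polys_add)

lemma fls_polys_prod: "(\<And>i. i \<in> I \<Longrightarrow> g i \<in> fls_polys) \<Longrightarrow> prod g I \<in> fls_polys"
  by (induction I rule: infinite_finite_induct) (auto intro: fls_polys_mult)

text \<open>Discreteness of the ring. It turns nonvanishing of a polynomial coefficient or
  determinant into a lower bound.\<close>

lemma fls_polys_abs_ge_1: "a \<in> fls_polys \<Longrightarrow> a \<noteq> 0 \<Longrightarrow> fls_abs a \<ge> 1"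
  unfolding fls_polys_def by (auto simp: fls_abs_poly_in_T)

lemma countable_UNIV_poly: "countable (UNIV :: 'a::{zero,countable} poly set)"
proof -
  have "(UNIV :: 'a poly set) = range Poly"
    by (metis Poly_coeffs surjI)
  then show ?thesis
    by (metis countableI_type countable_image)
qed

lemma countable_fls_polys: "countable (fls_polys :: 'k::{field,finite} fls set)"
  unfolding fls_polys_def by (intro countable_image countable_UNIV_poly)

lemma countable_vec_in:
  assumes "countable A"
  shows "countable {v :: 'a ^ 'n. \<forall>i. v $ i \<in> A}"
proof -
  have "countable (PiE (UNIV :: 'n set) (\<lambda>_. A))"
    using assms by (intro countable_PiE) auto
  then have "countable (vec_lambda ` (PiE (UNIV :: 'n set) (\<lambda>_. A)))"
    by (rule countable_image)
  moreover have "{v :: 'a ^ 'n. \<forall>i. v $ i \<in> A} \<subseteq> vec_lambda ` (PiE (UNIV :: 'n set) (\<lambda>_. A))"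
  proof
    fix v :: "'a ^ 'n" assume "v \<in> {v. \<forall>i. v $ i \<in> A}"
    then have "vec_nth v \<in> PiE UNIV (\<lambda>_. A)" by auto
    then show "v \<in> vec_lambda ` (PiE (UNIV :: 'n set) (\<lambda>_. A))"
      by (metis image_eqI vec_nth_inverse)
  qed
  ultimately show ?thesis
    by (rule countable_subset[rotated])
qed

subsection \<open>Cells\<close>

text \<open>Since the nonzero values are the powers of e, every ball of radius at most 1 has this
  form. Natural levels have two uses: measures stay at most 1, and \<open>LEAST\<close> selects a
  largest ball.\<close>

definition cell :: "'k::field fls ^ 'd \<Rightarrow> nat \<Rightarrow> ('k fls ^ 'd) set" where
  "cell c m = sup_ball c (exp (- real m))"

lemma mem_cell_iff: "x \<in> cell c m \<longleftrightarrow> (\<forall>i. fls_abs (x $ i - c $ i) < exp (- real m))"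
  by (simp add: cell_def sup_ball_def sup_norm_less_iff)

lemma mem_cell_self [simp]: "c \<in> cell c m"
  by (simp add: mem_cell_iff)

text \<open>By the ultrametric inequality every point of a ball is a centre of it; hence two cells
  are nested or disjoint.\<close>

lemma cell_eq:
  assumes "x \<in> cell c m"
  shows "cell c m = cell x m"
proof -
  have *: "cell a m \<subseteq> cell b m" if "a \<in> cell b m" for a b :: "'a fls ^ 'b"
  proof
    fix y assume "y \<in> cell a m"
    show "y \<in> cell b m"
      unfolding mem_cell_iff
    proof
      fix i
      have "fls_abs (y $ i - b $ i) \<le> max (fls_abs (y $ i - a $ i)) (fls_abs (a $ i - b $ i))"
        using fls_abs_add[of "y $ i - a $ i" "a $ i - b $ i"] by simp
      also have "\<dots> < exp (- real m)"
        using that \<open>y \<in> cell a m\<close> by (simp add: mem_cell_iff)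
      finally show "fls_abs (y $ i - b $ i) < exp (- real m)" .
    qed
  qed
  have "c \<in> cell x m"
    using assms unfolding mem_cell_iff
    by (metis fls_abs_minus minus_diff_eq)
  with * assms show ?thesis
    by blast
qed

lemma cell_antimono: "m \<le> m' \<Longrightarrow> cell x m' \<subseteq> cell x m"
  unfolding mem_cell_iff subset_iff
  by (auto intro: less_le_trans)

lemma cell_eq': "x \<in> cell c m' \<Longrightarrow> m \<le> m' \<Longrightarrow> cell c m = cell x m"
  using cell_antimono cell_eq by blast

lemma open_cell [simp]: "open (cell c m)"
  unfolding open_iff_sup_ball
proof
  fix x assume "x \<in> cell c m"
  then have "sup_ball x (exp (- real m)) \<subseteq> cell c m"
    using cell_eq by (metis cell_def order_refl)
  then show "\<exists>r>0. sup_ball x r \<subseteq> cell c m"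
    by (intro exI[of _ "exp (- real m)"]) auto
qed

lemma closed_cell [simp]: "closed (cell c m)"
  unfolding closed_def open_iff_sup_ball
proof safe
  fix x assume "x \<notin> cell c m"
  then have "cell x m \<subseteq> - cell c m"
    using cell_eq mem_cell_self by blast
  then show "\<exists>r>0. sup_ball x r \<subseteq> - cell c m"
    by (intro exI[of _ "exp (- real m)"]) (auto simp: cell_def)
qed

lemma sup_ball_contains_cell:
  assumes "r > 0"
  shows "\<exists>m. cell x m \<subseteq> sup_ball x r"
proof -
  obtain m :: nat where m: "- ln r < real m"
    using reals_Archimedean2 by blast
  then have "exp (- real m) \<le> r"
    using assms by (metis exp_le_cancel_iff exp_ln less_eq_real_def minus_less_iff)
  then have "cell x m \<subseteq> sup_ball x r"
    by (auto simp: cell_def sup_ball_def)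
  then show ?thesis ..
qed

lemma open_contains_cell: "open U \<Longrightarrow> x \<in> U \<Longrightarrow> \<exists>m. cell x m \<subseteq> U"
  unfolding open_iff_sup_ball using sup_ball_contains_cell by (meson order_trans)

definition cells :: "('k::field fls ^ 'd) set set" where
  "cells = range (\<lambda>(c, m). cell c m)"

lemma cell_in_cells [simp]: "cell c m \<in> cells"
  by (auto simp: cells_def)

lemma cellsE: "b \<in> cells \<Longrightarrow> (\<And>c m. b = cell c m \<Longrightarrow> P) \<Longrightarrow> P"
  by (auto simp: cells_def)

lemma open_cells: "b \<in> cells \<Longrightarrow> open b"
  by (auto elim: cellsE)

text \<open>A centre may be moved to a truncated series, which has finitely many nonzero
  coefficients from a finite field.\<close>

lemma countable_cells: "countable (cells :: ('k::{field,finite} fls ^ 'd) set set)"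
proof -
  define A :: "'k fls set" where "A = (\<lambda>(a, m). a * fls_X ^ m) ` (fls_polys \<times> UNIV)"
  have A: "countable A"
    unfolding A_def by (intro countable_image countable_SIGMA countable_fls_polys) auto
  have dense: "\<exists>a\<in>A. fls_abs (a - x) < exp (- real m)" for x :: "'k fls" and m
  proof -
    \<comment> \<open>\<open>p\<close> is the polynomial part of \<open>T ^ m * x\<close>, so
      \<open>poly_in_T p * fls_X ^ m\<close> is \<open>x\<close> cut off after its coefficient at
      \<open>int m\<close>.\<close>
    define p where "p = Abs_poly (\<lambda>k. fls_nth x (int m - int k))"
    have "\<exists>N. \<forall>i>N. fls_nth x (int m - int i) = 0"
    proof (intro exI allI impI)
      fix i assume "i > nat (int m - fls_subdegree x)"
      then show "fls_nth x (int m - int i) = 0"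
        by (intro fls_eq0_below_subdegree) linarith
    qed
    then have "coeff p = (\<lambda>k. fls_nth x (int m - int k))"
      unfolding p_def by (subst Abs_poly_inverse) (auto simp: MOST_nat)
    then have "fls_nth (poly_in_T p * fls_X ^ m) k = (if k \<le> int m then fls_nth x k else 0)" for k
      by (simp add: fls_X_power_times_conv_shift fls_nth_poly_in_T)
    then have "fls_abs (poly_in_T p * fls_X ^ m - x) < exp (- real m)"
      unfolding fls_abs_less_exp_iff by simp
    moreover have "poly_in_T p * fls_X ^ m \<in> A"
      by (auto simp: A_def)
    ultimately show ?thesis by blast
  qed
  have "cells \<subseteq> (\<lambda>(c, m). cell c m) ` ({v :: 'k fls ^ 'd. \<forall>i. v $ i \<in> A} \<times> UNIV)"
  proof
    fix b :: "('k fls ^ 'd) set" assume "b \<in> cells"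
    then obtain c m where b: "b = cell c m" by (rule cellsE)
    obtain a where a: "\<And>i. a i \<in> A" "\<And>i. fls_abs (a i - c $ i) < exp (- real m)"
    proof -
      have "\<forall>i. \<exists>a. a \<in> A \<and> fls_abs (a - c $ i) < exp (- real m)"
        using dense by blast
      then show thesis
        using that by metis
    qed
    then have "vec_lambda a \<in> cell c m"
      by (simp add: mem_cell_iff)
    then have "b = cell (vec_lambda a) m"
      using b cell_eq by metis
    then show "b \<in> (\<lambda>(c, m). cell c m) ` ({v. \<forall>i. v $ i \<in> A} \<times> UNIV)"
      using a(1) by (intro image_eqI[of _ _ "(vec_lambda a, m)"]) auto
  qed
  then show ?thesis
    by (rule countable_subset) (intro countable_image countable_SIGMA countable_vec_in[OF A] countableI_type)
qed

lemma open_eq_Union_cells: "open U \<Longrightarrow> U = \<Union>{b \<in> cells. b \<subseteq> U}"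
proof -
  assume "open U"
  show ?thesis
  proof
    show "U \<subseteq> \<Union>{b \<in> cells. b \<subseteq> U}"
    proof
      fix x assume "x \<in> U"
      with \<open>open U\<close> obtain m where "cell x m \<subseteq> U"
        by (meson open_contains_cell)
      then show "x \<in> \<Union>{b \<in> cells. b \<subseteq> U}"
        by (intro UnionI[of "cell x m"]) auto
    qed
  qed blast
qed

lemma sets_borel_eq_cells:
  "sets (borel :: ('k::{field,finite} fls ^ 'd) measure) = sigma_sets UNIV cells"
proof -
  have "sigma_sets UNIV {S :: ('k fls ^ 'd) set. open S} = sigma_sets UNIV cells"
  proof (rule sigma_sets_eqI)
    fix S :: "('k fls ^ 'd) set" assume "S \<in> {S. open S}"
    then have "S = \<Union>{b \<in> cells. b \<subseteq> S}"
      by (intro open_eq_Union_cells) simp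
    moreover have "\<Union>{b \<in> cells. b \<subseteq> S} \<in> sigma_sets UNIV cells"
    proof (rule sigma_sets_UNION)
      show "countable {b \<in> cells. b \<subseteq> S}"
        by (rule countable_subset[OF _ countable_cells]) blast
    qed (simp add: sigma_sets.Basic)
    ultimately show "S \<in> sigma_sets UNIV cells"
      by simp
  qed (simp add: open_cells sigma_sets.Basic)
  then show ?thesis
    by (simp add: borel_def)
qed

text \<open>The least level means the largest radius, so these are the maximal cells with property
  \<open>Q\<close>. They are the disjoint families on which all local estimates are summed.\<close>

definition top_cells :: "(('k::field fls ^ 'd) set \<Rightarrow> bool) \<Rightarrow> ('k fls ^ 'd) set set" where
  "top_cells Q = {cell x (LEAST m. Q (cell x m)) | x. \<exists>m. Q (cell x m)}"

lemma top_cells_subset: "top_cells Q \<subseteq> cells"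
  by (auto simp: top_cells_def)

lemma top_cells_D: "b \<in> top_cells Q \<Longrightarrow> Q b"
  by (auto simp: top_cells_def intro: LeastI)

lemma top_cells_cover:
  assumes "Q (cell x m)"
  shows "\<exists>b\<in>top_cells Q. x \<in> b"
  using assms unfolding top_cells_def by (intro bexI[of _ "cell x (LEAST m. Q (cell x m))"]) auto

text \<open>The cells around \<open>x\<close> and \<open>z\<close> agree at every level up to that
  of \<open>b\<close>, so both points find the same least level.\<close>

lemma top_cells_eqI:
  assumes b: "b \<in> top_cells Q" and z: "z \<in> b"
  shows "b = cell z (LEAST m. Q (cell z m))"
proof -
  obtain x m where x: "Q (cell x m)" and b: "b = cell x (LEAST m. Q (cell x m))"
    using b by (auto simp: top_cells_def)
  define k where "k = (LEAST m. Q (cell x m))"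
  have eq: "cell x m = cell z m" if "m \<le> k" for m
    using z that unfolding b k_def by (rule cell_eq')
  have "Q (cell x k)"
    unfolding k_def using x by (rule LeastI)
  then have "(LEAST m. Q (cell z m)) = k"
    using eq not_less_Least[of _ "\<lambda>m. Q (cell x m)"] unfolding k_def[symmetric]
    by (intro Least_equality) (auto simp: not_le[symmetric])
  then show ?thesis
    using eq[of k] b by (simp add: k_def)
qed

lemma disjoint_top_cells: "disjoint (top_cells Q)"
  unfolding disjoint_def
proof (intro ballI impI)
  fix a b assume "a \<in> top_cells Q" "b \<in> top_cells Q" "a \<noteq> b"
  then show "a \<inter> b = {}"
    using top_cells_eqI[of a Q] top_cells_eqI[of b Q] by blast
qed

lemma countable_top_cells: "countable (top_cells (Q :: ('k::{field,finite} fls ^ 'd) set \<Rightarrow> bool))"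
  using countable_cells top_cells_subset by (rule countable_subset[rotated])

subsection \<open>Haar measure and its outer measure\<close>

locale haar =
  fixes lam :: "('k::{field,finite} fls ^ 'd) measure"
  assumes haar: "is_haar_measure lam"
begin

lemma sets_lam: "sets lam = sets borel"
  using haar by (simp add: is_haar_measure_def)

lemma space_lam [simp]: "space lam = UNIV"
  using sets_eq_imp_space_eq[OF sets_lam] by simp

lemma open_in_sets: "open A \<Longrightarrow> A \<in> sets lam"
  by (simp add: sets_lam)

lemma cells_in_sets: "b \<in> cells \<Longrightarrow> b \<in> sets lam"
  by (simp add: open_in_sets open_cells)

lemma emeasure_cell_translate: "emeasure lam (cell c m) = emeasure lam (cell 0 m)"
proof -
  have "(\<lambda>x. c + x) ` cell 0 m = cell c m"
  proof
    show "cell c m \<subseteq> (\<lambda>x. c + x) ` cell 0 m"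
    proof
      fix x assume "x \<in> cell c m"
      then have "x - c \<in> cell 0 m" by (simp add: mem_cell_iff)
      then show "x \<in> (\<lambda>x. c + x) ` cell 0 m"
        by (intro image_eqI[of _ _ "x - c"]) auto
    qed
  qed (auto simp: mem_cell_iff)
  moreover have "emeasure lam ((\<lambda>x. c + x) ` cell 0 m) = emeasure lam (cell 0 m)"
    using haar open_in_sets[OF open_cell] unfolding is_haar_measure_def by blast
  ultimately show ?thesis by (simp only:)
qed

lemma emeasure_cells_le_1: "b \<in> cells \<Longrightarrow> emeasure lam b \<le> 1"
proof (elim cellsE)
  fix c m assume b: "b = cell c m"
  have "cell 0 m \<subseteq> {x :: 'k fls ^ 'd. sup_norm x \<le> 1}"
  proof
    fix x :: "'k fls ^ 'd" assume "x \<in> cell 0 m"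
    then have *: "fls_abs (x $ i) < exp (- real m)" for i
      by (simp add: mem_cell_iff)
    have "fls_abs (x $ i) \<le> 1" for i
    proof -
      have "exp (- real m) \<le> 1" by simp
      with *[of i] show ?thesis by linarith
    qed
    then show "x \<in> {x. sup_norm x \<le> 1}"
      unfolding sup_norm_def by (simp add: Max_le_iff)
  qed
  moreover have unit: "emeasure lam {x :: 'k fls ^ 'd. sup_norm x \<le> 1} = 1"
    using haar by (simp add: is_haar_measure_def)
  \<comment> \<open>\<open>emeasure\<close> is 0 on nonmeasurable sets, so the normalisation itself
    proves measurability.\<close>
  moreover have "{x :: 'k fls ^ 'd. sup_norm x \<le> 1} \<in> sets lam"
  proof (rule ccontr)
    assume "\<not> ?thesis"
    from emeasure_notin_sets[OF this] unit show False by simp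
  qed
  ultimately have "emeasure lam (cell 0 m) \<le> 1"
    using emeasure_mono[of "cell 0 m" "{x. sup_norm x \<le> 1}" lam] by simp
  then show ?thesis
    unfolding b emeasure_cell_translate[of c] .
qed

lemma emeasure_cells_finite: "b \<in> cells \<Longrightarrow> emeasure lam b < \<infinity>"
  using emeasure_cells_le_1[of b] by (auto simp: less_top[symmetric] top_unique)

definition cell_index :: ennreal where
  "cell_index = of_nat (CARD('k ^ 'd))"

text \<open>A cell around 0 is covered by subcells of the next level, one for each vector of
  coefficients at \<open>int (Suc m)\<close>. Translation invariance gives the other
  centres.\<close>

lemma emeasure_cell_Suc: "emeasure lam (cell c m) \<le> cell_index * emeasure lam (cell c (Suc m))"
proof -
  define v :: "'k ^ 'd \<Rightarrow> 'k fls ^ 'd" where "v a = (\<chi> i. fls_const (a $ i) * fls_X ^ Suc m)" for a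
  have "cell 0 m \<subseteq> (\<Union>a. cell (v a) (Suc m))"
  proof
    fix x :: "'k fls ^ 'd" assume "x \<in> cell 0 m"
    then have x: "fls_nth (x $ i) k = 0" if "k \<le> int m" for i k
      using that by (simp add: mem_cell_iff fls_abs_less_exp_iff)
    have "x \<in> cell (v (\<chi> i. fls_nth (x $ i) (int (Suc m)))) (Suc m)"
      unfolding mem_cell_iff fls_abs_less_exp_iff
    proof (intro allI impI)
      fix i k assume "k \<le> int (Suc m)"
      then have "k \<le> int m \<or> k = 1 + int m" by auto
      then show "fls_nth (x $ i - v (\<chi> i. fls_nth (x $ i) (int (Suc m))) $ i) k = 0"
        by (auto simp: v_def fls_X_power_times_conv_shift x simp del: power_Suc)
    qed
    then show "x \<in> (\<Union>a. cell (v a) (Suc m))" by blast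
  qed
  then have "emeasure lam (cell 0 m) \<le> emeasure lam (\<Union>a. cell (v a) (Suc m))"
    by (intro emeasure_mono open_in_sets) auto
  also have "\<dots> \<le> (\<Sum>a\<in>UNIV. emeasure lam (cell (v a) (Suc m)))"
    by (intro emeasure_subadditive_finite) (auto intro: open_in_sets)
  also have "\<dots> = cell_index * emeasure lam (cell 0 (Suc m))"
    by (simp add: emeasure_cell_translate[of "v _"] cell_index_def)
  finally show ?thesis
    using emeasure_cell_translate by metis
qed

text \<open>The next larger cell fails \<open>Q\<close> by maximality of \<open>b\<close>, and it
  stays inside \<open>b0\<close> because \<open>b\<close> is a proper subset of \<open>b0\<close>.
  In the applications the failure of \<open>Q\<close> supplies a large value on \<open>b'\<close>,
  which is what goodness asks for.\<close>

lemma top_cells_parent: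
  assumes b0: "b0 \<in> cells" and Q: "\<And>b. Q b \<Longrightarrow> b \<subseteq> b0" "\<not> Q b0" and b: "b \<in> top_cells Q"
  shows "\<exists>b'\<in>cells. b \<subseteq> b' \<and> b' \<subseteq> b0 \<and> \<not> Q b' \<and> emeasure lam b' \<le> cell_index * emeasure lam b"
proof -
  obtain x m where Qm: "Q (cell x m)" and b_eq: "b = cell x (LEAST m. Q (cell x m))"
    using b by (auto simp: top_cells_def)
  define k where "k = (LEAST m. Q (cell x m))"
  have Qk: "Q (cell x k)"
    unfolding k_def using Qm by (rule LeastI)
  obtain c m0 where c: "b0 = cell c m0"
    using b0 by (rule cellsE)
  have "x \<in> b0"
    using Q(1)[OF Qk] mem_cell_self[of x k] by blast
  then have b0_eq: "b0 = cell x m0"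
    using c cell_eq by metis
  have "m0 < k"
  proof (rule ccontr)
    assume "\<not> m0 < k"
    then have "b0 \<subseteq> cell x k"
      unfolding b0_eq by (intro cell_antimono) auto
    then have "b0 = cell x k"
      using Q(1)[OF Qk] by blast
    then show False
      using Qk Q(2) by simp
  qed
  then obtain j where j: "k = Suc j" "m0 \<le> j"
    by (metis Suc_leI Suc_le_mono gr0_implies_Suc less_eq_Suc_le not_less_zero old.nat.exhaust)
  have "\<not> Q (cell x j)"
    using not_less_Least[of j "\<lambda>m. Q (cell x m)"] j by (auto simp: k_def)
  moreover have "cell x j \<subseteq> b0"
    unfolding b0_eq using j by (intro cell_antimono)
  moreover have "b \<subseteq> cell x j"
    unfolding b_eq k_def[symmetric] j by (intro cell_antimono) auto
  moreover have "emeasure lam (cell x j) \<le> cell_index * emeasure lam b"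
    using emeasure_cell_Suc[of x j] unfolding b_eq k_def[symmetric] j .
  ultimately show ?thesis
    by (intro bexI[of _ "cell x j"]) auto
qed

abbreviation outer :: "('k fls ^ 'd) set \<Rightarrow> ennreal" where
  "outer \<equiv> outer_measure_of lam"

lemma outer_attain: "\<exists>E\<in>sets lam. A \<subseteq> E \<and> outer A = emeasure lam E"
  by (intro outer_measure_of_attain) auto

lemma outer_le_emeasure: "A \<subseteq> E \<Longrightarrow> E \<in> sets lam \<Longrightarrow> outer A \<le> emeasure lam E"
  by (metis outer_measure_of_eq outer_measure_of_mono)

lemma outer_Un: "outer (A \<union> B) \<le> outer A + outer B"
proof -
  obtain E G where E: "E \<in> sets lam" "A \<subseteq> E" "outer A = emeasure lam E"
    and G: "G \<in> sets lam" "B \<subseteq> G" "outer B = emeasure lam G"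
    using outer_attain by metis
  have "outer (A \<union> B) \<le> emeasure lam (E \<union> G)"
    using E G by (intro outer_le_emeasure) auto
  also have "\<dots> \<le> emeasure lam E + emeasure lam G"
    using E G by (intro emeasure_subadditive)
  finally show ?thesis
    using E G by simp
qed

lemma outer_null_iff: "outer A = 0 \<longleftrightarrow> (\<exists>E\<in>null_sets lam. A \<subseteq> E)"
proof
  assume "outer A = 0"
  then show "\<exists>E\<in>null_sets lam. A \<subseteq> E"
    using outer_attain[of A] by auto
next
  assume "\<exists>E\<in>null_sets lam. A \<subseteq> E"
  then obtain E where "A \<subseteq> E" "E \<in> sets lam" "emeasure lam E = 0"
    by (auto simp: null_sets_def)
  then show "outer A = 0"
    using outer_le_emeasure[of A E] by simp
qed

lemma outer_UN_null:
  assumes "countable I" and "\<And>i. i \<in> I \<Longrightarrow> outer (A i) = 0"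
  shows "outer (\<Union>i\<in>I. A i) = 0"
proof -
  obtain E where E: "\<And>i. i \<in> I \<Longrightarrow> E i \<in> null_sets lam" "\<And>i. i \<in> I \<Longrightarrow> A i \<subseteq> E i"
    using assms(2) unfolding outer_null_iff by metis
  have "(\<Union>i\<in>I. E i) \<in> null_sets lam"
    using assms(1) E(1) by (intro null_sets_UN') auto
  moreover have "(\<Union>i\<in>I. A i) \<subseteq> (\<Union>i\<in>I. E i)"
    using E(2) by blast
  ultimately show ?thesis
    unfolding outer_null_iff by blast
qed

lemma outer_Un_null: "outer N = 0 \<Longrightarrow> A \<subseteq> N \<union> B \<Longrightarrow> outer A \<le> outer B"
  using outer_measure_of_mono[of A "N \<union> B" lam] outer_Un[of N B] by auto

text \<open>Measurable hulls of the pieces \<open>A \<inter> b\<close>, cut back to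
  \<open>b\<close>, are disjoint. Countable additivity is thus available although \<open>A\<close>
  may fail to be measurable.\<close>

lemma outer_le_disjoint:
  assumes "countable F" and "disjoint F" and "F \<subseteq> sets lam" and "\<Union>F \<subseteq> B" and "B \<in> sets lam"
    and "A \<subseteq> \<Union>F" and le: "\<And>b. b \<in> F \<Longrightarrow> outer (A \<inter> b) \<le> K * emeasure lam b"
  shows "outer A \<le> K * emeasure lam B"
proof -
  obtain E where E: "\<And>b. E b \<in> sets lam" "\<And>b. A \<inter> b \<subseteq> E b" "\<And>b. outer (A \<inter> b) = emeasure lam (E b)"
    using outer_attain[of "A \<inter> _"] by metis
  have sets: "E b \<inter> b \<in> sets lam" if "b \<in> F" for b
    using that E(1) assms(3) by auto
  have "A \<subseteq> (\<Union>b\<in>F. E b \<inter> b)"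
    using assms(6) E(2) by blast
  moreover have "(\<Union>b\<in>F. E b \<inter> b) \<in> sets lam"
    using assms(1) sets by (intro sets.countable_UN') auto
  ultimately have "outer A \<le> emeasure lam (\<Union>b\<in>F. E b \<inter> b)"
    by (rule outer_le_emeasure)
  also have "\<dots> = (\<integral>\<^sup>+b. emeasure lam (E b \<inter> b) \<partial>count_space F)"
    using assms(1,2) sets
    by (intro emeasure_UN_countable) (auto simp: disjoint_family_on_def disjoint_def)
  also have "\<dots> \<le> (\<integral>\<^sup>+b. K * emeasure lam b \<partial>count_space F)"
  proof (intro nn_integral_mono)
    fix b assume "b \<in> space (count_space F)"
    then have "b \<in> F" by simp
    have "emeasure lam (E b \<inter> b) \<le> emeasure lam (E b)"
      by (intro emeasure_mono E) auto
    with le[OF \<open>b \<in> F\<close>] show "emeasure lam (E b \<inter> b) \<le> K * emeasure lam b"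
      by (simp add: E(3))
  qed
  also have "\<dots> = K * (\<integral>\<^sup>+b. emeasure lam b \<partial>count_space F)"
    by (intro nn_integral_cmult) auto
  also have "(\<integral>\<^sup>+b. emeasure lam b \<partial>count_space F) = emeasure lam (\<Union>b\<in>F. b)"
    using assms(1,2,3)
    by (intro emeasure_UN_countable[symmetric]) (auto simp: disjoint_family_on_def disjoint_def)
  also have "K * \<dots> \<le> K * emeasure lam B"
    using assms(4,5) by (intro mult_left_mono emeasure_mono) auto
  finally show ?thesis .
qed

text \<open>Outer regularity in a form symmetric in \<open>A\<close> and \<open>- A\<close>.
  Swapping \<open>S\<close> and \<open>T\<close> settles complements, which makes an induction over
  the sigma-algebra possible.\<close>

lemma open_approx:
  assumes b0: "b0 \<in> cells" and A: "A \<in> sets lam" and "e > 0"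
  shows "\<exists>S T. open S \<and> open T \<and> A \<subseteq> S \<and> - A \<subseteq> T \<and> emeasure lam (b0 \<inter> (S \<inter> T)) < ennreal e"
proof -
  have "A \<in> sigma_sets UNIV cells"
    using A unfolding sets_lam sets_borel_eq_cells .
  then show ?thesis
    using \<open>e > 0\<close>
  proof (induction A arbitrary: e rule: sigma_sets.induct)
    case (Basic a)
    then show ?case
      by (intro exI[of _ a] exI[of _ "- a"]) (auto elim!: cellsE)
  next
    case Empty
    then show ?case
      by (intro exI[of _ "{}"] exI[of _ UNIV]) auto
  next
    case (Compl a)
    from Compl.IH[OF Compl.prems] obtain S T where "open S" "open T" "a \<subseteq> S" "- a \<subseteq> T"
      "emeasure lam (b0 \<inter> (S \<inter> T)) < ennreal e"
      by blast
    then show ?case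
      by (intro exI[of _ T] exI[of _ S]) (auto simp: Int_commute)
  next
    case (Union a)
    \<comment> \<open>These bounds add up to \<open>e / 2\<close>, which leaves room for the strict
      inequality.\<close>
    define d where "d i = e / 2 * (1 / 2) ^ Suc i" for i
    have d: "d i > 0" for i
      using Union.prems by (simp add: d_def)
    have "\<exists>S T. open S \<and> open T \<and> a i \<subseteq> S \<and> - a i \<subseteq> T \<and> emeasure lam (b0 \<inter> (S \<inter> T)) < ennreal (d i)" for i
      using Union.IH[OF d] .
    then obtain S T where ST: "\<And>i. open (S i)" "\<And>i. open (T i)" "\<And>i. a i \<subseteq> S i" "\<And>i. - a i \<subseteq> T i"
      "\<And>i. emeasure lam (b0 \<inter> (S i \<inter> T i)) < ennreal (d i)"
      by metis
    \<comment> \<open>Only finitely many \<open>T i\<close> can be intersected with openness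
      preserved. Continuity from above, inside the cell \<open>b0\<close> of finite measure, shows
      that finitely many are enough.\<close>
    define W where "W n = b0 \<inter> (\<Union>i. S i) \<inter> (\<Inter>i\<le>n. T i)" for n
    have W_sets: "W n \<in> sets lam" for n
      unfolding W_def using b0 ST by (intro open_in_sets open_Int open_cells open_UN open_INT) auto
    have "(\<lambda>n. emeasure lam (W n)) \<longlonglongrightarrow> emeasure lam (\<Inter>n. W n)"
    proof (rule Lim_emeasure_decseq)
      show "decseq W"
        unfolding W_def decseq_def by (auto intro: order_trans)
      show "emeasure lam (W n) \<noteq> \<infinity>" for n
      proof -
        have "emeasure lam (W n) \<le> emeasure lam b0"
          unfolding W_def using b0 by (intro emeasure_mono cells_in_sets) auto
        then show ?thesis
          using emeasure_cells_finite[OF b0] by (auto simp: top_unique)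
      qed
    qed (use W_sets in auto)
    moreover have "emeasure lam (\<Inter>n. W n) < ennreal e"
    proof -
      have "(\<Inter>n. W n) \<subseteq> (\<Union>i. b0 \<inter> (S i \<inter> T i))"
        unfolding W_def by auto
      then have "emeasure lam (\<Inter>n. W n) \<le> emeasure lam (\<Union>i. b0 \<inter> (S i \<inter> T i))"
        using open_cells[OF b0] ST by (intro emeasure_mono open_in_sets open_UN ballI open_Int)
      also have "\<dots> \<le> (\<Sum>i. emeasure lam (b0 \<inter> (S i \<inter> T i)))"
        using b0 ST by (intro emeasure_subadditive_countably) (auto intro!: open_in_sets intro: open_cells)
      also have "\<dots> \<le> (\<Sum>i. ennreal (d i))"
        using ST(5) by (intro suminf_le) (auto intro: less_imp_le)
      also have "\<dots> = ennreal (e / 2)"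
        using d sums_mult[OF power_half_series, of "e / 2"]
        by (intro suminf_ennreal_eq) (auto simp: d_def less_imp_le)
      also have "\<dots> < ennreal e"
        using Union.prems by (intro ennreal_lessI) auto
      finally show ?thesis .
    qed
    ultimately have "\<forall>\<^sub>F n in sequentially. emeasure lam (W n) < ennreal e"
      by (rule order_tendstoD)
    then obtain n where "emeasure lam (W n) < ennreal e"
      unfolding eventually_sequentially by blast
    moreover have "open (\<Union>i. S i)" "open (\<Inter>i\<le>n. T i)"
      using ST by auto
    moreover have "(\<Union>i. a i) \<subseteq> (\<Union>i. S i)" "- (\<Union>i. a i) \<subseteq> (\<Inter>i\<le>n. T i)"
      using ST(3,4) by blast+
    ultimately show ?case
      unfolding W_def by (intro exI[of _ "\<Union>i. S i"] exI[of _ "\<Inter>i\<le>n. T i"]) (auto simp: Int_assoc)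
  qed
qed

lemma outer_open_approx:
  assumes b0: "b0 \<in> cells" and A: "A \<subseteq> b0" and e: "e > 0"
  shows "\<exists>S. open S \<and> A \<subseteq> S \<and> S \<subseteq> b0 \<and> emeasure lam S \<le> outer A + ennreal e"
proof -
  obtain E where E: "E \<in> sets lam" "A \<subseteq> E" "outer A = emeasure lam E"
    using outer_attain by metis
  obtain S T where ST: "open S" "open T" "E \<subseteq> S" "- E \<subseteq> T" "emeasure lam (b0 \<inter> (S \<inter> T)) < ennreal e"
    using open_approx[OF b0 E(1) e] by blast
  have sets: "b0 \<inter> (S \<inter> T) \<in> sets lam"
    using b0 ST by (intro open_in_sets) (auto intro: open_cells)
  have "emeasure lam (b0 \<inter> S) \<le> emeasure lam (E \<union> (b0 \<inter> (S \<inter> T)))"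
    using E(1) ST(3,4) sets by (intro emeasure_mono) auto
  also have "\<dots> \<le> emeasure lam E + emeasure lam (b0 \<inter> (S \<inter> T))"
    using E(1) sets by (rule emeasure_subadditive)
  also have "\<dots> \<le> outer A + ennreal e"
    using ST(5) E(3) by (intro add_mono) auto
  finally show ?thesis
    using b0 ST A E(2) by (intro exI[of _ "b0 \<inter> S"]) (auto intro: open_cells)
qed

text \<open>A form of the Lebesgue density theorem. Covering \<open>A\<close> by an open set of
  measure at most \<open>outer A + e\<close> and cutting this set into maximal cells gives
  \<open>outer A \<le> (outer A + e) / 2\<close> for every \<open>e > 0\<close>.\<close>

lemma outer_null_of_density:
  assumes b0: "b0 \<in> cells" and A: "A \<subseteq> b0"
    and dens: "\<And>b. b \<in> cells \<Longrightarrow> b \<subseteq> b0 \<Longrightarrow> A \<inter> b \<noteq> {} \<Longrightarrow> outer (A \<inter> b) \<le> ennreal (1/2) * emeasure lam b"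
  shows "outer A = 0"
proof -
  have "outer A \<le> emeasure lam b0"
    using A b0 by (intro outer_le_emeasure cells_in_sets)
  then have "outer A < \<infinity>"
    using emeasure_cells_finite[OF b0] by (rule le_less_trans)
  then obtain r where r: "outer A = ennreal r" "r \<ge> 0"
    by (cases "outer A") auto
  have "r \<le> 0 + e" if e: "e > 0" for e
  proof -
    obtain S where S: "open S" "A \<subseteq> S" "S \<subseteq> b0" "emeasure lam S \<le> outer A + ennreal e"
      using outer_open_approx[OF b0 A e] by blast
    define F where "F = top_cells (\<lambda>b. b \<subseteq> S)"
    have "outer A \<le> ennreal (1/2) * emeasure lam S"
    proof (rule outer_le_disjoint[of F])
      show "countable F" "disjoint F"
        by (simp_all add: F_def countable_top_cells disjoint_top_cells)
      show "F \<subseteq> sets lam"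
        using top_cells_subset cells_in_sets unfolding F_def by blast
      show "\<Union>F \<subseteq> S"
        using top_cells_D unfolding F_def by fastforce
      show "S \<in> sets lam"
        using S(1) by (rule open_in_sets)
      show "A \<subseteq> \<Union>F"
      proof
        fix x assume "x \<in> A"
        then obtain m where "cell x m \<subseteq> S"
          using S(1,2) open_contains_cell by blast
        then show "x \<in> \<Union>F"
          unfolding F_def by (meson UnionI top_cells_cover)
      qed
      fix b assume "b \<in> F"
      then have "b \<in> cells" "b \<subseteq> b0"
        using top_cells_subset top_cells_D[of b "\<lambda>b. b \<subseteq> S"] S(3) unfolding F_def by blast+
      then show "outer (A \<inter> b) \<le> ennreal (1/2) * emeasure lam b"
        using dens[of b] by (cases "A \<inter> b = {}") auto
    qed
    also have "\<dots> \<le> ennreal (1/2) * (ennreal r + ennreal e)"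
      using S(4) r(1) by (intro mult_left_mono) auto
    also have "\<dots> = ennreal (1/2 * (r + e))"
    proof -
      have "ennreal r + ennreal e = ennreal (r + e)"
        using r(2) e by simp
      then show ?thesis
        using r(2) e by (simp only:) (intro ennreal_mult[symmetric], auto)
    qed
    finally have "r \<le> 1/2 * (r + e)"
      unfolding r(1) using r(2) e by (subst (asm) ennreal_le_iff) auto
    then show ?thesis by simp
  qed
  then have "r \<le> 0"
    by (rule field_le_epsilon)
  with r show ?thesis
    by simp
qed

text \<open>A cell inside \<open>b0\<close> that meets this set contains a value at least
  \<open>s'\<close>, so by \<open>half\<close> the set fills at most half of the cell. For a
  continuous \<open>g\<close> and \<open>s \<le> s'\<close> the set would be empty.\<close>

lemma outer_no_small_cell:
  fixes g :: "'k fls ^ 'd \<Rightarrow> real"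
  assumes b0: "b0 \<in> cells"
    and half: "\<And>b. b \<in> cells \<Longrightarrow> b \<subseteq> b0 \<Longrightarrow> \<exists>y\<in>b. g y \<ge> s' \<Longrightarrow>
      outer {x \<in> b. g x < s} \<le> ennreal (1/2) * emeasure lam b"
  shows "outer {x \<in> b0. g x < s \<and> \<not> (\<exists>b\<in>cells. x \<in> b \<and> b \<subseteq> b0 \<and> (\<forall>y\<in>b. g y < s'))} = 0"
    (is "outer ?A = 0")
proof (rule outer_null_of_density[OF b0])
  fix b assume b: "b \<in> cells" "b \<subseteq> b0" "?A \<inter> b \<noteq> {}"
  then have "\<exists>y\<in>b. g y \<ge> s'"
    by (auto simp: not_less)
  have "outer (?A \<inter> b) \<le> outer {x \<in> b. g x < s}"
    by (intro outer_measure_of_mono) auto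
  also have "\<dots> \<le> ennreal (1/2) * emeasure lam b"
    using half b \<open>\<exists>y\<in>b. g y \<ge> s'\<close> by blast
  finally show "outer (?A \<inter> b) \<le> ennreal (1/2) * emeasure lam b" .
qed auto

end

subsection \<open>Quantitative nondivergence\<close>

text \<open>When \<open>cmp\<close> is strict inclusion of subspaces in one direction or the other,
  the cliques are flags. An abstract relation keeps the measure-theoretic induction free of
  lattices.\<close>

definition clique :: "('a \<Rightarrow> 'a \<Rightarrow> bool) \<Rightarrow> 'a set \<Rightarrow> bool" where
  "clique cmp F \<longleftrightarrow> (\<forall>S\<in>F. \<forall>T\<in>F. S \<noteq> T \<longrightarrow> cmp S T)"

text \<open>
  The marked points of Kleinbock and Margulis.  The second threshold \<open>\<sigma>\<close>, a fixed fraction of \<open>\<rho>\<close>,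
  makes up for the lack of continuity of the functions \<open>\<psi> S\<close>.
\<close>

definition marked ::
    "('a \<Rightarrow> 'a \<Rightarrow> bool) \<Rightarrow> ('a \<Rightarrow> 'x \<Rightarrow> real) \<Rightarrow> real \<Rightarrow> real \<Rightarrow> real \<Rightarrow> 'a set \<Rightarrow> 'x \<Rightarrow> bool" where
  "marked cmp \<psi> \<epsilon> \<rho> \<sigma> P x \<longleftrightarrow>
     (\<exists>F\<subseteq>P. clique cmp F \<and> (\<forall>S\<in>F. \<epsilon> \<le> \<psi> S x \<and> \<psi> S x < \<rho>) \<and>
       (\<forall>S\<in>P. (\<forall>T\<in>F. cmp S T) \<longrightarrow> \<sigma> \<le> \<psi> S x))"

context haar
begin

text \<open>Goodness relative to any value \<open>r\<close> reached in \<open>b\<close> instead of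
  the supremum: zero and infinite suprema then follow the same rule, and real-valued maxima such as
  covolumes are covered too.\<close>

definition good_on :: "real \<Rightarrow> real \<Rightarrow> ('k fls ^ 'd) set \<Rightarrow> ('k fls ^ 'd \<Rightarrow> real) \<Rightarrow> bool" where
  "good_on C \<alpha> b0 g \<longleftrightarrow>
     (\<forall>b\<in>cells. \<forall>r e. b \<subseteq> b0 \<longrightarrow> r > 0 \<longrightarrow> e > 0 \<longrightarrow> (\<exists>y\<in>b. g y \<ge> r) \<longrightarrow>
        outer {x \<in> b. g x < e} \<le> ennreal (C * (e / r) powr \<alpha>) * emeasure lam b)"

lemma good_onD:
  "good_on C \<alpha> b0 g \<Longrightarrow> b \<in> cells \<Longrightarrow> b \<subseteq> b0 \<Longrightarrow> r > 0 \<Longrightarrow> e > 0 \<Longrightarrow> \<exists>y\<in>b. g y \<ge> r \<Longrightarrow>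
     outer {x \<in> b. g x < e} \<le> ennreal (C * (e / r) powr \<alpha>) * emeasure lam b"
  unfolding good_on_def by blast

lemma good_on_subset: "good_on C \<alpha> b0 g \<Longrightarrow> b1 \<subseteq> b0 \<Longrightarrow> good_on C \<alpha> b1 g"
  unfolding good_on_def by (meson order_trans)

lemma outer_no_small_cell_good:
  assumes "b0 \<in> cells" and "good_on C \<alpha> b0 g" and "s > 0" and "s' > 0" and half: "C * (s / s') powr \<alpha> \<le> 1/2"
  shows "outer {x \<in> b0. g x < s \<and> \<not> (\<exists>b\<in>cells. x \<in> b \<and> b \<subseteq> b0 \<and> (\<forall>y\<in>b. g y < s'))} = 0"
proof (rule outer_no_small_cell[OF assms(1)])
  fix b :: "('k fls ^ 'd) set" assume "b \<in> cells" "b \<subseteq> b0" "\<exists>y\<in>b. g y \<ge> s'"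
  with assms have "outer {x \<in> b. g x < s} \<le> ennreal (C * (s / s') powr \<alpha>) * emeasure lam b"
    by (intro good_onD[of C \<alpha> b0 g b s' s]) auto
  also have "\<dots> \<le> ennreal (1/2) * emeasure lam b"
    using half by (intro mult_right_mono ennreal_leI) auto
  finally show "outer {x \<in> b. g x < s} \<le> ennreal (1/2) * emeasure lam b" .
qed

text \<open>Let \<open>b\<close> be maximal with some \<open>\<psi> S\<close> below \<rho> on it,
  and \<open>b'\<close> its parent. No function of the family stays below \<rho> on
  \<open>b'\<close>, so the induction hypothesis applies there to the elements comparable with
  \<open>S\<close>, whose cliques are shorter by one. A point of \<open>b\<close> marked by a flag
  \<open>F\<close> of these, with \<open>\<psi> S x \<ge> \<epsilon>\<close>, is marked by
  \<open>insert S F\<close>. Goodness on \<open>b'\<close> bounds the points with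
  \<open>\<psi> S x < \<epsilon>\<close>.\<close>

lemma nondivergence:
  fixes \<psi> :: "'a \<Rightarrow> 'k fls ^ 'd \<Rightarrow> real"
  assumes cmp: "\<And>S T. cmp S T \<Longrightarrow> cmp T S" "\<And>S. \<not> cmp S S"
    and pos: "\<epsilon> > 0" "\<rho> > 0" "\<sigma> > 0" and half: "C * (\<sigma> / \<rho>) powr \<alpha> \<le> 1/2"
    and "b0 \<in> cells" and "countable P"
    and "\<And>S. S \<in> P \<Longrightarrow> good_on C \<alpha> b0 (\<psi> S)"
    and "\<And>F. F \<subseteq> P \<Longrightarrow> clique cmp F \<Longrightarrow> finite F \<and> card F \<le> m"
    and "\<And>S. S \<in> P \<Longrightarrow> \<exists>y\<in>b0. \<psi> S y \<ge> \<rho>"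
  shows "outer {x \<in> b0. \<not> marked cmp \<psi> \<epsilon> \<rho> \<sigma> P x} \<le>
    (\<Sum>i<m. cell_index ^ Suc i) * ennreal (C * (\<epsilon> / \<rho>) powr \<alpha>) * emeasure lam b0"
  using assms(7-)
proof (induction m arbitrary: P b0)
  case 0
  have "P = {}"
  proof (rule ccontr)
    assume "P \<noteq> {}"
    then obtain S where "{S} \<subseteq> P" by blast
    then show False
      using 0(4)[of "{S}"] by (auto simp: clique_def)
  qed
  then have "marked cmp \<psi> \<epsilon> \<rho> \<sigma> P x" for x
    by (auto simp: marked_def clique_def)
  then show ?case
    by simp
next
  case (Suc m)
  define E where "E = ennreal (C * (\<epsilon> / \<rho>) powr \<alpha>)"
  define K where "K m = (\<Sum>i<m. cell_index ^ Suc i) * E" for m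
  have K_Suc: "K (Suc m) = (K m + E) * cell_index"
    \<comment> \<open>Each level adds one term \<open>E\<close> for the function chosen at this
      level and multiplies everything by \<open>cell_index\<close> for the return from the parent to
      the cell. This recursion is the origin of the geometric sum.\<close>
    unfolding K_def sum.lessThan_Suc_shift
    by (simp add: sum_distrib_left sum_distrib_right algebra_simps)
  define U where "U = {x \<in> b0. \<not> marked cmp \<psi> \<epsilon> \<rho> \<sigma> P x}"
  define N where "N S = {x \<in> b0. \<psi> S x < \<sigma> \<and> \<not> (\<exists>b\<in>cells. x \<in> b \<and> b \<subseteq> b0 \<and> (\<forall>y\<in>b. \<psi> S y < \<rho>))}" for S
  define Q where "Q b \<longleftrightarrow> b \<in> cells \<and> b \<subseteq> b0 \<and> (\<exists>S\<in>P. \<forall>y\<in>b. \<psi> S y < \<rho>)" for b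
  have N_null: "outer (N S) = 0" if "S \<in> P" for S
    unfolding N_def using Suc.prems(1,3) that pos half by (intro outer_no_small_cell_good[of b0 C \<alpha>]) auto
  have "outer (\<Union>S\<in>P. N S) = 0"
    using Suc.prems(2) N_null by (rule outer_UN_null)
  moreover have "U \<subseteq> (\<Union>S\<in>P. N S) \<union> (U \<inter> \<Union>(top_cells Q))"
  proof
    fix x assume x: "x \<in> U"
    \<comment> \<open>The empty flag does not mark \<open>x\<close>, so the second condition of
      \<open>marked\<close> fails for some \<open>S\<close>.\<close>
    then obtain S where S: "S \<in> P" "\<psi> S x < \<sigma>"
      unfolding U_def marked_def clique_def by (auto simp: not_le)
    show "x \<in> (\<Union>S\<in>P. N S) \<union> (U \<inter> \<Union>(top_cells Q))"
    proof (cases "x \<in> N S")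
      case False
      then obtain b where b: "b \<in> cells" "x \<in> b" "b \<subseteq> b0" "\<forall>y\<in>b. \<psi> S y < \<rho>"
        using x S(2) unfolding N_def U_def by blast
      then obtain c k where "b = cell c k" by (elim cellsE)
      then have "b = cell x k"
        using b(2) cell_eq by metis
      then have "Q (cell x k)"
        using b S(1) unfolding Q_def by auto
      then show ?thesis
        using x top_cells_cover by blast
    qed (use S in blast)
  qed
  ultimately have "outer U \<le> outer (U \<inter> \<Union>(top_cells Q))"
    by (rule outer_Un_null)
  also have "\<dots> \<le> K (Suc m) * emeasure lam b0"
  proof (rule outer_le_disjoint[of "top_cells Q"])
    show "top_cells Q \<subseteq> sets lam"
      using top_cells_subset cells_in_sets by blast
    show "\<Union>(top_cells Q) \<subseteq> b0"
      using top_cells_D[of _ Q] unfolding Q_def by blast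
    fix b assume b: "b \<in> top_cells Q"
    obtain S where S: "S \<in> P" "\<And>y. y \<in> b \<Longrightarrow> \<psi> S y < \<rho>"
      using top_cells_D[OF b] unfolding Q_def by blast
    have "\<not> Q b0"
      using Suc.prems(5) unfolding Q_def by (meson not_le)
    then obtain b' where b': "b' \<in> cells" "b \<subseteq> b'" "b' \<subseteq> b0" "\<not> Q b'"
      "emeasure lam b' \<le> cell_index * emeasure lam b"
      using top_cells_parent[OF Suc.prems(1) _ _ b] unfolding Q_def by blast
    \<comment> \<open>Failure of \<open>Q\<close> on the parent is exactly the lower bound that the
      induction hypothesis requires.\<close>
    have big: "\<exists>y\<in>b'. \<psi> T y \<ge> \<rho>" if "T \<in> P" for T
      using b' that unfolding Q_def by (meson not_le)
    define P' where "P' = {T \<in> P. cmp T S}"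
    have le1: "outer {x \<in> b'. \<not> marked cmp \<psi> \<epsilon> \<rho> \<sigma> P' x} \<le> K m * emeasure lam b'"
      unfolding K_def E_def
    proof (rule Suc.IH)
      show "countable P'"
        using Suc.prems(2) unfolding P'_def by (rule countable_subset[rotated]) blast
      show "good_on C \<alpha> b' (\<psi> T)" if "T \<in> P'" for T
        using that Suc.prems(3) b'(3) unfolding P'_def by (blast intro: good_on_subset)
      show "\<exists>y\<in>b'. \<rho> \<le> \<psi> T y" if "T \<in> P'" for T
        using that big unfolding P'_def by blast
      \<comment> \<open>\<open>S\<close> can be added to every flag in \<open>P'\<close>, and it
        lies in none of them because \<open>cmp\<close> is irreflexive.\<close>
      show "finite F \<and> card F \<le> m" if F: "F \<subseteq> P'" "clique cmp F" for F
      proof -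
        have "insert S F \<subseteq> P" "clique cmp (insert S F)"
          using F S(1) cmp(1) unfolding clique_def P'_def by blast+
        then have "finite (insert S F) \<and> card (insert S F) \<le> Suc m"
          by (rule Suc.prems(4))
        moreover have "S \<notin> F"
          using F(1) cmp(2) unfolding P'_def by blast
        ultimately show ?thesis by auto
      qed
    qed (fact b')
    have le2: "outer {x \<in> b'. \<psi> S x < \<epsilon>} \<le> E * emeasure lam b'"
      unfolding E_def using Suc.prems(3)[OF S(1)] b' big[OF S(1)] pos by (intro good_onD[of C \<alpha> b0]) auto
    have "U \<inter> b \<subseteq> {x \<in> b'. \<not> marked cmp \<psi> \<epsilon> \<rho> \<sigma> P' x} \<union> {x \<in> b'. \<psi> S x < \<epsilon>}"
    proof (rule subsetI, rule ccontr)
      fix x assume x: "x \<in> U \<inter> b" "x \<notin> {x \<in> b'. \<not> marked cmp \<psi> \<epsilon> \<rho> \<sigma> P' x} \<union> {x \<in> b'. \<psi> S x < \<epsilon>}"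
      then have "x \<in> b'" "\<epsilon> \<le> \<psi> S x" "\<psi> S x < \<rho>" "marked cmp \<psi> \<epsilon> \<rho> \<sigma> P' x"
        using b'(2) S(2) by auto
      then obtain F where F: "F \<subseteq> P'" "clique cmp F" "\<forall>T\<in>F. \<epsilon> \<le> \<psi> T x \<and> \<psi> T x < \<rho>"
        "\<And>T. T \<in> P' \<Longrightarrow> (\<forall>R\<in>F. cmp T R) \<Longrightarrow> \<sigma> \<le> \<psi> T x"
        unfolding marked_def by blast
      have "marked cmp \<psi> \<epsilon> \<rho> \<sigma> P x"
        unfolding marked_def
      proof (intro exI[of _ "insert S F"] conjI ballI impI)
        show "insert S F \<subseteq> P"
          using F(1) S(1) unfolding P'_def by blast
        show "clique cmp (insert S F)"
          using F(1,2) cmp(1) unfolding P'_def clique_def by blast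
        fix T assume "T \<in> P" "\<forall>R\<in>insert S F. cmp T R"
        then show "\<sigma> \<le> \<psi> T x"
          using F(4)[of T] unfolding P'_def by blast
      qed (use F(3) \<open>\<epsilon> \<le> \<psi> S x\<close> \<open>\<psi> S x < \<rho>\<close> in auto)
      with x show False
        unfolding U_def by blast
    qed
    then have "outer (U \<inter> b) \<le> outer {x \<in> b'. \<not> marked cmp \<psi> \<epsilon> \<rho> \<sigma> P' x} + outer {x \<in> b'. \<psi> S x < \<epsilon>}"
      by (rule order_trans[OF outer_measure_of_mono outer_Un])
    also have "\<dots> \<le> K m * emeasure lam b' + E * emeasure lam b'"
      using le1 le2 by (rule add_mono)
    also have "\<dots> = (K m + E) * emeasure lam b'"
      by (simp add: distrib_right)
    also have "\<dots> \<le> (K m + E) * (cell_index * emeasure lam b)"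
      using b'(5) by (intro mult_left_mono) auto
    also have "\<dots> = K (Suc m) * emeasure lam b"
      unfolding K_Suc by (simp add: mult.assoc)
    finally have "outer (U \<inter> b) \<le> K (Suc m) * emeasure lam b" .
    moreover have "U \<inter> \<Union>(top_cells Q) \<inter> b \<subseteq> U \<inter> b"
      by blast
    ultimately show "outer (U \<inter> \<Union>(top_cells Q) \<inter> b) \<le> K (Suc m) * emeasure lam b"
      by (meson order_trans outer_measure_of_mono)
  qed (use Suc.prems(1) cells_in_sets in \<open>auto simp: countable_top_cells disjoint_top_cells\<close>)
  finally show ?case
    unfolding U_def K_def E_def .
qed

end

subsection \<open>Exterior products by determinants\<close>

text \<open>A fixed enumeration of the index type, which lets the entries of a list serve as the
  first rows of a matrix.\<close>

definition pos :: "'i::finite \<Rightarrow> nat" where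
  "pos = (SOME r. bij_betw r UNIV {..<CARD('i)})"

lemma bij_betw_pos: "bij_betw (pos :: 'i::finite \<Rightarrow> nat) UNIV {..<CARD('i)}"
proof -
  have "\<exists>r :: 'i \<Rightarrow> nat. bij_betw r UNIV {..<CARD('i)}"
    using ex_bij_betw_finite_nat[of "UNIV :: 'i set"] by (simp add: atLeast0LessThan)
  then show ?thesis
    unfolding pos_def by (rule someI_ex)
qed

lemma pos_eq_iff [simp]: "pos i = pos j \<longleftrightarrow> i = j"
  using bij_betw_pos by (auto simp: bij_betw_def inj_on_def)

lemma bij_betw_pos_less:
  assumes "k \<le> CARD('i::finite)"
  shows "bij_betw pos {i :: 'i. pos i < k} {..<k}"
  unfolding bij_betw_def
proof
  show "inj_on pos {i :: 'i. pos i < k}"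
    by (auto simp: inj_on_def)
  have "{..<CARD('i)} = range (pos :: 'i \<Rightarrow> nat)"
    using bij_betw_pos[where 'i = 'i] by (auto simp: bij_betw_def)
  then have "\<exists>i :: 'i. pos i = m" if "m < CARD('i)" for m
    using that by (metis imageE lessThan_iff)
  then show "pos ` {i :: 'i. pos i < k} = {..<k}"
    using assms by (intro set_eqI iffI) (auto simp: image_iff, metis less_le_trans)
qed

text \<open>
  The coordinates of the exterior product of the vectors in a list \<open>S\<close> are, up to sign and
  repetition, the determinants of the matrices \<open>frame S J\<close>, in which \<open>S\<close> is completed by standard
  basis vectors.
\<close>

definition frame :: "('a::field ^ 'i) list \<Rightarrow> ('i \<Rightarrow> 'i) \<Rightarrow> 'a ^ 'i ^ 'i" where
  "frame S J = (\<chi> i. if pos i < length S then S ! pos i else axis (J i) 1)"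

text \<open>For weights of product 1 this is the maximum norm of the exterior product of
  \<open>S\<close> after the diagonal map \<open>w\<close>. The coordinate at an index set is scaled
  by the product of \<open>w\<close> over that set, which equals the product of
  \<open>inverse (w j)\<close> over its complement, and the complement is what \<open>J\<close>
  lists. If \<open>J\<close> repeats an index there, the determinant vanishes.\<close>

definition wedge_norm :: "('i \<Rightarrow> real) \<Rightarrow> ('k::field fls ^ 'i) list \<Rightarrow> real" where
  "wedge_norm w S =
     Max (range (\<lambda>J. fls_abs (det (frame S J)) * (\<Prod>i | length S \<le> pos i. inverse (w (J i)))))"

definition weighted_norm :: "('i \<Rightarrow> real) \<Rightarrow> 'k::field fls ^ 'i \<Rightarrow> real" where
  "weighted_norm w v = Max (range (\<lambda>j. w j * fls_abs (v $ j)))"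

lemma wedge_norm_ge:
  "fls_abs (det (frame S J)) * (\<Prod>i | length S \<le> pos i. inverse (w (J i))) \<le> wedge_norm w S"
  unfolding wedge_norm_def by (intro Max_ge) auto

lemma wedge_norm_leI:
  "(\<And>J. fls_abs (det (frame S J)) * (\<Prod>i | length S \<le> pos i. inverse (w (J i))) \<le> B) \<Longrightarrow> wedge_norm w S \<le> B"
  unfolding wedge_norm_def by (intro Max.boundedI) auto

lemma wedge_norm_attained:
  "\<exists>J. wedge_norm w S = fls_abs (det (frame S J)) * (\<Prod>i | length S \<le> pos i. inverse (w (J i)))"
proof -
  have "wedge_norm w S \<in> range (\<lambda>J. fls_abs (det (frame S J)) * (\<Prod>i | length S \<le> pos i. inverse (w (J i))))"
    unfolding wedge_norm_def by (intro Max_in) auto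
  then show ?thesis by blast
qed

text \<open>Expand \<open>v\<close> in the standard basis in the row numbered
  \<open>length S\<close>: each term is a coordinate of \<open>S\<close> for \<open>J\<close>
  changed at that row. The ultrametric inequality makes the constant 1.\<close>

lemma wedge_norm_snoc:
  fixes v :: "'k::field fls ^ 'i"
  assumes w: "\<And>i. w i > 0" and len: "length S < CARD('i)"
  shows "wedge_norm w (S @ [v]) \<le> wedge_norm w S * weighted_norm w v"
proof (rule wedge_norm_leI)
  fix J :: "'i \<Rightarrow> 'i"
  let ?k = "length S"
  obtain i0 :: 'i where i0: "pos i0 = ?k"
    using bij_betw_pos[where 'i = 'i] len unfolding bij_betw_def by (metis imageE lessThan_iff)
  define P where "P = (\<Prod>i | Suc ?k \<le> pos i. inverse (w (J i)))"
  have "wedge_norm w S \<ge> 0"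
    by (rule order_trans[OF _ wedge_norm_ge[of S id]])
       (use w in \<open>auto intro!: mult_nonneg_nonneg prod_nonneg simp: less_imp_le\<close>)
  have "P > 0"
    unfolding P_def using w by (intro prod_pos) auto
  have frame_eq: "frame S (J(i0 := j)) = (\<chi> i. if i = i0 then axis j 1 else frame S J $ i)" for j
    using i0 by (auto simp: frame_def vec_eq_iff)
  have "frame (S @ [v]) J = (\<chi> i. if i = i0 then (\<Sum>j\<in>UNIV. v $ j *s axis j 1) else frame S J $ i)"
  proof -
    have "frame (S @ [v]) J $ i = (if i = i0 then v else frame S J $ i)" for i
    proof (cases "i = i0")
      case False
      then have "pos i \<noteq> ?k"
        using i0 by (metis pos_eq_iff)
      then show ?thesis
        using False by (auto simp: frame_def nth_append)
    qed (simp add: frame_def i0)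
    then show ?thesis
      by (simp add: vec_eq_iff basis_expansion)
  qed
  then have "det (frame (S @ [v]) J) = (\<Sum>j\<in>UNIV. det (\<chi> i. if i = i0 then v $ j *s axis j 1 else frame S J $ i))"
    by (simp add: det_linear_row_sum[where a = "\<lambda>_ j. v $ j *s axis j 1"])
  also have "\<dots> = (\<Sum>j\<in>UNIV. v $ j * det (frame S (J(i0 := j))))"
    unfolding frame_eq by (intro sum.cong det_row_mul[where a = "\<lambda>_. axis _ 1"] refl)
  finally have det_eq: "det (frame (S @ [v]) J) = (\<Sum>j\<in>UNIV. v $ j * det (frame S (J(i0 := j))))" .
  have le: "fls_abs (v $ j * det (frame S (J(i0 := j)))) \<le> wedge_norm w S * weighted_norm w v / P" for j
  proof -
    have "{i :: 'i. ?k \<le> pos i} = insert i0 {i. Suc ?k \<le> pos i}"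
      using i0 by (auto simp: Suc_le_eq order_le_less)
    then have "(\<Prod>i | ?k \<le> pos i. inverse (w ((J(i0 := j)) i))) =
        inverse (w j) * (\<Prod>i | Suc ?k \<le> pos i. inverse (w ((J(i0 := j)) i)))"
      using i0 by simp
    also have "(\<Prod>i | Suc ?k \<le> pos i. inverse (w ((J(i0 := j)) i))) = P"
      unfolding P_def using i0 by (intro prod.cong) auto
    finally have prod_eq: "(\<Prod>i | ?k \<le> pos i. inverse (w ((J(i0 := j)) i))) = inverse (w j) * P" .
    have "fls_abs (det (frame S (J(i0 := j)))) * (inverse (w j) * P) \<le> wedge_norm w S"
      using wedge_norm_ge[of S "J(i0 := j)" w] unfolding prod_eq .
    moreover have "w j * fls_abs (v $ j) \<le> weighted_norm w v"
      unfolding weighted_norm_def by (intro Max_ge) auto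
    ultimately have "fls_abs (det (frame S (J(i0 := j)))) * (inverse (w j) * P) * (w j * fls_abs (v $ j))
        \<le> wedge_norm w S * weighted_norm w v"
      using w[of j] \<open>P > 0\<close> \<open>wedge_norm w S \<ge> 0\<close> by (intro mult_mono) auto
    then show ?thesis
      using w[of j] \<open>P > 0\<close> by (simp add: fls_abs_mult field_simps)
  qed
  have "fls_abs (det (frame (S @ [v]) J)) \<le> wedge_norm w S * weighted_norm w v / P"
    unfolding det_eq by (intro fls_abs_sum_le le order_trans[OF fls_abs_nonneg le])
  then show "fls_abs (det (frame (S @ [v]) J)) * (\<Prod>i | length (S @ [v]) \<le> pos i. inverse (w (J i)))
      \<le> wedge_norm w S * weighted_norm w v"
    using \<open>P > 0\<close> unfolding P_def by (simp add: field_simps)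
qed

text \<open>The starting value for flags. For a permutation \<open>J\<close> the determinant is a
  sign and the weights multiply to 1; otherwise two rows coincide.\<close>

lemma wedge_norm_Nil:
  fixes w :: "'i::finite \<Rightarrow> real"
  assumes "(\<Prod>i\<in>UNIV. w i) = 1"
  shows "wedge_norm w ([] :: ('k::field fls ^ 'i) list) \<le> 1"
proof (rule wedge_norm_leI)
  fix J :: "'i \<Rightarrow> 'i"
  have frame_Nil: "(frame [] J :: 'k fls ^ 'i ^ 'i) = (\<chi> i. axis (J i) 1)"
    by (simp add: frame_def)
  show "fls_abs (det (frame [] J :: 'k fls ^ 'i ^ 'i)) * (\<Prod>i | length [] \<le> pos i. inverse (w (J i))) \<le> 1"
  proof (cases "inj J")
    case True
    then have J: "J permutes UNIV"
      by (intro bij_imp_permutes) (auto simp: bij_betw_def intro!: finite_UNIV_inj_surj)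
    have "(frame [] J :: 'k fls ^ 'i ^ 'i) = (\<chi> i. (mat 1) $ J i)"
      by (auto simp: frame_Nil vec_eq_iff axis_def mat_def)
    then have "det (frame [] J :: 'k fls ^ 'i ^ 'i) = of_int (sign J)"
      using det_permute_rows[OF J, of "mat 1 :: 'k fls ^ 'i ^ 'i"] by simp
    then have "fls_abs (det (frame [] J :: 'k fls ^ 'i ^ 'i)) = 1"
      by (simp add: sign_def)
    moreover have "(\<Prod>i\<in>UNIV. inverse (w (J i))) = (\<Prod>i\<in>UNIV. inverse (w i))"
      using prod.permute[OF J, of "\<lambda>i. inverse (w i)"] by (simp add: o_def)
    ultimately show ?thesis
      using assms prod_inversef[of w UNIV] by (simp add: o_def)
  next
    case False
    then obtain i j where "i \<noteq> j" "J i = J j"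
      by (auto simp: inj_on_def)
    then have "det (frame [] J :: 'k fls ^ 'i ^ 'i) = 0"
      by (intro det_identical_rows[of i j]) (auto simp: frame_Nil row_def)
    then show ?thesis by simp
  qed
qed

text \<open>Identity outside the first \<open>k\<close> positions, so that the completing axes stay
  fixed.\<close>

definition basis_change :: "nat \<Rightarrow> (nat \<Rightarrow> nat \<Rightarrow> 'a::field) \<Rightarrow> 'a ^ 'i ^ 'i::finite" where
  "basis_change k A =
     (\<chi> i l. if pos i < k then if pos l < k then A (pos i) (pos l) else 0 else if i = l then 1 else 0)"

text \<open>The factor does not depend on \<open>J\<close>: a change of basis multiplies the whole
  exterior product by one scalar.\<close>

lemma det_frame_basis_change:
  fixes S T :: "('a::field ^ 'i) list"
  assumes len: "length S = k" "length T = k" "k \<le> CARD('i)"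
    and A: "\<And>a. a < k \<Longrightarrow> S ! a = (\<Sum>b<k. A a b *s T ! b)"
  shows "det (frame S J) = det (basis_change k A :: 'a ^ 'i ^ 'i) * det (frame T J)"
proof -
  have "(basis_change k A ** frame T J) $ i $ m = frame S J $ i $ m" for i m
  proof (cases "pos i < k")
    case True
    have "(basis_change k A ** frame T J) $ i $ m =
        (\<Sum>l\<in>(UNIV :: 'i set). if pos l < k then A (pos i) (pos l) * (T ! pos l) $ m else 0)"
      unfolding matrix_matrix_mult_def vec_lambda_beta
      using True len by (intro sum.cong) (auto simp: basis_change_def frame_def)
    also have "\<dots> = (\<Sum>l | pos (l :: 'i) < k. A (pos i) (pos l) * (T ! pos l) $ m)"
      by (simp add: sum.If_cases)
    also have "\<dots> = (\<Sum>b<k. A (pos i) b * (T ! b) $ m)"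
      using bij_betw_pos_less[OF len(3)] by (rule sum.reindex_bij_betw)
    also have "\<dots> = frame S J $ i $ m"
      using True len A by (simp add: frame_def)
    finally show ?thesis .
  next
    case False
    then have "(basis_change k A ** frame T J) $ i $ m = (\<Sum>l\<in>UNIV. if i = l then frame T J $ l $ m else 0)"
      unfolding matrix_matrix_mult_def vec_lambda_beta
      by (intro sum.cong) (auto simp: basis_change_def)
    with False len show ?thesis
      by (simp add: frame_def)
  qed
  then have "frame S J = basis_change k A ** frame T J"
    by (simp add: vec_eq_iff)
  then show ?thesis
    by (simp add: det_mul)
qed

lemma coeffs_of_subset_span:
  fixes S T :: "('a::field ^ 'i) list"
  assumes "set S \<subseteq> vec.span (set T)" and "distinct T"
  shows "\<exists>A. \<forall>a<length S. S ! a = (\<Sum>b<length T. A a b *s T ! b)"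
proof -
  have "\<exists>u. S ! a = (\<Sum>b<length T. u b *s T ! b)" if "a < length S" for a
  proof -
    have "S ! a \<in> range (\<lambda>u. \<Sum>v\<in>set T. u v *s v)"
      using that assms(1) nth_mem by (fastforce simp: vec.span_finite)
    then obtain u where u: "S ! a = (\<Sum>v\<in>set T. u v *s v)" by blast
    have "bij_betw ((!) T) {..<length T} (set T)"
      using assms(2) by (intro bij_betw_nth) auto
    then have "S ! a = (\<Sum>b<length T. u (T ! b) *s T ! b)"
      unfolding u by (rule sum.reindex_bij_betw[symmetric])
    then show ?thesis by (intro exI[of _ "\<lambda>b. u (T ! b)"])
  qed
  then show ?thesis by metis
qed

text \<open>
  A pair \<open>(p, q)\<close> is the vector with entry \<open>p\<close> at \<open>None\<close> and entries \<open>q $ j\<close> at \<open>Some j\<close>.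
\<close>

definition shear :: "'a::field ^ 'n \<Rightarrow> 'a ^ ('n::finite) option \<Rightarrow> 'a ^ 'n option" where
  "shear y v = (\<chi> i. case i of None \<Rightarrow> v $ None + (\<Sum>j\<in>UNIV. y $ j * v $ Some j) | Some j \<Rightarrow> v $ Some j)"

lemma shear_None: "shear y v $ None = v $ None + (\<Sum>j\<in>UNIV. y $ j * v $ Some j)"
  and shear_Some [simp]: "shear y v $ Some j = v $ Some j"
  by (simp_all add: shear_def)

lemma linear_shear: "Vector_Spaces.linear (*s) (*s) (shear y)"
proof
  show "shear y (u + v) = shear y u + shear y v" for u v
    by (auto simp: shear_def vec_eq_iff sum.distrib algebra_simps split: option.split)
  show "shear y (c *s v) = c *s shear y v" for c v
    by (auto simp: shear_def vec_eq_iff sum_distrib_left algebra_simps split: option.split)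
qed

lemma shear_sum: "shear y (\<Sum>b\<in>B. A b *s v b) = (\<Sum>b\<in>B. A b *s shear y (v b))"
proof -
  interpret l: Vector_Spaces.linear "(*s)" "(*s)" "shear y"
    by (rule linear_shear)
  show ?thesis by (simp add: l.sum l.scale)
qed

lemma inj_shear: "inj (shear y)"
proof (rule inj_on_inverseI)
  show "shear (- y) (shear y v) = v" for v
    by (auto simp: shear_def vec_eq_iff sum_negf split: option.split)
qed

text \<open>\<open>shear y\<close> is linear, so the coefficients expressing \<open>S\<close> by
  \<open>T\<close> also connect the sheared lists. One scalar thus serves all \<open>y\<close> and
  \<open>J\<close>.\<close>

lemma det_frame_shear_basis_change:
  fixes S T :: "('a::field ^ ('n::finite) option) list"
  assumes "set S \<subseteq> vec.span (set T)" "distinct T" "length S = length T" "length T \<le> CARD('n option)"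
  shows "\<exists>c. \<forall>y J. det (frame (map (shear y) S) J) = c * det (frame (map (shear y) T) J)"
proof -
  obtain A where A: "\<And>a. a < length S \<Longrightarrow> S ! a = (\<Sum>b<length T. A a b *s T ! b)"
    using coeffs_of_subset_span[OF assms(1,2)] by blast
  have "map (shear y) S ! a = (\<Sum>b<length T. A a b *s map (shear y) T ! b)" if "a < length T" for a y
    using that assms(3) A[of a] by (simp add: shear_sum)
  then have "det (frame (map (shear y) S) J) =
      det (basis_change (length T) A :: 'a ^ 'n option ^ 'n option) * det (frame (map (shear y) T) J)" for y J
    using assms by (intro det_frame_basis_change) auto
  then show ?thesis by blast
qed

text \<open>Only the column \<open>None\<close> depends on \<open>y\<close>, and it does so
  affinely; the determinant is linear in that column. The completing axes are not sheared and
  contribute 0 to the added columns. The explicit form of the coefficients serves to show that they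
  are polynomials.\<close>

lemma det_frame_shear_affine:
  fixes S :: "('a::field ^ ('n::finite) option) list"
  obtains D0 D where "\<And>y. det (frame (map (shear y) S) J) = D0 + (\<Sum>j\<in>UNIV. D j * y $ j)"
    and "D0 = det (frame S J)"
    and "\<And>j. D j = det (\<chi> l. if l = None then \<chi> i. if pos i < length S then S ! pos i $ Some j else 0
          else \<chi> i. frame S J $ i $ l)"
proof -
  define R where "R l = (\<chi> i. frame S J $ i $ l)" for l
  define c where "c j = (\<chi> i :: 'n option. if pos i < length S then S ! pos i $ Some j else 0)" for j
  have "det (frame (map (shear y) S) J) = det (frame S J) +
      (\<Sum>j\<in>UNIV. det (\<chi> l. if l = None then c j else R l) * y $ j)" for y
  proof -
    have "transpose (frame (map (shear y) S) J) =
        (\<chi> l. if l = None then R l + (\<Sum>j\<in>UNIV. y $ j *s c j) else R l)"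
      by (auto simp: vec_eq_iff transpose_def frame_def R_def c_def shear_def split: option.split)
    then have "det (frame (map (shear y) S) J) =
        det (\<chi> l. if l = None then R l + (\<Sum>j\<in>UNIV. y $ j *s c j) else R l)"
      by (metis det_transpose)
    also have "\<dots> = det (\<chi> l. if l = None then R l else R l) +
        det (\<chi> l. if l = None then (\<Sum>j\<in>UNIV. y $ j *s c j) else R l)"
      by (rule det_row_add)
    also have "(\<chi> l. if l = None then R l else R l) = transpose (frame S J)"
      by (simp add: R_def transpose_def vec_eq_iff)
    also have "det (\<chi> l. if l = None then (\<Sum>j\<in>UNIV. y $ j *s c j) else R l) =
        (\<Sum>j\<in>UNIV. det (\<chi> l. if l = None then y $ j *s c j else R l))"
      by (rule det_linear_row_sum) simp
    also have "\<dots> = (\<Sum>j\<in>UNIV. det (\<chi> l. if l = None then c j else R l) * y $ j)"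
      by (simp add: det_row_mul mult.commute)
    finally show ?thesis by simp
  qed
  from this[unfolded c_def R_def] show ?thesis
    by (rule that) (rule refl)+
qed

section \<open>Determinants of lists of polynomial vectors\<close>

lemma det_in_fls_polys:
  fixes A :: "'k::field fls ^ 'i ^ 'i"
  assumes "\<And>i j. A $ i $ j \<in> fls_polys"
  shows "det A \<in> fls_polys"
proof -
  have "of_int (sign p) \<in> (fls_polys :: 'k fls set)" for p :: "'i \<Rightarrow> 'i"
    by (auto simp: sign_def intro: fls_polys_uminus)
  then show ?thesis
    unfolding det_def using assms by (intro fls_polys_sum fls_polys_mult fls_polys_prod) auto
qed

definition poly_vecs :: "('k::field fls ^ 'i) set" where
  "poly_vecs = {v. \<forall>i. v $ i \<in> fls_polys}"

lemma frame_in_fls_polys: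
  assumes "set S \<subseteq> poly_vecs"
  shows "frame S J $ i $ l \<in> fls_polys"
proof (cases "pos i < length S")
  case True
  then have "S ! pos i \<in> poly_vecs"
    using assms nth_mem by blast
  with True show ?thesis
    by (simp add: frame_def poly_vecs_def)
qed (simp add: frame_def axis_def)

lemma det_frame_shear_affine_polys:
  fixes S :: "('k::field fls ^ ('n::finite) option) list"
  assumes S: "set S \<subseteq> poly_vecs"
  obtains D0 D where "\<And>y. det (frame (map (shear y) S) J) = D0 + (\<Sum>j\<in>UNIV. D j * y $ j)"
    and "D0 \<in> fls_polys" and "\<And>j. D j \<in> fls_polys"
proof (rule det_frame_shear_affine[of S J])
  fix D0 D
  assume 1: "\<And>y. det (frame (map (shear y) S) J) = D0 + (\<Sum>j\<in>UNIV. D j * y $ j)"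
    and 2: "D0 = det (frame S J)"
    and 3: "\<And>j. D j = det (\<chi> l. if l = None then \<chi> i. if pos i < length S then S ! pos i $ Some j else 0
          else \<chi> i. frame S J $ i $ l)"
  show thesis
  proof (rule that[OF 1])
    show "D0 \<in> fls_polys"
      unfolding 2 using frame_in_fls_polys[OF S] by (rule det_in_fls_polys)
    have "S ! a $ m \<in> fls_polys" if "a < length S" for a m
      using S that nth_mem[OF that] unfolding poly_vecs_def by blast
    then show "D j \<in> fls_polys" for j
      unfolding 3 using frame_in_fls_polys[OF S] by (intro det_in_fls_polys) auto
  qed
qed

text \<open>\<open>J\<close> must avoid \<open>None\<close> because the weights at the other indices
  are at most 1 in the flow, so completing by these axes does not shrink the coordinate. The point
  \<open>y\<close> shows that the affine function given by \<open>J\<close> is not zero, and its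
  polynomial entries make the determinant a polynomial.\<close>

lemma exists_completing_axes:
  fixes S :: "('k::field fls ^ ('n::finite) option) list"
  assumes S: "S \<noteq> []" "distinct S" "vec.independent (set S)"
  obtains y J where "y \<in> poly_vecs" and "\<And>i. length S \<le> pos i \<Longrightarrow> J i \<noteq> None"
    and "det (frame (map (shear y) S) J) \<noteq> 0"
proof -
  let ?N = "CARD('n option)"
  obtain v S' where S_eq: "S = v # S'"
    using S(1) by (cases S) auto
  then have "v \<noteq> 0"
    using S(3) vec.dependent_zero[of "set S"] S_eq by auto
  have "\<exists>y \<in> poly_vecs. shear y v $ None \<noteq> 0"
  proof (cases "v $ None = 0")
    case True
    then obtain j where j: "v $ Some j \<noteq> 0"
      using \<open>v \<noteq> 0\<close> by (metis option.exhaust vec_eq_iff zero_index)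
    then have "shear (axis j 1) v $ None \<noteq> 0"
      using True by (simp add: shear_None axis_def if_distrib[of "\<lambda>x. x * _"] cong: if_cong)
    moreover have "axis j 1 \<in> poly_vecs"
      by (simp add: poly_vecs_def axis_def)
    ultimately show ?thesis by blast
  next
    case False
    then show ?thesis
      by (intro bexI[of _ 0]) (auto simp: shear_None poly_vecs_def)
  qed
  then obtain y where y: "y \<in> poly_vecs" "shear y v $ None \<noteq> 0" by blast
  define S1 where "S1 = shear y ` set S"
  \<comment> \<open>After the shear the first vector has a nonzero entry at \<open>None\<close>, so
    \<open>V\<close> spans the whole space and the missing basis vectors can be taken from the axes
    \<open>Some j\<close>.\<close>
  define V where "V = S1 \<union> range (\<lambda>j. axis (Some j) 1)"
  interpret l: Vector_Spaces.linear "(*s)" "(*s)" "shear y"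
    by (rule linear_shear)
  have "vec.independent S1"
    unfolding S1_def using S(3) inj_on_subset[OF inj_shear subset_UNIV]
    by (rule l.independent_injective_image)
  then obtain B where B: "S1 \<subseteq> B" "B \<subseteq> V" "vec.independent B" "V \<subseteq> vec.span B"
    using vec.maximal_independent_subset_extend[of S1 V] V_def by blast
  have ax: "axis (Some j) 1 \<in> vec.span B" for j
    using B(4) unfolding V_def by blast
  have "axis None 1 \<in> vec.span B"
  proof -
    define z where "z = shear y v"
    have "z \<in> vec.span B"
      using B(4) unfolding V_def S1_def z_def S_eq by auto
    then have "z - (\<Sum>j\<in>UNIV. z $ Some j *s axis (Some j) 1) \<in> vec.span B"
      by (intro vec.span_diff vec.span_sum vec.span_scale ax)
    moreover have "z - (\<Sum>j\<in>UNIV. z $ Some j *s axis (Some j) 1) = z $ None *s axis None 1"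
    proof -
      have "z = (\<Sum>i\<in>UNIV. z $ i *s axis i 1)"
        by (rule basis_expansion[symmetric])
      also have "\<dots> = z $ None *s axis None 1 + (\<Sum>j\<in>UNIV. z $ Some j *s axis (Some j) 1)"
        by (simp add: UNIV_option_conv sum.reindex)
      finally show ?thesis by (simp add: algebra_simps)
    qed
    ultimately have "z $ None *s axis None 1 \<in> vec.span B"
      by simp
    from vec.span_scale[OF this, of "inverse (z $ None)"] show ?thesis
      using y(2) by (simp add: z_def vector_smult_assoc)
  qed
  with ax have "cart_basis \<subseteq> vec.span B"
    unfolding cart_basis_def by (auto, metis option.exhaust)
  then have "vec.span cart_basis \<subseteq> vec.span B"
    by (intro vec.span_minimal vec.subspace_span)
  then have span_B: "vec.span B = UNIV"
    by auto
  have card_B: "card B = ?N"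
    using vec.dim_span_eq_card_independent[OF B(3)] unfolding span_B by (simp add: card_cart_basis)
  have fin_B: "finite B"
    using B(3) by (rule vec.finiteI_independent)
  have card_S1: "card S1 = length S"
    unfolding S1_def using S(2) by (simp add: card_image inj_on_subset[OF inj_shear] distinct_card)
  then have len: "length S \<le> ?N"
    using card_mono[OF fin_B B(1)] card_B by simp
  have "card {i :: 'n option. pos i < length S} = length S"
    using bij_betw_same_card[OF bij_betw_pos_less[OF len]] by simp
  then have "card (UNIV - {i :: 'n option. pos i < length S}) = ?N - length S"
    by (subst card_Diff_subset) auto
  also have "UNIV - {i :: 'n option. pos i < length S} = {i. length S \<le> pos i}"
    by auto
  finally have "card {i :: 'n option. length S \<le> pos i} = card (B - S1)"
    using card_B card_S1 by (simp add: card_Diff_subset[OF finite_subset[OF B(1) fin_B] B(1)])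
  then obtain h where h: "bij_betw h {i :: 'n option. length S \<le> pos i} (B - S1)"
    using fin_B by (metis finite finite_Diff finite_same_card_bij)
  have "\<exists>j. h i = axis (Some j) 1" if "length S \<le> pos i" for i
    using h that B(2) unfolding V_def bij_betw_def by blast
  then obtain g where g: "\<And>i. length S \<le> pos i \<Longrightarrow> h i = axis (Some (g i)) 1"
    by metis
  define J where "J i = Some (g i)" for i
  have "B \<subseteq> rows (frame (map (shear y) S) J)"
  proof
    fix b assume b: "b \<in> B"
    have row: "frame (map (shear y) S) J $ i \<in> rows (frame (map (shear y) S) J)" for i
      by (auto simp: rows_def row_def)
    show "b \<in> rows (frame (map (shear y) S) J)"
    proof (cases "b \<in> S1")
      case True
      then obtain a where a: "a < length S" "b = shear y (S ! a)"
        unfolding S1_def by (auto simp: in_set_conv_nth)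
      then obtain i :: "'n option" where "pos i = a"
        using bij_betw_pos_less[OF len] unfolding bij_betw_def by (metis (mono_tags, lifting) imageE lessThan_iff)
      then show ?thesis
        using row[of i] a by (simp add: frame_def)
    next
      case False
      then obtain i where "length S \<le> pos i" "b = h i"
        using h b unfolding bij_betw_def by blast
      then show ?thesis
        using row[of i] g by (simp add: frame_def J_def)
    qed
  qed
  then have "vec.span (rows (frame (map (shear y) S) J)) = UNIV"
    using span_B vec.span_mono by blast
  then have "det (frame (map (shear y) S) J) \<noteq> 0"
    by (simp add: matrix_left_invertible_span_rows_gen[symmetric] invertible_left_inverse[symmetric] invertible_det_nz)
  then show ?thesis
    using y(1) by (intro that[of y J]) (auto simp: J_def)
qed

subsection \<open>Covolumes of polynomial lattices\<close>

text \<open>Finitely many points of \<open>B\<close> carry the independence. The vectors (1, f(x))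
  at these points are the nonzero rows of \<open>A\<close>; independence makes \<open>A\<close>
  injective, and a left inverse bounds the coefficients by the values of the combination at these
  points.\<close>

lemma exists_uniform_lower_bound:
  fixes f :: "'x \<Rightarrow> 'k::field fls ^ ('n::finite)"
  assumes indep: "\<And>a0 a. (\<forall>x\<in>B. a0 + (\<Sum>i\<in>UNIV. a $ i * f x $ i) = 0) \<Longrightarrow> a0 = 0 \<and> (\<forall>i. a $ i = 0)"
  shows "\<exists>c>0. \<forall>a0 a. (fls_abs a0 \<ge> 1 \<or> (\<exists>i. fls_abs (a $ i) \<ge> 1)) \<longrightarrow>
    (\<exists>x\<in>B. fls_abs (a0 + (\<Sum>i\<in>UNIV. a $ i * f x $ i)) \<ge> c)"
proof -
  define ext :: "'x \<Rightarrow> 'k fls ^ 'n option" where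
    "ext x = (\<chi> i. case i of None \<Rightarrow> 1 | Some j \<Rightarrow> f x $ j)" for x
  define mk :: "'k fls \<Rightarrow> 'k fls ^ 'n \<Rightarrow> 'k fls ^ 'n option" where
    "mk a0 a = (\<chi> i. case i of None \<Rightarrow> a0 | Some j \<Rightarrow> a $ j)" for a0 a
  have dot: "(\<Sum>i\<in>UNIV. ext x $ i * z $ i) = z $ None + (\<Sum>j\<in>UNIV. z $ Some j * f x $ j)" for x z
    by (simp add: UNIV_option_conv sum.reindex ext_def mult.commute)
  obtain Bs where Bs: "Bs \<subseteq> ext ` B" "vec.independent Bs" "ext ` B \<subseteq> vec.span Bs"
    using vec.maximal_independent_subset[of "ext ` B"] by blast
  have fin: "finite Bs"
    using Bs(2) by (rule vec.finiteI_independent)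
  have "card Bs \<le> CARD('n option)"
    using vec.independent_card_le_dim[OF subset_UNIV Bs(2)] by (simp add: card_cart_basis)
  then obtain g :: "'k fls ^ 'n option \<Rightarrow> 'n option" where g: "inj_on g Bs"
    using card_le_inj[OF fin, of "UNIV :: 'n option set"] by auto
  \<comment> \<open>The rows are indexed by coordinates: \<open>g\<close> places the chosen vectors,
    and the remaining rows are 0. A large entry of \<open>A *v z\<close> therefore belongs to a
    point of \<open>B\<close>.\<close>
  define A :: "'k fls ^ 'n option ^ 'n option" where
    "A = (\<chi> i. if i \<in> g ` Bs then inv_into Bs g i else 0)"
  have A_row: "A $ i = 0 \<or> A $ i \<in> Bs" for i
    by (auto simp: A_def inv_into_into)
  have A_nth: "(A *v z) $ i = (\<Sum>l\<in>UNIV. A $ i $ l * z $ l)" for i z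
    by (simp add: matrix_vector_mult_def)
  have "z = 0" if "A *v z = 0" for z
  proof -
    define V where "V = {v. (\<Sum>l\<in>UNIV. v $ l * z $ l) = 0}"
    have "vec.subspace V"
      unfolding V_def vec.subspace_def
      by (auto simp: distrib_right sum.distrib mult.assoc sum_distrib_left[symmetric])
    moreover have "Bs \<subseteq> V"
    proof
      fix b assume b: "b \<in> Bs"
      then have "A $ g b = b"
        using g by (simp add: A_def)
      then show "b \<in> V"
        using A_nth[of z "g b"] that by (simp add: V_def)
    qed
    ultimately have span_V: "vec.span Bs \<subseteq> V"
      by (intro vec.span_minimal)
    have "\<forall>x\<in>B. z $ None + (\<Sum>j\<in>UNIV. (\<chi> j. z $ Some j) $ j * f x $ j) = 0"
    proof
      fix x assume "x \<in> B"
      then have "ext x \<in> V"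
        using Bs(3) span_V by blast
      then show "z $ None + (\<Sum>j\<in>UNIV. (\<chi> j. z $ Some j) $ j * f x $ j) = 0"
        using dot[of x z] unfolding V_def by (simp del: UNIV_option_conv)
    qed
    then have "z $ None = 0 \<and> (\<forall>j. (\<chi> j. z $ Some j) $ j = 0)"
      by (rule indep)
    then have "z $ i = 0" for i
      by (cases i) auto
    then show "z = 0"
      by (simp add: vec_eq_iff)
  qed
  then have "\<exists>L. L ** A = mat 1"
    unfolding matrix_left_invertible_ker by blast
  then obtain L where L: "L ** A = mat 1" ..
  \<comment> \<open>The added 1 keeps \<open>M\<close> positive. The bound
    \<open>1 / (2 * M)\<close> used below would force every coefficient to have absolute value at
    most 1/2.\<close>
  define M where "M = (\<Sum>i\<in>UNIV. \<Sum>l\<in>UNIV. fls_abs (L $ i $ l)) + 1"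
  have M_ge: "fls_abs (L $ i $ l) \<le> M" for i l
  proof -
    have "fls_abs (L $ i $ l) \<le> (\<Sum>l\<in>UNIV. fls_abs (L $ i $ l))"
      by (rule member_le_sum) auto
    also have "\<dots> \<le> (\<Sum>i\<in>UNIV. \<Sum>l\<in>UNIV. fls_abs (L $ i $ l))"
      by (rule member_le_sum[where f = "\<lambda>i. \<Sum>l\<in>UNIV. fls_abs (L $ i $ l)"]) (auto intro: sum_nonneg)
    finally show ?thesis
      by (simp add: M_def)
  qed
  have "M > 0"
    unfolding M_def by (intro add_nonneg_pos sum_nonneg) auto
  show ?thesis
  proof (intro exI[of _ "1 / (2 * M)"] conjI allI impI)
    fix a0 :: "'k fls" and a :: "'k fls ^ 'n" assume "fls_abs a0 \<ge> 1 \<or> (\<exists>i. fls_abs (a $ i) \<ge> 1)"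
    then obtain i where i: "fls_abs (mk a0 a $ i) \<ge> 1"
    proof
      assume "fls_abs a0 \<ge> 1"
      then show thesis
        using that[of None] by (simp add: mk_def)
    next
      assume "\<exists>i. fls_abs (a $ i) \<ge> 1"
      then obtain j where "fls_abs (a $ j) \<ge> 1" ..
      then show thesis
        using that[of "Some j"] by (simp add: mk_def)
    qed
    define z where "z = mk a0 a"
    have "\<exists>l. fls_abs ((A *v z) $ l) \<ge> 1 / (2 * M)"
    proof (rule ccontr)
      assume "\<not> ?thesis"
      then have small: "fls_abs ((A *v z) $ l) \<le> 1 / (2 * M)" for l
        by (meson less_imp_le not_le)
      have "z = L *v (A *v z)"
        by (simp add: matrix_vector_mul_assoc L)
      then have "z $ i = (L *v (A *v z)) $ i"
        by (rule arg_cong)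
      then have "z $ i = (\<Sum>l\<in>UNIV. L $ i $ l * (A *v z) $ l)"
        unfolding matrix_vector_mult_def[of L] by simp
      moreover have "fls_abs (\<Sum>l\<in>UNIV. L $ i $ l * (A *v z) $ l) \<le> M * (1 / (2 * M))"
      proof (rule fls_abs_sum_le)
        show "fls_abs (L $ i $ l * (A *v z) $ l) \<le> M * (1 / (2 * M))" for l
          unfolding fls_abs_mult using \<open>M > 0\<close> by (intro mult_mono M_ge small) auto
      qed (use \<open>M > 0\<close> in simp)
      ultimately show False
        using i \<open>M > 0\<close> by (simp add: z_def)
    qed
    then obtain l where l: "fls_abs ((A *v z) $ l) \<ge> 1 / (2 * M)" ..
    then have "(A *v z) $ l \<noteq> 0"
      using \<open>M > 0\<close> by (auto simp: not_le)
    then have "A $ l \<noteq> 0"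
      unfolding A_nth by auto
    then obtain x where x: "x \<in> B" "A $ l = ext x"
      using A_row[of l] Bs(1) by blast
    then have "(A *v z) $ l = a0 + (\<Sum>i\<in>UNIV. a $ i * f x $ i)"
      unfolding A_nth x(2) dot by (simp add: z_def mk_def)
    with l x(1) show "\<exists>x\<in>B. fls_abs (a0 + (\<Sum>i\<in>UNIV. a $ i * f x $ i)) \<ge> 1 / (2 * M)"
      by auto
  qed (use \<open>M > 0\<close> in simp)
qed

text \<open>A sublattice is represented by an ordered basis, to which determinants apply directly.
  The condition \<open>S \<noteq> []\<close> excludes the zero subspace.\<close>

definition basis_lists :: "('k::field fls ^ 'i) list set" where
  "basis_lists = {S. S \<noteq> [] \<and> distinct S \<and> vec.independent (set S) \<and> set S \<subseteq> poly_vecs}"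

lemma length_basis_list: "S \<in> basis_lists \<Longrightarrow> length S = vec.dim (set S)"
  using vec.dim_eq_card_independent[of "set S"] distinct_card[of S] by (simp add: basis_lists_def)

lemma length_basis_list_le:
  fixes S :: "('k::field fls ^ 'i) list"
  shows "S \<in> basis_lists \<Longrightarrow> length S \<le> CARD('i)"
  using vec.dim_subset[of "set S" UNIV] by (simp add: length_basis_list card_cart_basis)

lemma length_basis_list_cong:
  "S \<in> basis_lists \<Longrightarrow> T \<in> basis_lists \<Longrightarrow> vec.span (set S) = vec.span (set T) \<Longrightarrow> length S = length T"
  by (metis length_basis_list vec.dim_span)

lemma det_frame_basis_lists:
  fixes S T :: "('k::field fls ^ ('n::finite) option) list"
  assumes "S \<in> basis_lists" "T \<in> basis_lists" "vec.span (set S) = vec.span (set T)"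
  shows "\<exists>c. \<forall>y J. det (frame (map (shear y) S) J) = c * det (frame (map (shear y) T) J)"
proof (rule det_frame_shear_basis_change)
  show "set S \<subseteq> vec.span (set T)"
    using assms(3) vec.span_superset[of "set S"] by simp
  show "distinct T"
    using assms(2) by (simp add: basis_lists_def)
  show "length S = length T"
    using assms by (rule length_basis_list_cong)
  show "length T \<le> CARD('n option)"
    using assms(2) by (rule length_basis_list_le)
qed

text \<open>These play the part of bases of primitive sublattices: among the polynomial bases of one
  subspace they have the least determinants, for all \<open>y\<close> and \<open>J\<close>
  simultaneously.\<close>

definition minimal_lists :: "('k::field fls ^ ('n::finite) option) list set" where
  "minimal_lists = {S \<in> basis_lists. \<forall>T\<in>basis_lists. vec.span (set T) = vec.span (set S) \<longrightarrow>
     (\<forall>y J. fls_abs (det (frame (map (shear y) S) J)) \<le> fls_abs (det (frame (map (shear y) T) J)))}"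

lemma minimal_lists_subset: "minimal_lists \<subseteq> basis_lists"
  by (auto simp: minimal_lists_def)

lemma shear_in_poly_vecs: "y \<in> poly_vecs \<Longrightarrow> v \<in> poly_vecs \<Longrightarrow> shear y v \<in> poly_vecs"
  unfolding poly_vecs_def
  by (auto simp: shear_def split: option.split intro!: fls_polys_add fls_polys_sum fls_polys_mult)

text \<open>
  A completing determinant at a polynomial point \<open>y\<close> is a polynomial; a list for which its degree is
  least is minimal, because the other determinants change by the same factor.
\<close>

lemma exists_minimal_list:
  fixes S :: "('k::field fls ^ ('n::finite) option) list"
  assumes S: "S \<in> basis_lists"
  shows "\<exists>T\<in>minimal_lists. vec.span (set T) = vec.span (set S)"
proof -
  have "S \<noteq> []" "distinct S" "vec.independent (set S)"
    using S by (auto simp: basis_lists_def)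
  then obtain y J where y: "y \<in> poly_vecs" and det: "det (frame (map (shear y) S) J) \<noteq> 0"
    using exists_completing_axes by metis
  define D where "D T = det (frame (map (shear y) T) J)" for T
  define P where "P T \<longleftrightarrow> T \<in> basis_lists \<and> vec.span (set T) = vec.span (set S)" for T
  have D_nz: "D T \<noteq> 0" if "P T" for T
    using det_frame_basis_lists[of S T] that S det unfolding P_def D_def by auto
  have D_poly: "D T \<in> fls_polys" if "P T" for T
  proof -
    have "set (map (shear y) T) \<subseteq> poly_vecs"
      using that y shear_in_poly_vecs unfolding P_def basis_lists_def by fastforce
    then show ?thesis
      unfolding D_def by (intro det_in_fls_polys frame_in_fls_polys)
  qed
  obtain T where T: "P T" "\<And>T'. P T' \<Longrightarrow> nat (- fls_subdegree (D T)) \<le> nat (- fls_subdegree (D T'))"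
    using ex_has_least_nat[of P S "\<lambda>T. nat (- fls_subdegree (D T))"] S unfolding P_def by blast
  have le: "fls_abs (D T) \<le> fls_abs (D T')" if "P T'" for T'
  proof -
    have "fls_subdegree (D T') \<le> 0"
      using fls_polys_abs_ge_1[OF D_poly D_nz, OF that that] D_nz[OF that] by (simp add: fls_abs_def)
    then have "- fls_subdegree (D T) \<le> - fls_subdegree (D T')"
      using T(2)[OF that] by linarith
    then show ?thesis
      using D_nz that T(1) by (simp add: fls_abs_def)
  qed
  have "fls_abs (det (frame (map (shear z) T) I)) \<le> fls_abs (det (frame (map (shear z) T') I))"
    if T': "T' \<in> basis_lists" "vec.span (set T') = vec.span (set T)" for T' z I
  proof -
    have "P T'"
      using T' T(1) by (simp add: P_def)
    obtain c where c: "\<And>y J. det (frame (map (shear y) T) J) = c * det (frame (map (shear y) T') J)"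
      using det_frame_basis_lists[of T T'] T(1) T' unfolding P_def by auto
    have "fls_abs c * fls_abs (D T') \<le> 1 * fls_abs (D T')"
      using le[OF \<open>P T'\<close>] c[of y J] by (simp add: D_def fls_abs_mult)
    then have "fls_abs c \<le> 1"
      using D_nz[OF \<open>P T'\<close>] by (simp add: mult_le_cancel_right less_le)
    then show ?thesis
      unfolding c fls_abs_mult by (intro mult_left_le_one_le) auto
  qed
  with T(1) show ?thesis
    unfolding P_def minimal_lists_def by (intro bexI[of _ T]) auto
qed

definition covol :: "('n option \<Rightarrow> real) \<Rightarrow> ('k::field fls ^ ('n::finite) option) list \<Rightarrow> 'k fls ^ 'n \<Rightarrow> real" where
  "covol w S y = wedge_norm w (map (shear y) S)"

lemma covol_minimal_le:
  assumes "\<And>i. w i > 0" and "S \<in> minimal_lists" "T \<in> basis_lists" "vec.span (set T) = vec.span (set S)"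
  shows "covol w S y \<le> covol w T y"
  unfolding covol_def
proof (rule wedge_norm_leI)
  fix J
  have len: "length T = length S"
    using assms minimal_lists_subset length_basis_list_cong by blast
  have "fls_abs (det (frame (map (shear y) S) J)) \<le> fls_abs (det (frame (map (shear y) T) J))"
    using assms by (simp add: minimal_lists_def)
  then have "fls_abs (det (frame (map (shear y) S) J)) * (\<Prod>i | length S \<le> pos i. inverse (w (J i)))
    \<le> fls_abs (det (frame (map (shear y) T) J)) * (\<Prod>i | length S \<le> pos i. inverse (w (J i)))"
    using assms(1) by (intro mult_right_mono prod_nonneg) (auto simp: less_imp_le)
  also have "\<dots> \<le> wedge_norm w (map (shear y) T)"
    using wedge_norm_ge[of "map (shear y) T" J w] len by simp
  finally show "fls_abs (det (frame (map (shear y) S) J)) *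
      (\<Prod>i | length (map (shear y) S) \<le> pos i. inverse (w (J i))) \<le> wedge_norm w (map (shear y) T)"
    by simp
qed

text \<open>Both inclusions are strict, so different bases of one subspace are never comparable and
  the members of a flag have different lengths.\<close>

definition comparable :: "('k::field fls ^ 'i) list \<Rightarrow> ('k fls ^ 'i) list \<Rightarrow> bool" where
  "comparable S T \<longleftrightarrow> vec.span (set S) \<subset> vec.span (set T) \<or> vec.span (set T) \<subset> vec.span (set S)"

lemma length_less_if_span_psubset:
  "S \<in> basis_lists \<Longrightarrow> T \<in> basis_lists \<Longrightarrow> vec.span (set S) \<subset> vec.span (set T) \<Longrightarrow> length S < length T"
  using vec.dim_psubset[of "set S" "set T"] by (simp add: length_basis_list)

lemma clique_card:
  fixes F :: "('k::field fls ^ 'i) list set"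
  assumes F: "F \<subseteq> basis_lists" and "clique comparable F"
  shows "finite F \<and> card F \<le> CARD('i)"
proof -
  have "length S \<noteq> length T" if "S \<in> F" "T \<in> F" "S \<noteq> T" for S T
  proof -
    have "comparable S T" "S \<in> basis_lists" "T \<in> basis_lists"
      using that assms unfolding clique_def by auto
    then show ?thesis
      using length_less_if_span_psubset[of S T] length_less_if_span_psubset[of T S]
      unfolding comparable_def by (metis less_irrefl)
  qed
  then have inj: "inj_on length F"
    by (auto simp: inj_on_def)
  have "length ` F \<subseteq> {1..CARD('i)}"
    using F length_basis_list_le by (force simp: basis_lists_def Suc_le_eq)
  then have "finite (length ` F)" "card (length ` F) \<le> card {1..CARD('i)}"
    by (simp_all only: finite_subset[OF _ finite_atLeastAtMost] card_mono[OF finite_atLeastAtMost])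
  with inj show ?thesis
    by (auto simp: card_image dest: finite_imageD)
qed

text \<open>Add a short \<open>v\<close> to the largest member \<open>S0\<close> of the flag whose
  span omits it. Since \<open>S0\<close> has covolume at most 1, the enlarged lattice has covolume
  below \<epsilon>. Its span either occurs in the flag or is comparable with the whole flag, and
  \<open>marked\<close> gives a lower bound in both cases.\<close>

lemma marked_imp_no_short_vector:
  fixes y :: "'k::field fls ^ ('n::finite)"
  assumes w: "\<And>i. w i > 0" "(\<Prod>i\<in>UNIV. w i) = 1" and "\<rho> \<le> 1" "\<epsilon> \<le> \<sigma>"
    and marked: "marked comparable (covol w) \<epsilon> \<rho> \<sigma> minimal_lists y"
    and v: "v \<in> poly_vecs" "v \<noteq> 0"
  shows "\<epsilon> \<le> weighted_norm w (shear y v)"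
proof (rule ccontr)
  assume "\<not> ?thesis"
  then have short: "weighted_norm w (shear y v) < \<epsilon>" by simp
  have "0 \<le> w None * fls_abs (shear y v $ None)"
    using w(1)[of None] by simp
  also have "\<dots> \<le> weighted_norm w (shear y v)"
    unfolding weighted_norm_def by (intro Max_ge) auto
  finally have nonneg: "weighted_norm w (shear y v) \<ge> 0" .
  obtain F where F: "F \<subseteq> minimal_lists" "clique comparable F" "\<And>S. S \<in> F \<Longrightarrow> \<epsilon> \<le> covol w S y \<and> covol w S y < \<rho>"
    "\<And>S. S \<in> minimal_lists \<Longrightarrow> (\<forall>T\<in>F. comparable S T) \<Longrightarrow> \<sigma> \<le> covol w S y"
    using marked unfolding marked_def by blast
  have F_basis: "F \<subseteq> basis_lists"
    using F(1) minimal_lists_subset by blast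
  then have "finite F"
    using clique_card F(2) by blast
  define A where "A = {S \<in> F. v \<notin> vec.span (set S)}"
  \<comment> \<open>The members omitting \<open>v\<close> form a chain, so one of greatest length
    contains the others; \<open>[]\<close> stands for the zero subspace.\<close>
  obtain S0 where S0: "S0 = [] \<or> S0 \<in> A" "\<And>S. S \<in> A \<Longrightarrow> vec.span (set S) \<subseteq> vec.span (set S0)"
  proof (cases "A = {}")
    case False
    have "finite A"
      using \<open>finite F\<close> by (simp add: A_def)
    with False obtain S0 where S0: "S0 \<in> A" "\<And>S. S \<in> A \<Longrightarrow> length S \<le> length S0"
    proof -
      have "Max (length ` A) \<in> length ` A"
        using \<open>finite A\<close> False by (intro Max_in) auto
      then obtain S0 where "S0 \<in> A" "length S0 = Max (length ` A)"
        by auto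
      then show ?thesis
        using that[of S0] \<open>finite A\<close> by simp
    qed
    have "vec.span (set S) \<subseteq> vec.span (set S0)" if "S \<in> A" for S
    proof (cases "S = S0")
      case False
      then have "comparable S S0"
        using that S0(1) F(2) unfolding A_def clique_def by blast
      moreover have "\<not> vec.span (set S0) \<subset> vec.span (set S)"
        using length_less_if_span_psubset[of S0 S] S0 that F_basis unfolding A_def by fastforce
      ultimately show ?thesis
        unfolding comparable_def by blast
    qed simp
    with S0(1) show ?thesis
      using that by blast
  qed (use that[of "[]"] in auto)
  have covol_S0: "covol w S0 y \<le> 1"
    using S0(1) F(3) \<open>\<rho> \<le> 1\<close> wedge_norm_Nil[OF w(2)] unfolding A_def covol_def by force
  have v_span: "v \<notin> vec.span (set S0)"
    using S0(1) v(2) unfolding A_def by auto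
  have S0_basis: "distinct S0" "vec.independent (set S0)" "set S0 \<subseteq> poly_vecs"
    using S0(1) F_basis unfolding A_def basis_lists_def by (auto simp: vec.independent_empty)
  have S1: "S0 @ [v] \<in> basis_lists"
    using S0_basis v(1) v_span vec.span_base[of v "set S0"]
      vec.independent_insertI[OF v_span S0_basis(2)]
    unfolding basis_lists_def by auto
  obtain S2 where S2: "S2 \<in> minimal_lists" "vec.span (set S2) = vec.span (set (S0 @ [v]))"
    using exists_minimal_list[OF S1] by blast
  have "covol w S2 y \<le> covol w (S0 @ [v]) y"
    using w(1) S2 S1 by (intro covol_minimal_le) auto
  also have "\<dots> \<le> covol w S0 y * weighted_norm w (shear y v)"
    unfolding covol_def using length_basis_list_le[OF S1] w(1)
    by (simp add: wedge_norm_snoc)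
  also have "\<dots> \<le> 1 * weighted_norm w (shear y v)"
    using covol_S0 nonneg by (rule mult_right_mono)
  finally have S2_small: "covol w S2 y < \<epsilon>"
    using short by simp
  have span_S0: "vec.span (set S0) \<subseteq> vec.span (set S2)"
    unfolding S2(2) by (intro vec.span_mono) auto
  \<comment> \<open>A member of the flag with the span of \<open>S2\<close> is bounded below by
    \<epsilon>, and a minimal list comparable with the whole flag by \<sigma> \<ge>
    \<epsilon>.\<close>
  show False
  proof (cases "\<exists>S\<in>F. vec.span (set S) = vec.span (set S2)")
    case True
    then obtain S where S: "S \<in> F" "vec.span (set S2) = vec.span (set S)" by auto
    then have "covol w S y \<le> covol w S2 y"
      using w(1) F(1) S2(1) minimal_lists_subset by (intro covol_minimal_le) auto
    then show False
      using F(3)[OF S(1)] S2_small by simp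
  next
    case False
    have "comparable S2 S" if S: "S \<in> F" for S
    proof (cases "v \<in> vec.span (set S)")
      case True
      \<comment> \<open>\<open>S0\<close> omits \<open>v\<close> and \<open>S\<close> contains it,
        so comparability leaves only one direction of inclusion.\<close>
      have "vec.span (set S0) \<subseteq> vec.span (set S)"
      proof (cases "S0 = []")
        case nonempty: False
        then have "S0 \<in> F" "S0 \<noteq> S"
          using S0(1) True v_span unfolding A_def by auto
        then have "comparable S0 S"
          using S F(2) unfolding clique_def by blast
        then show ?thesis
          using True v_span unfolding comparable_def by blast
      qed (simp add: vec.span_zero)
      then have "set (S0 @ [v]) \<subseteq> vec.span (set S)"
        using True vec.span_superset[of "set S0"] by auto
      then have "vec.span (set S2) \<subseteq> vec.span (set S)"
        unfolding S2(2) by (intro vec.span_minimal vec.subspace_span)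
      then show ?thesis
        using False S unfolding comparable_def by blast
    next
      case v_notin: False
      then have "vec.span (set S) \<subseteq> vec.span (set S2)"
        using S S0(2) span_S0 unfolding A_def by blast
      then show ?thesis
        using False S unfolding comparable_def by blast
    qed
    then have "\<sigma> \<le> covol w S2 y"
      using F(4)[OF S2(1)] by blast
    then show False
      using S2_small \<open>\<epsilon> \<le> \<sigma>\<close> by simp
  qed
qed

section \<open>Covolumes as good functions on cells\<close>

lemma countable_minimal_lists: "countable (minimal_lists :: ('k::{field,finite} fls ^ ('n::finite) option) list set)"
proof -
  have "countable (poly_vecs :: ('k fls ^ 'n option) set)"
    unfolding poly_vecs_def by (intro countable_vec_in countable_fls_polys)
  then have "countable (lists (poly_vecs :: ('k fls ^ 'n option) set))"
    by (rule countable_lists)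
  then show ?thesis
    by (rule countable_subset[rotated]) (auto simp: minimal_lists_def basis_lists_def)
qed

context haar
begin

text \<open>The coordinate that attains the maximum at \<open>y\<close> is enough: it reaches the
  value \<open>r\<close> there, and it is small wherever the maximum is small. The constants of
  goodness are therefore unchanged by the maximum.\<close>

lemma good_on_covol:
  fixes f :: "'k fls ^ 'd \<Rightarrow> 'k fls ^ ('n::finite)"
  assumes good: "\<And>a0 a. good_on C \<alpha> b0 (\<lambda>x. fls_abs (a0 + (\<Sum>i\<in>UNIV. a $ i * f x $ i)))"
    and w: "\<And>i. w i > 0"
  shows "good_on C \<alpha> b0 (\<lambda>x. covol w S (f x))"
  unfolding good_on_def
proof (intro ballI allI impI)
  fix b :: "('k fls ^ 'd) set" and r e :: real
  assume b: "b \<in> cells" "b \<subseteq> b0" and r: "r > 0" and e: "e > 0" and "\<exists>y\<in>b. covol w S (f y) \<ge> r"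
  then obtain y where y: "y \<in> b" "covol w S (f y) \<ge> r" by blast
  obtain J where J: "covol w S (f y) =
      fls_abs (det (frame (map (shear (f y)) S) J)) * (\<Prod>i | length S \<le> pos i. inverse (w (J i)))"
    using wedge_norm_attained[of w "map (shear (f y)) S"] unfolding covol_def by auto
  define W where "W = (\<Prod>i | length S \<le> pos i. inverse (w (J i)))"
  have "W > 0"
    unfolding W_def using w by (intro prod_pos) auto
  obtain D0 D where D: "\<And>z. det (frame (map (shear z) S) J) = D0 + (\<Sum>j\<in>UNIV. D j * z $ j)"
    using det_frame_shear_affine by metis
  define g where "g x = fls_abs (D0 + (\<Sum>j\<in>UNIV. (\<chi> j. D j) $ j * f x $ j))" for x
  have g_eq: "g x = fls_abs (det (frame (map (shear (f x)) S) J))" for x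
    by (simp add: g_def D)
  have "g y * W \<ge> r"
    using y(2) J unfolding g_eq W_def by simp
  then have "\<exists>y\<in>b. g y \<ge> r / W"
    using y(1) \<open>W > 0\<close> by (auto simp: field_simps)
  moreover have "good_on C \<alpha> b0 g"
    unfolding g_def by (rule good)
  ultimately have "outer {x \<in> b. g x < e / W} \<le> ennreal (C * ((e / W) / (r / W)) powr \<alpha>) * emeasure lam b"
    using b r e \<open>W > 0\<close> by (intro good_onD[of C \<alpha> b0]) auto
  moreover have "{x \<in> b. covol w S (f x) < e} \<subseteq> {x \<in> b. g x < e / W}"
  proof clarify
    fix x assume "covol w S (f x) < e"
    moreover have "g x * W \<le> covol w S (f x)"
      using wedge_norm_ge[of "map (shear (f x)) S" J w] unfolding g_eq W_def covol_def by simp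
    ultimately show "g x < e / W"
      using \<open>W > 0\<close> by (simp add: field_simps)
  qed
  ultimately show "outer {x \<in> b. covol w S (f x) < e} \<le> ennreal (C * (e / r) powr \<alpha>) * emeasure lam b"
    using \<open>W > 0\<close> by (auto intro: order_trans[OF outer_measure_of_mono])
qed

text \<open>For the completing \<open>J\<close> the determinant is a nonzero affine function of f(x)
  with polynomial coefficients. Some coefficient has absolute value at least 1, and the uniform
  bound applies. The weights enter only through \<open>w (Some j) \<le> 1\<close> and do not shrink
  the coordinate.\<close>

lemma exists_covol_ge:
  fixes f :: "'k fls ^ 'd \<Rightarrow> 'k fls ^ ('n::finite)"
  assumes c: "\<And>a0 a. fls_abs a0 \<ge> 1 \<or> (\<exists>i. fls_abs (a $ i) \<ge> 1) \<Longrightarrow>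
      \<exists>x\<in>b0. fls_abs (a0 + (\<Sum>i\<in>UNIV. a $ i * f x $ i)) \<ge> c"
    and w: "\<And>i. w i > 0" "\<And>j. w (Some j) \<le> 1" and S: "S \<in> basis_lists"
  shows "\<exists>x\<in>b0. covol w S (f x) \<ge> c"
proof -
  have S': "S \<noteq> []" "distinct S" "vec.independent (set S)" "set S \<subseteq> poly_vecs"
    using S by (auto simp: basis_lists_def)
  obtain y J where J: "\<And>i. length S \<le> pos i \<Longrightarrow> J i \<noteq> None" and nz: "det (frame (map (shear y) S) J) \<noteq> 0"
    using exists_completing_axes[OF S'(1-3)] by metis
  obtain D0 D where D: "\<And>z. det (frame (map (shear z) S) J) = D0 + (\<Sum>j\<in>UNIV. D j * z $ j)"
    "D0 \<in> fls_polys" "\<And>j. D j \<in> fls_polys"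
    using det_frame_shear_affine_polys[OF S'(4), of J] by metis
  have "D0 \<noteq> 0 \<or> (\<exists>j. D j \<noteq> 0)"
  proof (rule ccontr)
    assume "\<not> ?thesis"
    then have "D0 = 0" "\<And>j. D j = 0" by auto
    then show False
      using nz D(1)[of y] by simp
  qed
  then have "fls_abs D0 \<ge> 1 \<or> (\<exists>i. fls_abs ((\<chi> j. D j) $ i) \<ge> 1)"
    using fls_polys_abs_ge_1 D(2,3) by auto
  then obtain x where x: "x \<in> b0" "fls_abs (D0 + (\<Sum>i\<in>UNIV. (\<chi> j. D j) $ i * f x $ i)) \<ge> c"
    using c by blast
  have "1 \<le> (\<Prod>i | length S \<le> pos i. inverse (w (J i)))"
  proof (rule prod_ge_1)
    fix i :: "'n option" assume "i \<in> {i. length S \<le> pos i}"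
    then obtain j where "J i = Some j"
      using J by auto
    then show "1 \<le> inverse (w (J i))"
      using w by (simp add: one_le_inverse)
  qed
  then have "fls_abs (det (frame (map (shear (f x)) S) J)) * 1 \<le>
      fls_abs (det (frame (map (shear (f x)) S) J)) * (\<Prod>i | length S \<le> pos i. inverse (w (J i)))"
    by (intro mult_left_mono) auto
  also have "\<dots> \<le> covol w S (f x)"
    using wedge_norm_ge[of "map (shear (f x)) S" J w] unfolding covol_def by simp
  finally show ?thesis
    using x D(1) by (intro bexI[of _ x]) auto
qed

lemma outer_short_vectors:
  fixes f :: "'k fls ^ 'd \<Rightarrow> 'k fls ^ ('n::finite)"
  assumes b0: "b0 \<in> cells"
    and good: "\<And>a0 a. good_on C \<alpha> b0 (\<lambda>x. fls_abs (a0 + (\<Sum>i\<in>UNIV. a $ i * f x $ i)))"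
    and c: "\<And>a0 a. fls_abs a0 \<ge> 1 \<or> (\<exists>i. fls_abs (a $ i) \<ge> 1) \<Longrightarrow>
      \<exists>x\<in>b0. fls_abs (a0 + (\<Sum>i\<in>UNIV. a $ i * f x $ i)) \<ge> \<rho>"
    and \<rho>: "0 < \<rho>" "\<rho> \<le> 1" and \<epsilon>: "0 < \<epsilon>" "\<epsilon> \<le> \<sigma>" and half: "C * (\<sigma> / \<rho>) powr \<alpha> \<le> 1/2"
    and w: "\<And>i. w i > 0" "\<And>j. w (Some j) \<le> 1" "(\<Prod>i\<in>UNIV. w i) = 1"
  shows "outer {x \<in> b0. \<exists>v\<in>poly_vecs. v \<noteq> 0 \<and> weighted_norm w (shear (f x) v) < \<epsilon>} \<le>
    (\<Sum>i<CARD('n option). cell_index ^ Suc i) * ennreal (C * (\<epsilon> / \<rho>) powr \<alpha>) * emeasure lam b0"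
proof -
  have "{x \<in> b0. \<exists>v\<in>poly_vecs. v \<noteq> 0 \<and> weighted_norm w (shear (f x) v) < \<epsilon>} \<subseteq>
      {x \<in> b0. \<not> marked comparable (\<lambda>S x. covol w S (f x)) \<epsilon> \<rho> \<sigma> minimal_lists x}"
  proof clarify
    fix x v assume v: "v \<in> poly_vecs" "v \<noteq> 0" "weighted_norm w (shear (f x) v) < \<epsilon>"
      and "marked comparable (\<lambda>S x. covol w S (f x)) \<epsilon> \<rho> \<sigma> minimal_lists x"
    then have "marked comparable (covol w) \<epsilon> \<rho> \<sigma> minimal_lists (f x)"
      by (simp add: marked_def)
    from marked_imp_no_short_vector[OF w(1,3) \<rho>(2) \<epsilon>(2) this v(1,2)] v(3) show False
      by simp
  qed
  then have "outer {x \<in> b0. \<exists>v\<in>poly_vecs. v \<noteq> 0 \<and> weighted_norm w (shear (f x) v) < \<epsilon>} \<le>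
      outer {x \<in> b0. \<not> marked comparable (\<lambda>S x. covol w S (f x)) \<epsilon> \<rho> \<sigma> minimal_lists x}"
    by (rule outer_measure_of_mono)
  also have "\<dots> \<le> (\<Sum>i<CARD('n option). cell_index ^ Suc i) * ennreal (C * (\<epsilon> / \<rho>) powr \<alpha>) * emeasure lam b0"
  proof (rule nondivergence[where \<psi> = "\<lambda>S x. covol w S (f x)"])
    show "C * (\<sigma> / \<rho>) powr \<alpha> \<le> 1/2" by (fact half)
    show "good_on C \<alpha> b0 (\<lambda>x. covol w S (f x))" for S
      using good w(1) by (rule good_on_covol)
    show "\<exists>x\<in>b0. \<rho> \<le> covol w S (f x)" if "S \<in> minimal_lists" for S
      using that minimal_lists_subset c w by (intro exists_covol_ge) auto
    show "finite F \<and> card F \<le> CARD('n option)"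
      if "F \<subseteq> minimal_lists" "clique comparable F" for F :: "('k fls ^ 'n option) list set"
      using that minimal_lists_subset by (intro clique_card) auto
  qed (use b0 \<rho> \<epsilon> countable_minimal_lists in \<open>auto simp: comparable_def\<close>)
  finally show ?thesis .
qed

subsection \<open>Transference\<close>

lemma outer_UN_le:
  assumes "countable I"
  shows "outer (\<Union>i\<in>I. A i) \<le> (\<integral>\<^sup>+i. outer (A i) \<partial>count_space I)"
proof -
  obtain E where E: "\<And>i. E i \<in> sets lam" "\<And>i. A i \<subseteq> E i" "\<And>i. outer (A i) = emeasure lam (E i)"
    using outer_attain[of "A _"] by metis
  have UN: "(\<Union>i\<in>I. E i) \<in> sets lam"
    using assms E(1) by (intro sets.countable_UN') auto
  have "outer (\<Union>i\<in>I. A i) \<le> emeasure lam (\<Union>i\<in>I. E i)"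
    using E(2) UN by (intro outer_le_emeasure) auto
  also have "\<dots> = (\<integral>\<^sup>+x. indicator (\<Union>i\<in>I. E i) x \<partial>lam)"
    using UN by simp
  also have "\<dots> \<le> (\<integral>\<^sup>+x. \<integral>\<^sup>+i. indicator (E i) x \<partial>count_space I \<partial>lam)"
  proof (intro nn_integral_mono)
    fix x
    show "indicator (\<Union>i\<in>I. E i) x \<le> (\<integral>\<^sup>+i. indicator (E i) x \<partial>count_space I)"
    proof (cases "x \<in> (\<Union>i\<in>I. E i)")
      case True
      then obtain i where "i \<in> I" "x \<in> E i" by blast
      then show ?thesis
        using nn_integral_ge_point[of i I "\<lambda>i. indicator (E i) x"] True by simp
    qed simp
  qed
  also have "\<dots> = (\<integral>\<^sup>+i. \<integral>\<^sup>+x. indicator (E i) x \<partial>lam \<partial>count_space I)"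
    using assms E(1) by (intro nn_integral_count_space_nn_integral) auto
  also have "\<dots> = (\<integral>\<^sup>+i. outer (A i) \<partial>count_space I)"
    using E by simp
  finally show ?thesis .
qed

text \<open>
  The transference argument of Beresnevich and Velani: the maximal cells on which \<open>g i\<close> stays below
  \<open>\<eta>'\<close> overlap for different \<open>i\<close> only inside \<open>H\<close>.  Hence those of them which are not mostly covered
  by \<open>H\<close> are essentially disjoint, whereas the others lie in a set of measure at most \<open>2 * outer H\<close>.
\<close>

lemma outer_transference:
  fixes g :: "'i \<Rightarrow> 'k fls ^ 'd \<Rightarrow> real"
  assumes b0: "b0 \<in> cells" and I: "countable I"
    and good: "\<And>i. i \<in> I \<Longrightarrow> good_on C \<alpha> b0 (g i)"
    and big: "\<And>i. i \<in> I \<Longrightarrow> \<exists>x\<in>b0. g i x \<ge> \<eta>'"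
    and \<eta>: "0 < \<eta>" "0 < \<eta>'" and half: "C * (\<eta> / \<eta>') powr \<alpha> \<le> 1/2"
    and H: "\<And>i j x. i \<in> I \<Longrightarrow> j \<in> I \<Longrightarrow> i \<noteq> j \<Longrightarrow> x \<in> b0 \<Longrightarrow> g i x < \<eta>' \<Longrightarrow> g j x < \<eta>' \<Longrightarrow> x \<in> H"
  shows "outer {x \<in> b0. \<exists>i\<in>I. g i x < \<eta>} \<le>
    2 * outer H + ennreal (C * (\<eta> / \<eta>') powr \<alpha>) * cell_index * 2 * emeasure lam b0"
proof -
  define \<kappa> where "\<kappa> = ennreal (C * (\<eta> / \<eta>') powr \<alpha>)"
  obtain M where M: "M \<in> sets lam" "H \<subseteq> M" "outer H = emeasure lam M"
    using outer_attain by metis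
  define Q where "Q i b \<longleftrightarrow> b \<in> cells \<and> b \<subseteq> b0 \<and> (\<forall>y\<in>b. g i y < \<eta>')" for i b
  \<comment> \<open>Cells with at least half of their measure inside \<open>M\<close>, the
    measurable hull of \<open>H\<close>.\<close>
  define R where "R b \<longleftrightarrow> b \<in> cells \<and> b \<subseteq> b0 \<and> emeasure lam b \<le> 2 * emeasure lam (b \<inter> M)" for b
  define N where "N i = {x \<in> b0. g i x < \<eta> \<and> \<not> (\<exists>b\<in>cells. x \<in> b \<and> b \<subseteq> b0 \<and> (\<forall>y\<in>b. g i y < \<eta>'))}" for i
  define V where "V = \<Union>(top_cells R)"
  define G where "G = {(i, b). i \<in> I \<and> b \<in> top_cells (Q i) \<and> \<not> R b}"
  have sets_top: "top_cells P \<subseteq> sets lam" for P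
    using top_cells_subset cells_in_sets by blast
  have "outer (\<Union>i\<in>I. N i) = 0"
    unfolding N_def using assms by (intro outer_UN_null outer_no_small_cell_good[of b0 C \<alpha>]) auto
  moreover have "{x \<in> b0. \<exists>i\<in>I. g i x < \<eta>} \<subseteq> (\<Union>i\<in>I. N i) \<union> (V \<union> (\<Union>(i, b)\<in>G. {x \<in> b. g i x < \<eta>}))"
  proof
    fix x assume "x \<in> {x \<in> b0. \<exists>i\<in>I. g i x < \<eta>}"
    then obtain i where x: "x \<in> b0" "i \<in> I" "g i x < \<eta>" by blast
    show "x \<in> (\<Union>i\<in>I. N i) \<union> (V \<union> (\<Union>(i, b)\<in>G. {x \<in> b. g i x < \<eta>}))"
    proof (cases "x \<in> N i")
      case False
      then obtain b where b: "b \<in> cells" "x \<in> b" "b \<subseteq> b0" "\<forall>y\<in>b. g i y < \<eta>'"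
        using x unfolding N_def by blast
      then obtain c k where "b = cell c k" by (elim cellsE)
      then have "b = cell x k"
        using b(2) cell_eq by metis
      then have "Q i (cell x k)"
        using b unfolding Q_def by auto
      then obtain b' where b': "b' \<in> top_cells (Q i)" "x \<in> b'"
        using top_cells_cover by blast
      show ?thesis
      proof (cases "R b'")
        case True
        obtain c k where "b' = cell c k"
          using b'(1) top_cells_subset by (blast elim: cellsE)
        then have "b' = cell x k"
          using b'(2) cell_eq by metis
        then have "\<exists>b\<in>top_cells R. x \<in> b"
          using True top_cells_cover by metis
        then show ?thesis
          unfolding V_def by blast
      next
        case False
        then have "(i, b') \<in> G"
          using x(2) b'(1) by (simp add: G_def)
        then show ?thesis
          using b'(2) x(3) by blast
      qed
    qed (use x in blast)
  qed
  ultimately have "outer {x \<in> b0. \<exists>i\<in>I. g i x < \<eta>} \<le> outer (V \<union> (\<Union>(i, b)\<in>G. {x \<in> b. g i x < \<eta>}))"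
    by (rule outer_Un_null)
  also have "\<dots> \<le> outer V + outer (\<Union>(i, b)\<in>G. {x \<in> b. g i x < \<eta>})"
    by (rule outer_Un)
  also have "\<dots> \<le> 2 * outer H + \<kappa> * cell_index * 2 * emeasure lam b0"
  proof (rule add_mono)
    have V: "V \<in> sets lam"
      unfolding V_def using sets_top countable_top_cells by (intro sets.countable_Union) auto
    have "emeasure lam V = (\<integral>\<^sup>+b. emeasure lam b \<partial>count_space (top_cells R))"
      using emeasure_UN_countable[of "top_cells R" "\<lambda>b. b" lam] sets_top[of R] countable_top_cells[of R]
        disjoint_top_cells[of R]
      unfolding V_def by (simp add: disjoint_family_on_def disjoint_def subset_iff)
    also have "\<dots> \<le> (\<integral>\<^sup>+b. 2 * emeasure lam (b \<inter> M) \<partial>count_space (top_cells R))"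
    proof (intro nn_integral_mono)
      fix b assume "b \<in> space (count_space (top_cells R))"
      then have "R b"
        using top_cells_D by simp
      then show "emeasure lam b \<le> 2 * emeasure lam (b \<inter> M)"
        by (simp add: R_def)
    qed
    also have "\<dots> = 2 * (\<integral>\<^sup>+b. emeasure lam (b \<inter> M) \<partial>count_space (top_cells R))"
      by (intro nn_integral_cmult) auto
    also have "(\<integral>\<^sup>+b. emeasure lam (b \<inter> M) \<partial>count_space (top_cells R)) = emeasure lam (\<Union>b\<in>top_cells R. b \<inter> M)"
      using sets_top[of R] countable_top_cells[of R] disjoint_top_cells[of R] M(1)
      by (intro emeasure_UN_countable[symmetric]) (auto simp: disjoint_family_on_def disjoint_def)
    also have "\<dots> \<le> emeasure lam M"
      using M(1) by (intro emeasure_mono) auto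
    finally show "outer V \<le> 2 * outer H"
      using V M(3) by (simp add: mult_left_mono)
  next
    have G_D: "i \<in> I" "b \<in> cells" "b \<subseteq> b0" "\<And>y. y \<in> b \<Longrightarrow> g i y < \<eta>'" "\<not> R b" "b \<in> top_cells (Q i)"
      if "(i, b) \<in> G" for i b
      using that top_cells_D[of b "Q i"] unfolding G_def Q_def by auto
    have G: "countable G"
    proof (rule countable_subset)
      show "G \<subseteq> I \<times> cells"
        using G_D by auto
    qed (intro countable_SIGMA I countable_cells)
    have le: "outer {x \<in> b. g i x < \<eta>} \<le> \<kappa> * cell_index * 2 * emeasure lam (b - M)" if ib: "(i, b) \<in> G" for i b
    proof -
      note D = G_D[OF ib]
      have "\<not> Q i b0"
        using big[OF D(1)] unfolding Q_def by (auto simp: not_less)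
      then obtain b' where b': "b' \<in> cells" "b \<subseteq> b'" "b' \<subseteq> b0" "\<not> Q i b'"
        "emeasure lam b' \<le> cell_index * emeasure lam b"
        using top_cells_parent[OF b0 _ _ D(6)] unfolding Q_def by blast
      then have "\<exists>y\<in>b'. g i y \<ge> \<eta>'"
        unfolding Q_def by (auto simp: not_less)
      then have "outer {x \<in> b'. g i x < \<eta>} \<le> \<kappa> * emeasure lam b'"
        unfolding \<kappa>_def using good[OF D(1)] b' \<eta> by (intro good_onD) auto
      moreover have "outer {x \<in> b. g i x < \<eta>} \<le> outer {x \<in> b'. g i x < \<eta>}"
        using b'(2) by (intro outer_measure_of_mono) auto
      ultimately have "outer {x \<in> b. g i x < \<eta>} \<le> \<kappa> * emeasure lam b'"
        by (rule order_trans[rotated])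
      also have "\<dots> \<le> \<kappa> * (cell_index * emeasure lam b)"
        using b'(5) by (rule mult_left_mono) simp
      \<comment> \<open>Failure of \<open>R\<close> puts more than half of \<open>b\<close> outside
        \<open>M\<close>. The overlaps of cells in \<open>G\<close> are thereby removed at the price
        of a factor 2.\<close>
      also have "emeasure lam b \<le> 2 * emeasure lam (b - M)"
      proof -
        have b: "b \<in> sets lam"
          using D(2) by (rule cells_in_sets)
        have split: "emeasure lam b = emeasure lam (b \<inter> M) + emeasure lam (b - M)"
        proof -
          have "b \<inter> M \<inter> (b - M) = {}" "b \<inter> M \<union> (b - M) = b"
            by blast+
          then show ?thesis
            using b M(1) plus_emeasure[of "b \<inter> M" lam "b - M"] by simp
        qed
        have less: "2 * emeasure lam (b \<inter> M) < emeasure lam (b \<inter> M) + emeasure lam (b - M)"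
          using D(2,3,5) unfolding R_def split[symmetric] by (simp add: not_le)
        have "emeasure lam (b \<inter> M) \<le> emeasure lam (b - M)"
        proof (rule ccontr)
          assume "\<not> ?thesis"
          then have "emeasure lam (b - M) \<le> emeasure lam (b \<inter> M)"
            by simp
          then have "emeasure lam (b \<inter> M) + emeasure lam (b - M) \<le> 2 * emeasure lam (b \<inter> M)"
            unfolding mult_2 by (rule add_left_mono)
          with less show False
            by (simp add: not_less[symmetric])
        qed
        then have "emeasure lam (b \<inter> M) + emeasure lam (b - M) \<le> emeasure lam (b - M) + emeasure lam (b - M)"
          by (rule add_right_mono)
        then show ?thesis
          unfolding split by (simp add: mult_2)
      qed
      finally show ?thesis
        by (simp add: mult_left_mono mult.assoc)
    qed
    have "outer (\<Union>(i, b)\<in>G. {x \<in> b. g i x < \<eta>}) \<le> (\<integral>\<^sup>+ib. outer {x \<in> snd ib. g (fst ib) x < \<eta>} \<partial>count_space G)"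
      using outer_UN_le[OF G, of "\<lambda>ib. {x \<in> snd ib. g (fst ib) x < \<eta>}"] by (simp add: case_prod_beta')
    also have "\<dots> \<le> (\<integral>\<^sup>+ib. \<kappa> * cell_index * 2 * emeasure lam (snd ib - M) \<partial>count_space G)"
      using le by (intro nn_integral_mono) auto
    also have "\<dots> = \<kappa> * cell_index * 2 * (\<integral>\<^sup>+ib. emeasure lam (snd ib - M) \<partial>count_space G)"
      by (intro nn_integral_cmult) auto
    also have "(\<integral>\<^sup>+ib. emeasure lam (snd ib - M) \<partial>count_space G) = emeasure lam (\<Union>ib\<in>G. snd ib - M)"
    proof (rule emeasure_UN_countable[symmetric])
      \<comment> \<open>For one index, two maximal cells are disjoint; for two indices, the overlap
        lies in \<open>H\<close> and hence in \<open>M\<close>.\<close>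
      show "disjoint_family_on (\<lambda>ib. snd ib - M) G"
        unfolding disjoint_family_on_def
      proof (intro ballI impI, rule ccontr)
        fix p p' assume p: "p \<in> G" "p' \<in> G" "p \<noteq> p'" "(snd p - M) \<inter> (snd p' - M) \<noteq> {}"
        obtain i b j b' where eq: "p = (i, b)" "p' = (j, b')"
          by (metis surj_pair)
        obtain z where z: "z \<in> b" "z \<in> b'" "z \<notin> M"
          using p(4) eq by auto
        note D = G_D[OF p(1)[unfolded eq]] and D' = G_D[OF p(2)[unfolded eq]]
        show False
        proof (cases "i = j")
          case True
          then have "b \<noteq> b'"
            using p(3) eq by simp
          then show False
            using D(6) D'(6) True disjoint_top_cells[of "Q i"] z unfolding disjoint_def by blast
        next
          case False
          then have "z \<in> H"
            using H[of i j z] D(1,3,4) D'(1,4) z by blast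
          then show False
            using z(3) M(2) by blast
        qed
      qed
      show "snd ib - M \<in> sets lam" if "ib \<in> G" for ib
        using that M(1) G_D(2)[of "fst ib" "snd ib"] cells_in_sets by auto
    qed (fact G)
    also have "\<kappa> * cell_index * 2 * \<dots> \<le> \<kappa> * cell_index * 2 * emeasure lam b0"
    proof (intro mult_left_mono emeasure_mono)
      show "(\<Union>ib\<in>G. snd ib - M) \<subseteq> b0"
        using G_D(3) by (fastforce dest: subsetD)
    qed (use b0 cells_in_sets in auto)
    finally show "outer (\<Union>(i, b)\<in>G. {x \<in> b. g i x < \<eta>}) \<le> \<kappa> * cell_index * 2 * emeasure lam b0" .
  qed
  finally show ?thesis
    unfolding \<kappa>_def .
qed

section \<open>From goodness in the completed measure to outer measure\<close>

lemma outer_le_completion: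
  assumes A: "A \<in> sets (completion lam)"
  shows "outer A \<le> emeasure (completion lam) A"
proof -
  obtain N where N: "N \<in> null_sets lam" "null_part lam A \<subseteq> N"
    using null_part[OF A] by blast
  have "A \<subseteq> N \<union> main_part lam A"
    using main_part_null_part_Un[OF A] N(2) by blast
  moreover have "outer N = 0"
    using N(1) outer_null_iff by blast
  ultimately have "outer A \<le> outer (main_part lam A)"
    by (intro outer_Un_null)
  also have "\<dots> = emeasure (completion lam) A"
    using A by (simp add: emeasure_completion)
  finally show ?thesis .
qed

lemma good_on_good_fun:
  assumes U: "open U" and good: "good_fun lam C \<alpha> U g" and b0: "b0 \<subseteq> U" and pos: "C > 0" "\<alpha> > 0"
  shows "good_on C \<alpha> b0 (\<lambda>x. fls_abs (g x))"
  unfolding good_on_def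
proof (intro ballI allI impI)
  fix b :: "('k fls ^ 'd) set" and r e :: real
  assume b: "b \<in> cells" "b \<subseteq> b0" and r: "r > 0" and e: "e > 0" and "\<exists>y\<in>b. fls_abs (g y) \<ge> r"
  then obtain y where y: "y \<in> b" "fls_abs (g y) \<ge> r" by blast
  obtain c m where c: "b = sup_ball c (exp (- real m))"
    using b(1) by (auto elim!: cellsE simp: cell_def)
  define S where "S = (SUP x\<in>b. ennreal (fls_abs (g x)))"
  have "ennreal r \<le> ennreal (fls_abs (g y))"
    using y(2) by (rule ennreal_leI)
  also have "\<dots> \<le> S"
    unfolding S_def using y(1) by (rule SUP_upper)
  finally have S: "ennreal r \<le> S" .
  then have "S \<noteq> 0"
    using r by auto
  \<comment> \<open>An infinite supremum makes the quotient 0; a finite one is at least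
    \<open>r\<close>.\<close>
  have ratio: "enn2real (ennreal e / S) \<le> e / r"
  proof (cases S)
    case (real s)
    then have "r \<le> s"
      using S r by auto
    then show ?thesis
      using real r e by (simp add: divide_ennreal frac_le)
  qed (use r e in simp)
  have "{x \<in> b. fls_abs (g x) < e} \<in> sets (completion lam)"
  proof -
    have U_sets: "U \<inter> space (completion lam) \<in> sets (completion lam)"
      using U by (simp add: open_in_sets)
    have "(\<lambda>x. fls_abs (g x)) \<in> borel_measurable (restrict_space (completion lam) U)"
      using good by (simp add: good_fun_def)
    then have "{x \<in> space (restrict_space (completion lam) U). fls_abs (g x) < e} \<in> sets (restrict_space (completion lam) U)"
      by (rule borel_measurable_less) simp
    then have "{x \<in> U. fls_abs (g x) < e} \<in> sets (completion lam)"
      by (simp add: sets_restrict_space_iff[OF U_sets] space_restrict_space)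
    then have "b \<inter> {x \<in> U. fls_abs (g x) < e} \<in> sets (completion lam)"
      using cells_in_sets[OF b(1)] by (intro sets.Int) auto
    moreover have "b \<inter> {x \<in> U. fls_abs (g x) < e} = {x \<in> b. fls_abs (g x) < e}"
      using b(2) b0 by blast
    ultimately show ?thesis by simp
  qed
  then have "outer {x \<in> b. fls_abs (g x) < e} \<le> emeasure (completion lam) {x \<in> b. fls_abs (g x) < e}"
    by (rule outer_le_completion)
  also have "\<dots> \<le> ennreal (C * enn2real (ennreal e / S) powr \<alpha>) * emeasure (completion lam) b"
  proof -
    have "b \<subseteq> U"
      using b(2) b0 by blast
    then show ?thesis
      using good e \<open>S \<noteq> 0\<close> unfolding good_fun_def S_def c Let_def by simp
  qed
  also have "emeasure (completion lam) b = emeasure lam b"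
    using cells_in_sets[OF b(1)] by simp
  also have "ennreal (C * enn2real (ennreal e / S) powr \<alpha>) * emeasure lam b \<le> ennreal (C * (e / r) powr \<alpha>) * emeasure lam b"
    using ratio pos by (intro mult_right_mono ennreal_leI mult_left_mono powr_mono2) auto
  finally show "outer {x \<in> b. fls_abs (g x) < e} \<le> ennreal (C * (e / r) powr \<alpha>) * emeasure lam b" .
qed

end

subsection \<open>Approximate solutions\<close>

text \<open>The diagonal flow that expands the value of the linear form, at \<open>None\<close>, and
  contracts its coefficient vector; the factor n in the exponent makes the determinant 1.\<close>

definition flow_weight :: "real \<Rightarrow> ('n::finite) option \<Rightarrow> real" where
  "flow_weight s i = (case i of None \<Rightarrow> exp (real CARD('n) * s) | Some _ \<Rightarrow> exp (- s))"

lemma prod_flow_weight: "(\<Prod>i\<in>UNIV. flow_weight s (i :: ('n::finite) option)) = 1"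
proof -
  have "(\<Prod>i\<in>UNIV. flow_weight s (i :: 'n option)) = exp (real CARD('n) * s) * exp (- s) ^ CARD('n)"
    by (simp add: UNIV_option_conv prod.reindex flow_weight_def)
  also have "\<dots> = 1"
    by (simp add: exp_of_nat_mult[symmetric] mult_exp_exp)
  finally show ?thesis .
qed

lemma fls_abs_vec_poly_ge_1:
  fixes q :: "'k::field poly ^ 'n"
  assumes "q \<noteq> 0"
  shows "\<exists>i. fls_abs (poly_in_T (q $ i)) \<ge> 1"
proof -
  obtain i where "q $ i \<noteq> 0"
    using assms by (auto simp: vec_eq_iff)
  then show ?thesis
    by (intro exI[of _ i] fls_polys_abs_ge_1) auto
qed

definition approx_solution ::
    "'k::field fls ^ 'n \<Rightarrow> 'k fls \<Rightarrow> real \<Rightarrow> real \<Rightarrow> 'k poly \<Rightarrow> 'k poly ^ 'n \<Rightarrow> bool" where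
  "approx_solution y \<theta> \<epsilon> t p q \<longleftrightarrow> q \<noteq> 0 \<and> (\<forall>i. fls_abs (poly_in_T (q $ i)) < exp t) \<and>
     fls_abs ((\<Sum>i\<in>UNIV. y $ i * poly_in_T (q $ i)) - poly_in_T p - \<theta>) < \<epsilon>"

text \<open>The ultrametric inequality preserves both bounds with constant 1. If
  \<open>q = q'\<close>, the nonzero polynomial \<open>p - p'\<close> would have absolute value less
  than \<epsilon> \<le> 1.\<close>

lemma approx_solution_diff:
  fixes y :: "'k::field fls ^ 'n"
  assumes 1: "approx_solution y \<theta> \<epsilon> t p q" and 2: "approx_solution y \<theta> \<epsilon> t p' q'"
    and "\<epsilon> \<le> 1" and "(p, q) \<noteq> (p', q')"
  shows "approx_solution y 0 \<epsilon> t (p - p') (q - q')"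
proof -
  define L where "L p q = (\<Sum>i\<in>UNIV. y $ i * poly_in_T (q $ i)) - poly_in_T p" for p and q :: "'k poly ^ 'n"
  have L: "L (p - p') (q - q') = (L p q - \<theta>) - (L p' q' - \<theta>)"
    by (simp add: L_def poly_in_T_diff algebra_simps sum_subtractf)
  have "fls_abs (L (p - p') (q - q')) \<le> max (fls_abs (L p q - \<theta>)) (fls_abs (L p' q' - \<theta>))"
    unfolding L by (rule fls_abs_diff)
  also have "\<dots> < \<epsilon>"
    using 1 2 by (simp add: approx_solution_def L_def)
  finally have small: "fls_abs (L (p - p') (q - q')) < \<epsilon>" .
  have "q - q' \<noteq> 0"
  proof
    assume "q - q' = 0"
    then have "q = q'" by simp
    then have "L (p - p') (q - q') = - poly_in_T (p - p')"
      by (simp add: L_def)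
    then have "fls_abs (poly_in_T (p - p')) < 1"
      using small \<open>\<epsilon> \<le> 1\<close> by simp
    moreover have "p - p' \<noteq> 0"
      using assms(4) \<open>q = q'\<close> by simp
    ultimately show False
      using fls_polys_abs_ge_1[of "poly_in_T (p - p')"] by simp
  qed
  moreover have "fls_abs (poly_in_T ((q - q') $ i)) < exp t" for i
  proof -
    have "fls_abs (poly_in_T ((q - q') $ i)) \<le> max (fls_abs (poly_in_T (q $ i))) (fls_abs (poly_in_T (q' $ i)))"
      by (simp add: poly_in_T_diff fls_abs_diff)
    also have "\<dots> < exp t"
      using 1 2 by (simp add: approx_solution_def)
    finally show ?thesis .
  qed
  ultimately show ?thesis
    using small by (simp add: approx_solution_def L_def)
qed

text \<open>The flow time (1 + \<delta>/4) t halves the excess \<delta>/2: the weighted entry at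
  \<open>None\<close> is below e^(-n\<delta>t/4), where n \<ge> 1, and the other entries are below
  e^(-\<delta>t/4).\<close>

lemma short_vector_of_approx_solution:
  fixes y :: "'k::field fls ^ ('n::finite)"
  assumes sol: "approx_solution y 0 (exp (- (real CARD('n) * (1 + \<delta> / 2) * t))) t p q" and "t \<ge> 0" "\<delta> \<ge> 0"
  shows "\<exists>v\<in>poly_vecs. v \<noteq> 0 \<and> weighted_norm (flow_weight ((1 + \<delta> / 4) * t)) (shear y v) < exp (- (\<delta> / 4 * t))"
proof -
  let ?n = "real CARD('n)" and ?s = "(1 + \<delta> / 4) * t"
  define v where "v = (\<chi> i. case i of None \<Rightarrow> - poly_in_T p | Some j \<Rightarrow> poly_in_T (q $ j))"
  have "v \<in> poly_vecs"
    by (auto simp: poly_vecs_def v_def fls_polys_uminus split: option.split)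
  moreover have "v \<noteq> 0"
  proof
    assume "v = 0"
    then have "v $ Some j = 0" for j by simp
    then show False
      using sol by (simp add: v_def approx_solution_def vec_eq_iff)
  qed
  moreover have "flow_weight ?s i * fls_abs (shear y v $ i) < exp (- (\<delta> / 4 * t))" for i
  proof (cases i)
    case None
    have "fls_abs (shear y v $ None) < exp (- (?n * (1 + \<delta> / 2) * t))"
      using sol by (simp add: approx_solution_def shear_None v_def)
    then have "exp (?n * ?s) * fls_abs (shear y v $ None) < exp (?n * ?s) * exp (- (?n * (1 + \<delta> / 2) * t))"
      by (intro mult_strict_left_mono) auto
    also have "\<dots> = exp (- (?n * (\<delta> / 4 * t)))"
      by (simp add: mult_exp_exp algebra_simps)
    also have "\<dots> \<le> exp (- (1 * (\<delta> / 4 * t)))"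
    proof -
      have "1 \<le> ?n"
        by (simp add: Suc_le_eq)
      then have "1 * (\<delta> / 4 * t) \<le> ?n * (\<delta> / 4 * t)"
        using assms(2,3) by (intro mult_right_mono) auto
      then show ?thesis by simp
    qed
    finally show ?thesis
      using None by (simp add: flow_weight_def)
  next
    case (Some j)
    have "fls_abs (shear y v $ i) < exp t"
      using sol Some by (simp add: approx_solution_def v_def)
    then have "exp (- ?s) * fls_abs (shear y v $ i) < exp (- ?s) * exp t"
      by (intro mult_strict_left_mono) auto
    also have "\<dots> = exp (- (\<delta> / 4 * t))"
      by (simp add: mult_exp_exp algebra_simps)
    finally show ?thesis
      using Some by (simp add: flow_weight_def)
  qed
  then have "weighted_norm (flow_weight ?s) (shear y v) < exp (- (\<delta> / 4 * t))"
    unfolding weighted_norm_def by (subst Max_less_iff) auto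
  ultimately show ?thesis by blast
qed

section \<open>Exponential decay and the exponent\<close>

lemma exp_tendsto_0: "c > 0 \<Longrightarrow> (\<lambda>t. exp (- (c * real t))) \<longlonglongrightarrow> 0"
proof -
  assume "c > 0"
  then have "(\<lambda>t. exp (- c) ^ t) \<longlonglongrightarrow> 0"
    by (intro LIMSEQ_power_zero) simp
  then show ?thesis
    by (simp add: exp_of_nat_mult[symmetric] mult.commute)
qed

lemma eventually_exp_le: "c > 0 \<Longrightarrow> B > 0 \<Longrightarrow> \<forall>\<^sub>F t in sequentially. exp (- (c * real t)) \<le> B"
  by (rule eventually_mono[OF order_tendstoD(2)[OF exp_tendsto_0, where a = B]]) (auto intro: less_imp_le)

text \<open>Excesses of the form 1/(j+1) suffice because larger exponents give stronger
  inequalities. Only countably many null sets then have to be discarded.\<close>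

lemma inhom_exponent_le_1I:
  fixes y :: "'k::field fls ^ ('n::finite)"
  assumes "\<And>j. \<forall>\<^sub>F t in sequentially.
    \<not> (\<exists>p q. approx_solution y \<theta> (exp (- (real CARD('n) * (1 + 1 / real (Suc j)) * real t))) (real t) p q)"
  shows "inhom_exponent y \<theta> \<le> 1"
  unfolding inhom_exponent_def
proof (rule SUP_least)
  fix \<omega> :: real
  assume "\<omega> \<in> {\<omega>. \<forall>N::nat. \<exists>t\<ge>N. \<exists>(p0 :: 'k poly) (q :: 'k poly ^ 'n). q \<noteq> 0 \<and>
          fls_abs ((\<Sum>i\<in>UNIV. y $ i * poly_in_T (q $ i)) - poly_in_T p0 - \<theta>)
            < exp (- (real CARD('n) * \<omega> * real t)) \<and>
          sup_norm (\<chi> i. poly_in_T (q $ i)) < exp (real t)}"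
  then have *: "\<exists>t\<ge>N. \<exists>p q. approx_solution y \<theta> (exp (- (real CARD('n) * \<omega> * real t))) (real t) p q" for N
    unfolding mem_Collect_eq approx_solution_def sup_norm_less_iff vec_lambda_beta by blast
  show "ereal \<omega> \<le> 1"
  proof (rule ccontr)
    assume "\<not> ereal \<omega> \<le> 1"
    then have "\<omega> - 1 > 0" by simp
    then obtain j where j: "1 / real (Suc j) < \<omega> - 1"
      using reals_Archimedean[of "\<omega> - 1"] by (auto simp: inverse_eq_divide)
    obtain N where N: "\<And>t. t \<ge> N \<Longrightarrow>
      \<not> (\<exists>p q. approx_solution y \<theta> (exp (- (real CARD('n) * (1 + 1 / real (Suc j)) * real t))) (real t) p q)"
      using assms[of j] unfolding eventually_sequentially by blast
    obtain t p q where t: "t \<ge> N" and sol: "approx_solution y \<theta> (exp (- (real CARD('n) * \<omega> * real t))) (real t) p q"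
      using * by blast
    have "exp (- (real CARD('n) * \<omega> * real t)) \<le> exp (- (real CARD('n) * (1 + 1 / real (Suc j)) * real t))"
      using j by (simp only: exp_le_cancel_iff neg_le_iff_le) (intro mult_right_mono mult_left_mono, auto)
    with sol have "approx_solution y \<theta> (exp (- (real CARD('n) * (1 + 1 / real (Suc j)) * real t))) (real t) p q"
      unfolding approx_solution_def by (meson less_le_trans)
    with N[OF t] show False by blast
  qed
qed

context haar
begin

text \<open>The first summand bounds the homogeneous exceptional set \<open>H\<close>. The second is
  the contribution of goodness, where the two thresholds have ratio e^(-n\<delta>t/2). Cells have
  measure at most 1, so the bound is free of \<open>b0\<close>.\<close>

lemma outer_approx_solutions:
  fixes f :: "'k fls ^ 'd \<Rightarrow> 'k fls ^ ('n::finite)" and \<theta> :: "'k fls"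
  assumes b0: "b0 \<in> cells"
    and good: "\<And>a0 a. good_on C \<alpha> b0 (\<lambda>x. fls_abs (a0 + (\<Sum>i\<in>UNIV. a $ i * f x $ i)))"
    and low: "\<And>a0 a. fls_abs a0 \<ge> 1 \<or> (\<exists>i. fls_abs (a $ i) \<ge> 1) \<Longrightarrow>
      \<exists>x\<in>b0. fls_abs (a0 + (\<Sum>i\<in>UNIV. a $ i * f x $ i)) \<ge> \<rho>"
    and \<rho>: "0 < \<rho>" "\<rho> \<le> 1" and half: "C * (\<sigma> / \<rho>) powr \<alpha> \<le> 1/2"
    and \<delta>: "\<delta> > 0" and t: "t \<ge> 0"
    and \<epsilon>: "exp (- (\<delta> / 4 * t)) \<le> \<sigma>"
    and \<eta>': "exp (- (real CARD('n) * (1 + \<delta> / 2) * t)) \<le> \<rho>"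
    and half': "C * exp (- (real CARD('n) * \<delta> / 2 * t)) powr \<alpha> \<le> 1/2"
  shows "outer {x \<in> b0. \<exists>p q. approx_solution (f x) \<theta> (exp (- (real CARD('n) * (1 + \<delta>) * t))) t p q} \<le>
    2 * ((\<Sum>i<CARD('n option). cell_index ^ Suc i) * ennreal (C * (exp (- (\<delta> / 4 * t)) / \<rho>) powr \<alpha>)) +
    ennreal (C * exp (- (real CARD('n) * \<delta> / 2 * t)) powr \<alpha>) * cell_index * 2"
proof -
  let ?n = "real CARD('n)"
  define \<eta> where "\<eta> = exp (- (?n * (1 + \<delta>) * t))"
  define \<eta>' where "\<eta>' = exp (- (?n * (1 + \<delta> / 2) * t))"
  define H where "H = {x \<in> b0. \<exists>p q. approx_solution (f x) 0 \<eta>' t p q}"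
  define I where "I = {(p :: 'k poly, q :: 'k poly ^ 'n). q \<noteq> 0 \<and> (\<forall>i. fls_abs (poly_in_T (q $ i)) < exp t)}"
  define g where "g = (\<lambda>(p, q) x. fls_abs ((\<Sum>i\<in>UNIV. f x $ i * poly_in_T (q $ i)) - poly_in_T p - \<theta>))"
  have g_eq: "g (p, q) = (\<lambda>x. fls_abs ((- poly_in_T p - \<theta>) + (\<Sum>i\<in>UNIV. (\<chi> i. poly_in_T (q $ i)) $ i * f x $ i)))" for p q
    by (simp add: g_def algebra_simps)
  have sol_iff: "approx_solution (f x) \<theta> e t p q \<longleftrightarrow> (p, q) \<in> I \<and> g (p, q) x < e" for x e p q
    by (auto simp: approx_solution_def I_def g_def)
  have ratio: "\<eta> / \<eta>' = exp (- (?n * \<delta> / 2 * t))"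
    by (simp add: \<eta>_def \<eta>'_def exp_diff[symmetric] algebra_simps)
  have "outer H \<le> outer {x \<in> b0. \<exists>v\<in>poly_vecs. v \<noteq> 0 \<and>
      weighted_norm (flow_weight ((1 + \<delta> / 4) * t)) (shear (f x) v) < exp (- (\<delta> / 4 * t))}"
    using short_vector_of_approx_solution[OF _ t, of _ \<delta>] \<delta>
    unfolding H_def \<eta>'_def by (intro outer_measure_of_mono) auto
  also have "\<dots> \<le> (\<Sum>i<CARD('n option). cell_index ^ Suc i) *
      ennreal (C * (exp (- (\<delta> / 4 * t)) / \<rho>) powr \<alpha>) * emeasure lam b0"
  proof (rule outer_short_vectors[OF b0 good low \<rho> _ \<epsilon> half])
    show "flow_weight ((1 + \<delta> / 4) * t) i > 0" for i :: "'n option"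
      by (simp add: flow_weight_def split: option.split)
    show "flow_weight ((1 + \<delta> / 4) * t) (Some j) \<le> 1" for j :: 'n
      using t \<delta> by (simp add: flow_weight_def)
  qed (simp_all add: prod_flow_weight)
  also have "\<dots> \<le> (\<Sum>i<CARD('n option). cell_index ^ Suc i) *
      ennreal (C * (exp (- (\<delta> / 4 * t)) / \<rho>) powr \<alpha>) * 1"
    using emeasure_cells_le_1[OF b0] by (intro mult_left_mono) auto
  finally have H_le: "outer H \<le> (\<Sum>i<CARD('n option). cell_index ^ Suc i) *
      ennreal (C * (exp (- (\<delta> / 4 * t)) / \<rho>) powr \<alpha>)"
    by simp
  have "outer {x \<in> b0. \<exists>i\<in>I. g i x < \<eta>} \<le>
      2 * outer H + ennreal (C * (\<eta> / \<eta>') powr \<alpha>) * cell_index * 2 * emeasure lam b0"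
  proof (rule outer_transference[OF b0])
    have "countable (UNIV :: 'k poly set)"
      by (rule countable_UNIV_poly)
    then have "countable ((UNIV :: 'k poly set) \<times> {q :: 'k poly ^ 'n. \<forall>i. q $ i \<in> UNIV})"
      by (intro countable_SIGMA countable_vec_in)
    then show "countable I"
      by (rule countable_subset[rotated]) auto
    show "good_on C \<alpha> b0 (g i)" if "i \<in> I" for i
    proof -
      obtain p q where i: "i = (p, q)" by (cases i)
      show ?thesis
        unfolding i g_eq by (rule good)
    qed
    \<comment> \<open>Since \<open>q \<noteq> 0\<close>, some coefficient has absolute value at
      least 1; the constant term may be arbitrary, so the bound is uniform in \<theta>.\<close>
    show "\<exists>x\<in>b0. g i x \<ge> \<eta>'" if "i \<in> I" for i
    proof -
      obtain p q where i: "i = (p, q)" by (cases i)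
      then have "q \<noteq> 0"
        using that by (simp add: I_def)
      then have "\<exists>i. fls_abs ((\<chi> i. poly_in_T (q $ i)) $ i) \<ge> 1"
        using fls_abs_vec_poly_ge_1[of q] by simp
      then have "\<exists>x\<in>b0. g i x \<ge> \<rho>"
        unfolding i g_eq by (intro low) auto
      then show ?thesis
        using \<open>exp (- (?n * (1 + \<delta> / 2) * t)) \<le> \<rho>\<close> unfolding \<eta>'_def by (meson order_trans)
    qed
    show "C * (\<eta> / \<eta>') powr \<alpha> \<le> 1/2"
      using half' unfolding ratio .
    show "x \<in> H" if ij: "i \<in> I" "j \<in> I" "i \<noteq> j" "x \<in> b0" "g i x < \<eta>'" "g j x < \<eta>'" for i j x
    proof -
      obtain p q p' q' where eq: "i = (p, q)" "j = (p', q')"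
        by (metis surj_pair)
      have "approx_solution (f x) 0 \<eta>' t (p - p') (q - q')"
      proof (rule approx_solution_diff)
        show "approx_solution (f x) \<theta> \<eta>' t p q" "approx_solution (f x) \<theta> \<eta>' t p' q'"
          using ij unfolding eq by (simp_all add: sol_iff)
        show "\<eta>' \<le> 1"
          using t \<delta> by (simp add: \<eta>'_def)
        show "(p, q) \<noteq> (p', q')"
          using ij(3) by (simp add: eq)
      qed
      then show ?thesis
        using ij(4) unfolding H_def by blast
    qed
  qed (simp_all add: \<eta>_def \<eta>'_def)
  also have "\<dots> \<le> 2 * ((\<Sum>i<CARD('n option). cell_index ^ Suc i) *
      ennreal (C * (exp (- (\<delta> / 4 * t)) / \<rho>) powr \<alpha>)) +
      ennreal (C * exp (- (?n * \<delta> / 2 * t)) powr \<alpha>) * cell_index * 2 * 1"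
    unfolding ratio using H_le emeasure_cells_le_1[OF b0] by (intro add_mono mult_left_mono) auto
  also have "{x \<in> b0. \<exists>i\<in>I. g i x < \<eta>} = {x \<in> b0. \<exists>p q. approx_solution (f x) \<theta> \<eta> t p q}"
    by (auto simp: sol_iff)
  finally show ?thesis
    by (simp add: \<eta>_def)
qed

lemma AE_inhom_exponent_le_1_cell:
  fixes f :: "'k fls ^ 'd \<Rightarrow> 'k fls ^ ('n::finite)" and \<theta> :: "'k fls"
  assumes b0: "b0 \<in> cells" and pos: "C > 0" "\<alpha> > 0"
    and good: "\<And>a0 a. good_on C \<alpha> b0 (\<lambda>x. fls_abs (a0 + (\<Sum>i\<in>UNIV. a $ i * f x $ i)))"
    and low: "\<And>a0 a. fls_abs a0 \<ge> 1 \<or> (\<exists>i. fls_abs (a $ i) \<ge> 1) \<Longrightarrow>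
      \<exists>x\<in>b0. fls_abs (a0 + (\<Sum>i\<in>UNIV. a $ i * f x $ i)) \<ge> \<rho>"
    and \<rho>: "0 < \<rho>" "\<rho> \<le> 1"
  shows "AE x in lam. x \<in> b0 \<longrightarrow> inhom_exponent (f x) \<theta> \<le> 1"
proof -
  let ?n = "real CARD('n)"
  \<comment> \<open>The solution of
    \<open>C * (\<sigma> / \<rho>) powr \<alpha> = 1/2\<close>.\<close>
  define \<sigma> where "\<sigma> = \<rho> * (1 / (2 * C)) powr (1 / \<alpha>)"
  have "\<sigma> > 0"
    using \<rho> pos by (simp add: \<sigma>_def)
  have half: "C * (\<sigma> / \<rho>) powr \<alpha> \<le> 1/2"
    using \<rho> pos by (simp add: \<sigma>_def powr_powr)
  have main: "AE x in lam. x \<in> b0 \<longrightarrow> (\<forall>\<^sub>F t in sequentially.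
      \<not> (\<exists>p q. approx_solution (f x) \<theta> (exp (- (?n * (1 + \<delta>) * real t))) (real t) p q))"
    if \<delta>: "\<delta> > 0" for \<delta>
  proof -
    define E where "E t = {x \<in> b0. \<exists>p q. approx_solution (f x) \<theta> (exp (- (?n * (1 + \<delta>) * real t))) (real t) p q}" for t
    define k0 where "k0 = (\<Sum>i<CARD('n option). CARD('k ^ 'd) ^ Suc i)"
    define A where "A = 2 * (real k0 * (C * \<rho> powr (- \<alpha>))) + C * real CARD('k ^ 'd) * 2"
    \<comment> \<open>The decay rate of the short vector term. The goodness term has rate
      n\<delta>\<alpha>/2, which is at least as large since n \<ge> 1.\<close>
    define \<gamma> where "\<gamma> = \<delta> * \<alpha> / 4"
    have "\<gamma> > 0"
      using \<delta> pos by (simp add: \<gamma>_def)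
    have "A \<ge> 0"
      using pos \<rho> by (auto simp: A_def)
    have n: "?n \<ge> 1"
      by (simp add: Suc_le_eq)
    have "\<forall>\<^sub>F t in sequentially. exp (- (\<delta> / 4 * real t)) \<le> \<sigma> \<and>
        exp (- (?n * (1 + \<delta> / 2) * real t)) \<le> \<rho> \<and> exp (- (?n * \<delta> * \<alpha> / 2 * real t)) \<le> 1 / (2 * C)"
      using \<delta> \<rho> pos \<open>\<sigma> > 0\<close> n by (intro eventually_conj eventually_exp_le) (auto intro!: mult_pos_pos)
    then obtain t0 where t0: "\<And>t. t \<ge> t0 \<Longrightarrow> exp (- (\<delta> / 4 * real t)) \<le> \<sigma>"
      "\<And>t. t \<ge> t0 \<Longrightarrow> exp (- (?n * (1 + \<delta> / 2) * real t)) \<le> \<rho>"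
      "\<And>t. t \<ge> t0 \<Longrightarrow> exp (- (?n * \<delta> * \<alpha> / 2 * real t)) \<le> 1 / (2 * C)"
      unfolding eventually_sequentially by blast
    have bound: "outer (E t) \<le> ennreal (A * exp (- (\<gamma> * real t)))" if t: "t \<ge> t0" for t
    proof -
      have p1: "exp (- (?n * \<delta> / 2 * real t)) powr \<alpha> = exp (- (?n * \<delta> * \<alpha> / 2 * real t))"
        by (simp add: powr_def algebra_simps)
      have p2: "(exp (- (\<delta> / 4 * real t)) / \<rho>) powr \<alpha> = exp (- (\<gamma> * real t)) * \<rho> powr (- \<alpha>)"
      proof -
        have "(exp (- (\<delta> / 4 * real t)) / \<rho>) powr \<alpha> = exp (- (\<delta> / 4 * real t)) powr \<alpha> / \<rho> powr \<alpha>"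
          using \<rho> by (simp add: powr_divide)
        also have "exp (- (\<delta> / 4 * real t)) powr \<alpha> = exp (- (\<gamma> * real t))"
          by (simp add: powr_def \<gamma>_def algebra_simps)
        finally show ?thesis
          by (simp add: powr_minus_divide)
      qed
      have "outer (E t) \<le> 2 * ((\<Sum>i<CARD('n option). cell_index ^ Suc i) *
            ennreal (C * (exp (- (\<delta> / 4 * real t)) / \<rho>) powr \<alpha>)) +
          ennreal (C * exp (- (?n * \<delta> / 2 * real t)) powr \<alpha>) * cell_index * 2"
        unfolding E_def
      proof (rule outer_approx_solutions[OF b0 good low \<rho> half \<delta> _ t0(1,2)[OF t]])
        show "C * exp (- (?n * \<delta> / 2 * real t)) powr \<alpha> \<le> 1/2"
          unfolding p1 using mult_left_mono[OF t0(3)[OF t], of C] pos by simp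
      qed auto
      also have "(\<Sum>i<CARD('n option). cell_index ^ Suc i) = ennreal (real k0)"
      proof -
        have "(\<Sum>i<CARD('n option). cell_index ^ Suc i) = of_nat k0"
          unfolding cell_index_def k0_def by simp
        then show ?thesis
          by (simp only: ennreal_of_nat_eq_real_of_nat)
      qed
      also have "cell_index = ennreal (real CARD('k ^ 'd))"
        by (simp add: cell_index_def ennreal_of_nat_eq_real_of_nat)
      also have "2 * (ennreal (real k0) * ennreal (C * (exp (- (\<delta> / 4 * real t)) / \<rho>) powr \<alpha>)) +
          ennreal (C * exp (- (?n * \<delta> / 2 * real t)) powr \<alpha>) * ennreal (real CARD('k ^ 'd)) * 2 =
          ennreal (2 * (real k0 * (C * (exp (- (\<gamma> * real t)) * \<rho> powr (- \<alpha>)))) +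
            C * exp (- (?n * \<delta> * \<alpha> / 2 * real t)) * real CARD('k ^ 'd) * 2)"
        unfolding p1 p2 using pos
        by (simp add: ennreal_plus ennreal_mult' ennreal_mult'' flip: ennreal_numeral)
      also have "\<dots> \<le> ennreal (A * exp (- (\<gamma> * real t)))"
      proof (rule ennreal_leI)
        have "\<gamma> * real t \<le> ?n * \<delta> * \<alpha> / 2 * real t"
        proof (rule mult_right_mono)
          have "1 * (\<delta> * \<alpha>) \<le> ?n * (\<delta> * \<alpha>)"
            using n \<delta> pos by (intro mult_right_mono) auto
          moreover have "0 \<le> \<delta> * \<alpha>"
            using \<delta> pos by simp
          ultimately have "\<delta> * \<alpha> / 4 \<le> ?n * (\<delta> * \<alpha>) / 2"
            by linarith
          then show "\<gamma> \<le> ?n * \<delta> * \<alpha> / 2"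
            by (simp only: \<gamma>_def mult.assoc)
        qed simp
        then have "exp (- (?n * \<delta> * \<alpha> / 2 * real t)) \<le> exp (- (\<gamma> * real t))"
          by simp
        then have "C * exp (- (?n * \<delta> * \<alpha> / 2 * real t)) * real CARD('k ^ 'd) * 2 \<le>
            C * exp (- (\<gamma> * real t)) * real CARD('k ^ 'd) * 2"
          using pos by (intro mult_right_mono mult_left_mono) auto
        moreover have "A * exp (- (\<gamma> * real t)) =
            2 * (real k0 * (C * (exp (- (\<gamma> * real t)) * \<rho> powr (- \<alpha>)))) +
            C * exp (- (\<gamma> * real t)) * real CARD('k ^ 'd) * 2"
          unfolding A_def by (simp add: algebra_simps)
        ultimately show "2 * (real k0 * (C * (exp (- (\<gamma> * real t)) * \<rho> powr (- \<alpha>)))) +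
            C * exp (- (?n * \<delta> * \<alpha> / 2 * real t)) * real CARD('k ^ 'd) * 2 \<le> A * exp (- (\<gamma> * real t))"
          by (simp only: add_left_mono)
      qed
      finally show ?thesis .
    qed
    obtain G where G: "\<And>t. G t \<in> sets lam" "\<And>t. E t \<subseteq> G t" "\<And>t. outer (E t) = emeasure lam (G t)"
      using outer_attain[of "E _"] by metis
    \<comment> \<open>The bound is available from \<open>t0\<close> on. With the earlier sets
      emptied, one geometric series dominates the whole sequence.\<close>
    define G' where "G' t = (if t \<ge> t0 then G t else {})" for t
    have G'_le: "emeasure lam (G' t) \<le> ennreal (A * exp (- (\<gamma> * real t)))" for t
      using bound[of t] G(3)[of t] by (simp add: G'_def)
    have "AE x in lam. eventually (\<lambda>t. x \<in> space lam - G' t) sequentially"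
    proof (rule borel_cantelli_AE1)
      show "G' t \<in> sets lam" for t
        using G(1) by (simp add: G'_def)
      show "emeasure lam (G' t) < \<infinity>" for t
        by (rule le_less_trans[OF G'_le]) simp
      show "summable (\<lambda>t. measure lam (G' t))"
      proof (rule summable_comparison_test')
        have "summable (\<lambda>t. exp (- \<gamma>) ^ t)"
          using \<open>\<gamma> > 0\<close> by (intro summable_geometric) simp
        then have "summable (\<lambda>t. exp (- (\<gamma> * real t)))"
          by (simp add: exp_of_nat_mult[symmetric] mult.commute)
        then show "summable (\<lambda>t. A * exp (- (\<gamma> * real t)))"
          by (rule summable_mult)
        show "norm (measure lam (G' t)) \<le> A * exp (- (\<gamma> * real t))" if "t \<ge> 0" for t
          using enn2real_mono[OF G'_le[of t]] \<open>A \<ge> 0\<close> by (simp add: measure_def)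
      qed
    qed
    then show ?thesis
    proof eventually_elim
      fix x assume ev: "eventually (\<lambda>t. x \<in> space lam - G' t) sequentially"
      show "x \<in> b0 \<longrightarrow> (\<forall>\<^sub>F t in sequentially.
          \<not> (\<exists>p q. approx_solution (f x) \<theta> (exp (- (?n * (1 + \<delta>) * real t))) (real t) p q))"
      proof
        assume "x \<in> b0"
        from ev eventually_ge_at_top[of t0] show "\<forall>\<^sub>F t in sequentially.
          \<not> (\<exists>p q. approx_solution (f x) \<theta> (exp (- (?n * (1 + \<delta>) * real t))) (real t) p q)"
        proof eventually_elim
          fix t assume "x \<in> space lam - G' t" "t0 \<le> t"
          then have "x \<notin> E t"
            using G(2)[of t] by (auto simp: G'_def)
          then show "\<not> (\<exists>p q. approx_solution (f x) \<theta> (exp (- (?n * (1 + \<delta>) * real t))) (real t) p q)"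
            using \<open>x \<in> b0\<close> by (simp add: E_def)
        qed
      qed
    qed
  qed
  have "AE x in lam. \<forall>j. x \<in> b0 \<longrightarrow> (\<forall>\<^sub>F t in sequentially.
      \<not> (\<exists>p q. approx_solution (f x) \<theta> (exp (- (?n * (1 + 1 / real (Suc j)) * real t))) (real t) p q))"
    unfolding AE_all_countable by (intro allI main) simp
  then show ?thesis
  proof eventually_elim
    case (elim x)
    then show ?case
      by (intro impI inhom_exponent_le_1I) blast
  qed
qed

end

theorem theorem1p1:
  fixes lam :: "('k::{field,finite} fls ^ 'd) measure"
    and U :: "('k fls ^ 'd) set"
    and f :: "'k fls ^ 'd \<Rightarrow> 'k fls ^ 'n"
    and C \<alpha>\<^sub>0 :: real
  assumes "is_haar_measure lam"
    and "open U"
    and "C > 0" and "\<alpha>\<^sub>0 > 0"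
    and "good_map lam C \<alpha>\<^sub>0 U f"
    and "nonplanar lam U f"
  shows "\<forall>\<theta> :: 'k fls. AE x in lam. x \<in> U \<longrightarrow> inhom_exponent (f x) \<theta> \<le> 1"
proof
  fix \<theta> :: "'k fls"
  interpret haar lam
    by (rule haar.intro) (fact assms(1))
  define indep where "indep b \<longleftrightarrow> (\<forall>a0 (a :: 'k fls ^ 'n).
    (\<forall>x\<in>b. a0 + (\<Sum>i\<in>UNIV. a $ i * f x $ i) = 0) \<longrightarrow> a0 = 0 \<and> (\<forall>i. a $ i = 0))" for b
  \<comment> \<open>A countable family of cells with a uniform lower bound each; every nonplanar
    point of \<open>U\<close> lies in one of them.\<close>
  define B where "B = {b \<in> cells. b \<subseteq> U \<and> indep b}"
  have "AE x in lam. x \<in> b \<longrightarrow> inhom_exponent (f x) \<theta> \<le> 1" if b: "b \<in> B" for b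
  proof -
    have "indep b"
      using b by (simp add: B_def)
    note indep_b = this[unfolded indep_def, THEN spec, THEN spec, THEN mp]
    from exists_uniform_lower_bound[of b f, OF indep_b]
    obtain c where c: "c > 0 \<and> (\<forall>a0 a. (fls_abs a0 \<ge> 1 \<or> (\<exists>i. fls_abs (a $ i) \<ge> 1)) \<longrightarrow>
        (\<exists>x\<in>b. fls_abs (a0 + (\<Sum>i\<in>UNIV. a $ i * f x $ i)) \<ge> c))"
      by (rule exE)
    show ?thesis
    proof (rule AE_inhom_exponent_le_1_cell[OF _ assms(3,4)])
      show "b \<in> cells"
        using b by (simp add: B_def)
      show "good_on C \<alpha>\<^sub>0 b (\<lambda>x. fls_abs (a0 + (\<Sum>i\<in>UNIV. a $ i * f x $ i)))" for a0 a
      proof (rule good_on_good_fun[OF assms(2) _ _ assms(3,4)])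
        show "good_fun lam C \<alpha>\<^sub>0 U (\<lambda>x. a0 + (\<Sum>i\<in>UNIV. a $ i * f x $ i))"
          using assms(5) unfolding good_map_def by (elim allE)
        show "b \<subseteq> U"
          using b by (simp add: B_def)
      qed
      \<comment> \<open>The minimum with 1 keeps covolumes below the threshold at most 1, as the
        short vector argument requires.\<close>
      show "\<exists>x\<in>b. fls_abs (a0 + (\<Sum>i\<in>UNIV. a $ i * f x $ i)) \<ge> min c 1"
        if big: "fls_abs a0 \<ge> 1 \<or> (\<exists>i. fls_abs (a $ i) \<ge> 1)" for a0 and a :: "'k fls ^ 'n"
      proof -
        obtain x where "x \<in> b" "fls_abs (a0 + (\<Sum>i\<in>UNIV. a $ i * f x $ i)) \<ge> c"
          using c[THEN conjunct2, THEN spec, THEN spec, THEN mp, OF big] by (rule bexE)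
        then show ?thesis
          by (intro bexI[of _ x]) auto
      qed
    qed (use c[THEN conjunct1] in auto)
  qed
  moreover have "countable B"
    by (rule countable_subset[OF _ countable_cells]) (auto simp: B_def)
  ultimately have "AE x in lam. \<forall>b\<in>B. x \<in> b \<longrightarrow> inhom_exponent (f x) \<theta> \<le> 1"
    by (subst AE_ball_countable) auto
  moreover have "AE x in lam. x \<in> U \<longrightarrow> nonplanar_at U f x"
    using assms(6) by (simp add: nonplanar_def)
  ultimately show "AE x in lam. x \<in> U \<longrightarrow> inhom_exponent (f x) \<theta> \<le> 1"
  proof eventually_elim
    fix x assume x: "\<forall>b\<in>B. x \<in> b \<longrightarrow> inhom_exponent (f x) \<theta> \<le> 1" "x \<in> U \<longrightarrow> nonplanar_at U f x"
    show "x \<in> U \<longrightarrow> inhom_exponent (f x) \<theta> \<le> 1"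
    proof
      assume "x \<in> U"
      then obtain m where m: "cell x m \<subseteq> U"
        using open_contains_cell[OF assms(2)] by blast
      have np: "nonplanar_at U f x"
        using x(2) \<open>x \<in> U\<close> by blast
      have "indep (cell x m)"
        unfolding indep_def cell_def
        by (rule np[unfolded nonplanar_at_def, THEN spec, THEN mp, THEN mp, OF exp_gt_zero m[unfolded cell_def]])
      then have "cell x m \<in> B"
        using m by (simp add: B_def)
      then show "inhom_exponent (f x) \<theta> \<le> 1"
        using x(1) mem_cell_self by blast
    qed
  qed
qed

end
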